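(* Let $1<p<N$, $p^*=\frac{Np}{N-p}$, $0\le\mu<\left(\frac{N-p}{p}\right)^p$. Let $Q\in L^\infty(\mathbb{R}^N)$ be a nonnegative function and let $u\in\mathcal{D}^{1,p}(\mathbb{R}^N)$ be a nonnegative weak solution of $$-\Delta_p u-\frac{\mu}{|x|^p}|u|^{p-2}u=Q(x)|u|^{p^*-2}u,\qquad x\in\mathbb{R}^N.$$ Then $$u(x)\ge m|x|^{-\gamma_1}\quad\text{for } |x|<1,$$ and $$u(x)\ge m|x|^{-\gamma_2}\quad\text{for } |x|>1,$$ where $m=\inf_{\partial B_1(0)}u$.
   Context: $\Delta_p u=\operatorname{div}(|\nabla u|^{p-2}\nabla u)$. $\mathcal{D}^{1,p}(\mathbb{R}^N)=\{v\in L^{p^*}(\mathbb{R}^N): v \text{ weakly differentiable and } \nabla v\in L^p(\mathbb{R}^N)\}$. $B_1(0)$ is the unit ball centered at the origin. A function $u\in\mathcal{D}^{1,p}(\mathbb{R}^N)$ is a weak subsolution of the equation if for every nonnegative $\varphi\in C_0^\infty(\mathbb{R}^N)$, $$\int_{\mathbb{R}^N}\Big(|\nabla u|^{p-2}\nabla u\cdot\nabla\varphi-\frac{\mu}{|x|^p}|u|^{p-2}u\varphi\Big)\le\int_{\mathbb{R}^N}Q|u|^{p^*-2}u\varphi .$$ It is a weak supersolution if $-u$ is a weak subsolution, and a weak solution if it is both. Pointwise inequalities hold almost everywhere; $\inf_{\partial B_1(0)}u$ is computed with the representative of $u$ that is continuous on $\mathbb{R}^N\setminus\{0\}$. $\gamma_1<\gamma_2$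 are the two roots in $[0,\infty)$ of $\gamma^{p-2}[(p-1)\gamma^2-(N-p)\gamma]+\mu=0$ (the left side being read as $(p-1)\gamma^p-(N-p)\gamma^{p-1}+\mu$). They satisfy $0\le\gamma_1<\frac{N-p}{p}<\gamma_2\le\frac{N-p}{p-1}$. *)

theory Defs
  imports "HOL-Analysis.Analysis"
begin

definition partial_deriv :: "'n \<Rightarrow> (real^'n \<Rightarrow> real) \<Rightarrow> real^'n \<Rightarrow> real" where
  "partial_deriv i f x = frechet_derivative f (at x) (axis i 1)"

definition gradient :: "(real^'n \<Rightarrow> real) \<Rightarrow> real^'n \<Rightarrow> real^'n" where
  "gradient f x = (\<chi> i. partial_deriv i f x)"

primrec Ck :: "nat \<Rightarrow> (real^'n \<Rightarrow> real) \<Rightarrow> bool" where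
  "Ck 0 f \<longleftrightarrow> continuous_on UNIV f"
| "Ck (Suc k) f \<longleftrightarrow> f differentiable_on UNIV \<and> (\<forall>i. Ck k (partial_deriv i f))"

definition test_function :: "(real^'n \<Rightarrow> real) \<Rightarrow> bool" where
  "test_function \<phi> \<longleftrightarrow> (\<forall>k. Ck k \<phi>) \<and> compact (closure {x. \<phi> x \<noteq> 0})"

definition locally_integrable :: "('a::euclidean_space \<Rightarrow> 'b::euclidean_space) \<Rightarrow> bool" where
  "locally_integrable f \<longleftrightarrow> (\<forall>K. compact K \<longrightarrow> f absolutely_integrable_on K)"

definition in_Lp :: "real \<Rightarrow> ('a::euclidean_space \<Rightarrow> 'b::euclidean_space) \<Rightarrow> bool" where
  "in_Lp p f \<longleftrightarrow> f \<in> borel_measurable lebesgue \<and> integrable lebesgue (\<lambda>x. norm (f x) powr p)"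

definition in_Linfty :: "('a::euclidean_space \<Rightarrow> real) \<Rightarrow> bool" where
  "in_Linfty f \<longleftrightarrow> f \<in> borel_measurable lebesgue \<and> (\<exists>C. AE x in lebesgue. \<bar>f x\<bar> \<le> C)"

definition has_weak_gradient :: "(real^'n \<Rightarrow> real) \<Rightarrow> (real^'n \<Rightarrow> real^'n) \<Rightarrow> bool" where
  "has_weak_gradient u g \<longleftrightarrow> locally_integrable u \<and> locally_integrable g \<and>
     (\<forall>\<phi>. test_function \<phi> \<longrightarrow> (\<forall>i.
        integral\<^sup>L lebesgue (\<lambda>x. u x * partial_deriv i \<phi> x)
          = - integral\<^sup>L lebesgue (\<lambda>x. g x $ i * \<phi> x)))"

definition weakly_differentiable :: "(real^'n \<Rightarrow> real) \<Rightarrow> bool" where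
  "weakly_differentiable u \<longleftrightarrow> (\<exists>g. has_weak_gradient u g)"

text \<open>Weak gradients are unique up to null sets, so the choice made here is immaterial
  wherever only integrals of it are used.\<close>

definition weak_grad :: "(real^'n \<Rightarrow> real) \<Rightarrow> real^'n \<Rightarrow> real^'n" where
  "weak_grad u = (SOME g. has_weak_gradient u g)"

definition crit_exp :: "real \<Rightarrow> real \<Rightarrow> real" where
  "crit_exp N p = N * p / (N - p)"

definition D1p :: "real \<Rightarrow> (real^'n \<Rightarrow> real) set" where
  "D1p p = {v. in_Lp (crit_exp (real CARD('n)) p) v \<and>
               weakly_differentiable v \<and> in_Lp p (weak_grad v)}"

text \<open>Both integrands are integrable for \<open>u \<in> D1p p\<close> and bounded \<open>Q\<close> when \<open>1 < p < N\<close>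
  (by the Hardy inequality for the singular term), so the convention that the Bochner integral
  of a non-integrable function is \<open>0\<close> plays no role. Since \<open>0 powr a = 0\<close>, the vector
  \<open>norm v powr (p - 2) *\<^sub>R v\<close> is \<open>0\<close> at \<open>v = 0\<close>, also for \<open>p < 2\<close>.\<close>

definition weak_subsolution ::
    "real \<Rightarrow> real \<Rightarrow> (real^'n \<Rightarrow> real) \<Rightarrow> (real^'n \<Rightarrow> real) \<Rightarrow> bool" where
  "weak_subsolution p \<mu> Q u \<longleftrightarrow> u \<in> D1p p \<and>
     (\<forall>\<phi>. test_function \<phi> \<and> (\<forall>x. 0 \<le> \<phi> x) \<longrightarrow>
        integral\<^sup>L lebesgue (\<lambda>x.
            (norm (weak_grad u x) powr (p - 2) *\<^sub>R weak_grad u x) \<bullet> gradient \<phi> x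
            - \<mu> / norm x powr p * \<bar>u x\<bar> powr (p - 2) * u x * \<phi> x)
        \<le> integral\<^sup>L lebesgue (\<lambda>x.
            Q x * \<bar>u x\<bar> powr (crit_exp (real CARD('n)) p - 2) * u x * \<phi> x))"

definition weak_supersolution ::
    "real \<Rightarrow> real \<Rightarrow> (real^'n \<Rightarrow> real) \<Rightarrow> (real^'n \<Rightarrow> real) \<Rightarrow> bool" where
  "weak_supersolution p \<mu> Q u \<longleftrightarrow> weak_subsolution p \<mu> Q (\<lambda>x. - u x)"

definition weak_solution ::
    "real \<Rightarrow> real \<Rightarrow> (real^'n \<Rightarrow> real) \<Rightarrow> (real^'n \<Rightarrow> real) \<Rightarrow> bool" where
  "weak_solution p \<mu> Q u \<longleftrightarrow> weak_subsolution p \<mu> Q u \<and> weak_supersolution p \<mu> Q u"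

text \<open>\<open>0 powr a = 0\<close> agrees with \<open>0\<^sup>p = 0\<^sup>p\<^sup>-\<^sup>1 = 0\<close> for \<open>p > 1\<close>, so \<open>\<gamma> = 0\<close> is treated correctly.\<close>

definition gamma_roots :: "real \<Rightarrow> real \<Rightarrow> real \<Rightarrow> real set" where
  "gamma_roots N p \<mu> =
     {\<gamma>. 0 \<le> \<gamma> \<and> (p - 1) * \<gamma> powr p - (N - p) * \<gamma> powr (p - 1) + \<mu> = 0}"

text \<open>For a given \<open>u\<close> any two such representatives agree on the complement of \<open>0\<close>.\<close>

definition continuous_rep :: "(real^'n \<Rightarrow> real) \<Rightarrow> (real^'n \<Rightarrow> real) \<Rightarrow> bool" where
  "continuous_rep u v \<longleftrightarrow> continuous_on (UNIV - {0}) v \<and> (AE x in lebesgue. v x = u x)"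

end

theory Submission
  imports Defs
begin

text \<open>
  Only the supersolution property of \<open>u\<close> and \<open>Q \<ge> 0\<close> matter. Write \<open>w = m |x|\<^sup>-\<^sup>\<gamma>\<close>,
  \<open>f = ln (u / w)\<close>, \<open>G = \<nabla>u / u\<close>, \<open>H = \<nabla>w / w\<close>. Testing the inequality for \<open>u\<close> with
  \<open>\<eta> w\<^sup>p u\<^sup>1\<^sup>-\<^sup>p k(f)\<close> and the equation for \<open>w\<close> with \<open>\<eta> w k(f)\<close>, where \<open>k\<close> is nonincreasing and
  vanishes on \<open>[0, \<infinity>)\<close> and \<open>\<eta>\<close> is a cutoff in \<open>ln |x|\<close>, the singular terms cancel and Picone's
  inequality leaves
  \<open>\<integral> \<eta> k(f) w\<^sup>p R(G, H) \<le> \<integral> k(f) w\<^sup>p (|G|\<^sup>p\<^sup>-\<^sup>2 G - |H|\<^sup>p\<^sup>-\<^sup>2 H) \<bullet> \<nabla>\<eta>\<close>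
  with a remainder \<open>R \<ge> 0\<close> that vanishes only for \<open>G = H\<close>. As \<open>\<gamma>\<^sub>1 < (N - p) / p < \<gamma>\<^sub>2\<close>, the function
  \<open>w\<^sup>p |x|\<^sup>-\<^sup>p\<close> is integrable on the relevant side of the sphere; this bounds \<open>k(f) w\<^sup>p |G|\<^sup>p\<close> in \<open>L\<^sup>1\<close>
  (a logarithmic Caccioppoli estimate), and since \<open>|\<nabla>\<eta>| \<le> C / (n |x|)\<close> is possible the right-hand
  side tends to 0. Hence \<open>G = H\<close> where \<open>f < 0\<close>, and integrating \<open>k(f)\<close> against the divergence-free
  field \<open>|x|\<^sup>-\<^sup>N x\<close> gives \<open>f \<ge> 0\<close>. The division by \<open>u\<close> is justified by first running the argument with
  \<open>\<mu> = 0\<close> and \<open>u + s\<close>, \<open>s > 0\<close>, in place of \<open>u\<close>, which shows that \<open>u\<close> is positive.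
\<close>

subsection \<open>Smooth functions and gradients\<close>

text \<open>The test functions contain \<open>ln (u / w)\<close>, while only a continuous
  representative and a weak gradient of \<open>u\<close> are at hand, so they are not even C1.
  Mollifying \<open>u\<close> inside the logarithm repairs this; as \<open>plap p (g x)\<close> lies
  only in the dual Lebesgue space, the limit is taken through a weighted L1 estimate for the
  mollified gradient. All of this happens on compact sets away from the origin. The equation for
  \<open>w\<close> enters as a divergence identity: its flux is a multiple of |x|^-alpha x with
  alpha = p + gamma (p - 1), the divergence of |x|^-alpha x is (N - alpha) |x|^-alpha, and the root
  equation says nu = gamma^(p-1) (N - alpha), where nu is mu or 0. The same identity with alpha =
  gamma p + p bounds the integrals of the weight w^p |x|^-p, and with alpha = N it gives the last
  step. The cutoff must rise from 0 somewhere. Lowering m to t m with t < 1, or raising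
  \<open>u\<close> by a constant, makes the inequality strict near the unit sphere, so k(f) vanishes
  where the cutoff rises and only its slow descent, of slope O(1/n), is felt.\<close>

lemma partial_deriv_eq: "GDERIV f x :> D \<Longrightarrow> partial_deriv i f x = D $ i"
  unfolding partial_deriv_def gderiv_def
  by (simp add: frechet_derivative_at [symmetric] inner_axis')

lemma gradient_eq: "GDERIV f x :> D \<Longrightarrow> gradient f x = D"
  by (simp add: gradient_def partial_deriv_eq vec_eq_iff)

lemma GDERIV_gradient:
  fixes f :: "real^'n \<Rightarrow> real"
  assumes "f differentiable (at x)"
  shows "GDERIV f x :> gradient f x"
proof -
  let ?F = "frechet_derivative f (at x)"
  have d: "(f has_derivative ?F) (at x)"
    using assms frechet_derivative_works by blast
  then interpret F: linear ?F by (rule has_derivative_linear)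
  have "?F h = h \<bullet> gradient f x" for h
  proof -
    have "?F h = ?F (\<Sum>i\<in>UNIV. (h $ i) *\<^sub>R axis i 1)"
      using basis_expansion[of h] by (simp add: scalar_mult_eq_scaleR)
    also have "\<dots> = h \<bullet> gradient f x"
      by (simp add: F.sum F.scaleR inner_vec_def gradient_def partial_deriv_def)
    finally show ?thesis .
  qed
  then have "?F = (\<lambda>h. h \<bullet> gradient f x)" by auto
  with d show ?thesis by (simp add: gderiv_def)
qed

lemma Ck_1_continuous_gradient: "Ck (Suc 0) f \<Longrightarrow> continuous_on UNIV (gradient f)"
  unfolding gradient_def by (simp add: continuous_on_vec_lambda)

text \<open>\<open>Ck\<close> is phrased with \<open>frechet_derivative\<close>, which is a choice.
  An explicit gradient formula pins the partial derivatives down, and the smoothness proofs below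
  run through this rule.\<close>

lemma Ck_SucI:
  assumes "\<And>x. GDERIV f x :> D x" "\<And>i. Ck k (\<lambda>x. D x $ i)"
  shows "Ck (Suc k) f"
proof -
  have "partial_deriv i f = (\<lambda>x. D x $ i)" for i
    using assms(1) by (intro ext partial_deriv_eq)
  moreover have "f differentiable_on UNIV"
    using assms(1) by (auto simp: differentiable_on_def differentiable_def gderiv_def)
  ultimately show ?thesis using assms(2) by simp
qed

lemma Ck_SucD: "Ck (Suc k) f \<Longrightarrow> Ck k f"
  by (induction k arbitrary: f) (auto intro: differentiable_imp_continuous_on)

lemma Ck_Suc_GDERIV: "Ck (Suc k) f \<Longrightarrow> GDERIV f x :> gradient f x"
  by (intro GDERIV_gradient) (simp add: differentiable_on_def)

lemma Ck_Suc_gradient: "Ck (Suc k) f \<Longrightarrow> Ck k (\<lambda>x. gradient f x $ i)"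
  by (simp add: gradient_def)

lemma Ck_const: "Ck k (\<lambda>x. c)"
proof (induction k arbitrary: c)
  case (Suc k)
  show ?case by (rule Ck_SucI[where D="\<lambda>_. 0"]) (auto simp: Suc gderiv_def)
qed auto

lemma Ck_add: "Ck k f \<Longrightarrow> Ck k g \<Longrightarrow> Ck k (\<lambda>x. f x + g x)"
proof (induction k arbitrary: f g)
  case (Suc k)
  show ?case
  proof (rule Ck_SucI)
    show "GDERIV (\<lambda>x. f x + g x) x :> gradient f x + gradient g x" for x
      by (intro GDERIV_add Suc.prems[THEN Ck_Suc_GDERIV])
    show "Ck k (\<lambda>x. (gradient f x + gradient g x) $ i)" for i
      using Suc.IH[OF Suc.prems[THEN Ck_Suc_gradient]] by simp
  qed
qed (auto intro!: continuous_intros)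

lemma Ck_mult: "Ck k f \<Longrightarrow> Ck k g \<Longrightarrow> Ck k (\<lambda>x. f x * g x)"
proof (induction k arbitrary: f g)
  case (Suc k)
  show ?case
  proof (rule Ck_SucI)
    show "GDERIV (\<lambda>x. f x * g x) x :> f x *\<^sub>R gradient g x + g x *\<^sub>R gradient f x" for x
      by (intro GDERIV_mult Suc.prems[THEN Ck_Suc_GDERIV])
    show "Ck k (\<lambda>x. (f x *\<^sub>R gradient g x + g x *\<^sub>R gradient f x) $ i)" for i
      using Suc.prems[THEN Ck_SucD] Suc.prems[THEN Ck_Suc_gradient] by (simp add: Ck_add Suc.IH)
  qed
qed (auto intro!: continuous_intros)

lemma Ck_component: "Ck k (\<lambda>x::real^'n. x $ i)"
proof (cases k)
  case (Suc m)
  show ?thesis unfolding Suc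
  proof (rule Ck_SucI)
    show "GDERIV (\<lambda>x. x $ i) x :> axis i 1" for x :: "real^'n"
      unfolding gderiv_def inner_axis
      by (auto intro!: bounded_linear_imp_has_derivative bounded_linear_vec_nth)
  qed (rule Ck_const)
qed (auto intro!: continuous_intros)

text \<open>The factor \<open>c\<close> is there for the induction: each derivative of
  \<open>f (x - y)\<close> in \<open>y\<close> produces a factor -1, which \<open>c\<close>
  absorbs.\<close>

lemma Ck_reflect:
  assumes "Ck k f" shows "Ck k (\<lambda>y. c * f (x - y))"
  using assms
proof (induction k arbitrary: f c)
  case (Suc k)
  show ?case
  proof (rule Ck_SucI)
    show "GDERIV (\<lambda>y. c * f (x - y)) y :> (- c) *\<^sub>R gradient f (x - y)" for y
    proof -
      have "((\<lambda>y. x - y) has_derivative (\<lambda>h. - h)) (at y)"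
        by (auto intro!: derivative_eq_intros)
      from has_derivative_compose[OF this, of f "\<lambda>h. h \<bullet> gradient f (x - y)"]
      have "((\<lambda>y. f (x - y)) has_derivative (\<lambda>h. - h \<bullet> gradient f (x - y))) (at y)"
        using Ck_Suc_GDERIV[OF Suc.prems, of "x - y"] by (simp add: gderiv_def)
      from has_derivative_mult_right[OF this, of c] show ?thesis
        by (simp add: gderiv_def)
    qed
    show "Ck k (\<lambda>y. ((- c) *\<^sub>R gradient f (x - y)) $ i)" for i
      using Suc.IH[OF Ck_Suc_gradient[OF Suc.prems], of "-c"] by simp
  qed
next
  case 0
  then show ?case
    by (auto intro!: continuous_intros continuous_on_compose2[of UNIV f])
qed

subsection \<open>A smooth bump function\<close>

text \<open>The functions P(1/t) exp(-1/t), extended by 0, form a class closed under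
  differentiation. Carrying the polynomial along turns smoothness of exp(-1/t) into a single
  induction.\<close>

definition bump_fun :: "real poly \<Rightarrow> real \<Rightarrow> real" where
  "bump_fun P t = (if t > 0 then poly P (inverse t) * exp (- inverse t) else 0)"

lemma poly_div_exp_tendsto_0:
  fixes P :: "real poly"
  shows "((\<lambda>s. poly P s * exp (- s)) \<longlongrightarrow> 0) at_top"
proof -
  have "((\<lambda>s. \<Sum>i\<le>degree P. coeff P i * (s ^ i / exp s)) \<longlongrightarrow> (\<Sum>i\<le>degree P. coeff P i * 0)) at_top"
    by (intro tendsto_intros tendsto_power_div_exp_0)
  then show ?thesis
    by (simp add: poly_altdef exp_minus sum_distrib_right divide_inverse mult.assoc)
qed

text \<open>With s = 1/t the quotient is s P(s) exp(-s) for t > 0, which tends to 0 as s grows. It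
  is the difference quotient at 0, the one point where the derivative is not read off from a
  formula.\<close>

lemma bump_fun_div_tendsto_0: "((\<lambda>t. bump_fun P t / t) \<longlongrightarrow> 0) (at 0)"
proof (rule filterlim_split_at_real)
  show "((\<lambda>t. bump_fun P t / t) \<longlongrightarrow> 0) (at_left 0)"
    by (rule tendsto_eventually) (auto simp: eventually_at bump_fun_def intro!: exI[of _ 1])
  have "((\<lambda>t. poly (pCons 0 P) (inverse t) * exp (- inverse t)) \<longlongrightarrow> 0) (at_right (0::real))"
    by (rule filterlim_compose[OF poly_div_exp_tendsto_0 filterlim_inverse_at_top_right])
  moreover have "eventually (\<lambda>t. poly (pCons 0 P) (inverse t) * exp (- inverse t) = bump_fun P t / t) (at_right (0::real))"
    by (auto simp: eventually_at bump_fun_def field_simps intro!: exI[of _ 1])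
  ultimately show "((\<lambda>t. bump_fun P t / t) \<longlongrightarrow> 0) (at_right 0)"
    using filterlim_cong by force
qed

text \<open>For t > 0 the derivative of P(1/t) exp(-1/t) is t^-2 (P - P')(1/t) exp(-1/t);
  multiplication by \<open>[:0, 0, 1:]\<close> is the factor t^-2.\<close>

lemma DERIV_bump_fun: "DERIV (bump_fun P) t :> bump_fun ([:0, 0, 1:] * (P - pderiv P)) t"
proof -
  consider "t < 0" | "t = 0" | "t > 0" by linarith
  then show ?thesis
  proof cases
    case 1
    have "DERIV (\<lambda>_. 0::real) t :> 0" by simp
    then have "DERIV (bump_fun P) t :> 0"
      by (rule has_field_derivative_transform_within_open[of _ _ _ "{..<0}"]) (use 1 in \<open>auto simp: bump_fun_def\<close>)
    then show ?thesis using 1 by (simp add: bump_fun_def)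
  next
    case 2
    then show ?thesis
      using bump_fun_div_tendsto_0[of P] by (simp add: DERIV_def bump_fun_def)
  next
    case 3
    have "DERIV (\<lambda>t. poly P (inverse t) * exp (- inverse t)) t :>
       bump_fun ([:0, 0, 1:] * (P - pderiv P)) t"
      using 3 by (auto intro!: derivative_eq_intros DERIV_chain2[OF poly_DERIV]
        simp: bump_fun_def power2_eq_square algebra_simps)
    then show ?thesis
      by (rule has_field_derivative_transform_within_open[of _ _ _ "{0<..}"]) (use 3 in \<open>auto simp: bump_fun_def\<close>)
  qed
qed

lemma Ck_bump_fun: "Ck k (\<lambda>x::real^'n. bump_fun P (c - x \<bullet> x))"
proof (induction k arbitrary: P)
  case 0
  have "continuous_on UNIV (bump_fun P)"
    using DERIV_bump_fun by (metis DERIV_isCont continuous_at_imp_continuous_on)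
  then show ?case
    by (auto intro!: continuous_intros continuous_on_compose2[of UNIV "bump_fun P"])
next
  case (Suc k)
  let ?P = "[:0, 0, 1:] * (P - pderiv P)"
  show ?case
  proof (rule Ck_SucI)
    fix x :: "real^'n"
    have "GDERIV (\<lambda>x. c - x \<bullet> x) x :> (-2) *\<^sub>R x"
      unfolding gderiv_def by (auto intro!: derivative_eq_intros simp: inner_commute)
    from GDERIV_DERIV_compose[OF this DERIV_bump_fun]
    show "GDERIV (\<lambda>x. bump_fun P (c - x \<bullet> x)) x :> bump_fun ?P (c - x \<bullet> x) *\<^sub>R ((-2) *\<^sub>R x)" .
  next
    fix i
    have "Ck k (\<lambda>x::real^'n. bump_fun ?P (c - x \<bullet> x) * ((-2) * x $ i))"
      by (intro Ck_mult Ck_const Ck_component Suc.IH)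
    then show "Ck k (\<lambda>x::real^'n. (bump_fun ?P (c - x \<bullet> x) *\<^sub>R ((-2) *\<^sub>R x)) $ i)" by (simp add: mult.assoc)
  qed
qed

section \<open>Existence of mollifying kernels\<close>

lemma compact_closure_supportI:
  fixes f :: "real^'n \<Rightarrow> real"
  assumes "bounded A" "\<And>x. x \<notin> A \<Longrightarrow> f x = 0"
  shows "compact (closure {x. f x \<noteq> 0})"
proof -
  have "{x. f x \<noteq> 0} \<subseteq> A" using assms(2) by blast
  then show ?thesis using assms(1) bounded_subset compact_closure by blast
qed

text \<open>Nonempty open sets have positive measure. This is how almost everywhere inequalities for
  functions continuous off the origin become pointwise ones.\<close>

lemma open_AE_empty:
  fixes S :: "'a::euclidean_space set"
  assumes "open S" "AE x in lborel. x \<notin> S"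
  shows "S = {}"
proof -
  have "S \<in> null_sets lborel"
    using assms AE_iff_null_sets[of S lborel] by simp
  then have "negligible S"
    by (simp add: negligible_iff_null_sets null_sets_completionI)
  then show ?thesis using open_not_negligible assms(1) by blast
qed

definition mollifier :: "real \<Rightarrow> (real^'n \<Rightarrow> real) \<Rightarrow> bool" where
  "mollifier e \<rho> \<longleftrightarrow> (\<forall>k. Ck k \<rho>) \<and> (\<forall>x. 0 \<le> \<rho> x) \<and> (\<forall>x. e \<le> norm x \<longrightarrow> \<rho> x = 0) \<and>
     integral\<^sup>L lborel \<rho> = 1"

lemma continuous_compact_support_integrable:
  fixes f :: "'a::euclidean_space \<Rightarrow> 'b::{banach, second_countable_topology}"
  assumes "continuous_on UNIV f" "compact A" "\<And>x. x \<notin> A \<Longrightarrow> f x = 0"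
  shows "integrable lborel f"
proof -
  have "(\<lambda>x. indicator A x *\<^sub>R f x) = f"
    using assms(3) by (auto simp: indicator_def fun_eq_iff)
  then show ?thesis
    using borel_integrable_compact[OF assms(2), of f] assms(1) continuous_on_subset by fastforce
qed

lemma mollifier_exists:
  assumes "e > 0"
  obtains \<rho> :: "real^'n \<Rightarrow> real" where "mollifier e \<rho>"
proof -
  define b :: "real^'n \<Rightarrow> real" where "b x = bump_fun 1 (e\<^sup>2 - x \<bullet> x)" for x
  have sm: "Ck k b" for k unfolding b_def by (rule Ck_bump_fun)
  have nn: "b x \<ge> 0" for x by (auto simp: b_def bump_fun_def)
  have supp: "b x = 0" if "e \<le> norm x" for x
  proof -
    have "e\<^sup>2 \<le> (norm x)\<^sup>2" using that assms by (intro power_mono) auto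
    then show ?thesis by (simp add: b_def bump_fun_def dot_square_norm)
  qed
  have cont: "continuous_on UNIV b" using sm[of 0] by simp
  have int: "integrable lborel b"
    using cont compact_cball by (rule continuous_compact_support_integrable[of _ "cball 0 e"]) (auto intro: supp)
  have "integral\<^sup>L lborel b \<noteq> 0"
  proof
    assume "integral\<^sup>L lborel b = 0"
    then have ae: "AE x in lborel. b x = 0"
      using integral_nonneg_eq_0_iff_AE[OF int] nn by simp
    have imp: "x \<notin> ball 0 e" if "b x = 0" for x
    proof
      assume "x \<in> ball 0 e"
      then have "(norm x)\<^sup>2 < e\<^sup>2" by (intro power_strict_mono) auto
      then show False using \<open>b x = 0\<close> by (simp add: b_def bump_fun_def dot_square_norm)
    qed
    from ae have "AE x::real^'n in lborel. x \<notin> ball 0 e"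
      by (rule eventually_mono) (rule imp)
    then have "ball (0::real^'n) e = {}" by (intro open_AE_empty) auto
    then show False using assms by simp
  qed
  moreover have "integral\<^sup>L lborel b \<ge> 0"
    by (rule Bochner_Integration.integral_nonneg) (rule nn)
  ultimately have pos: "integral\<^sup>L lborel b > 0" by linarith
  have "mollifier e (\<lambda>x. inverse (integral\<^sup>L lborel b) * b x)"
    unfolding mollifier_def using pos nn supp by (simp add: Ck_mult Ck_const sm)
  then show thesis by (rule that)
qed

subsection \<open>Compactly supported functions of class C1\<close>

text \<open>\<open>A\<close> is any compact set off which the function vanishes, not its exact
  support, so that a whole sequence of test functions can share one \<open>A\<close>.\<close>

definition C1c :: "(real^'n) set \<Rightarrow> (real^'n \<Rightarrow> real) \<Rightarrow> (real^'n \<Rightarrow> real^'n) \<Rightarrow> bool" where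
  "C1c A \<phi> D \<longleftrightarrow> compact A \<and> (\<forall>x. GDERIV \<phi> x :> D x) \<and> continuous_on UNIV D \<and> (\<forall>x. x \<notin> A \<longrightarrow> \<phi> x = 0)"

lemma GDERIV_unique:
  assumes "GDERIV f x :> D" "GDERIV f x :> E" shows "D = E"
proof -
  have "(\<lambda>h. h \<bullet> D) = (\<lambda>h. h \<bullet> E)"
    using assms unfolding gderiv_def by (rule has_derivative_unique)
  then show ?thesis by (metis vector_eq_ldot)
qed

lemma GDERIV_transform_open:
  assumes "GDERIV f x :> D" "open S" "x \<in> S" "\<And>y. y \<in> S \<Longrightarrow> f y = g y"
  shows "GDERIV g x :> D"
  using assms unfolding gderiv_def by (metis has_derivative_transform_within_open)

lemma GDERIV_isCont: "GDERIV f x :> D \<Longrightarrow> isCont f x"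
  unfolding gderiv_def by (rule has_derivative_continuous)

lemma C1cD:
  assumes "C1c A \<phi> D"
  shows "compact A" "GDERIV \<phi> x :> D x" "continuous_on UNIV D" "x \<notin> A \<Longrightarrow> \<phi> x = 0"
    "continuous_on UNIV \<phi>"
  using assms unfolding C1c_def
  by (auto intro!: continuous_at_imp_continuous_on GDERIV_isCont)

text \<open>\<open>A\<close> is closed, so the function vanishes on a whole neighbourhood of
  \<open>x\<close>.\<close>

lemma C1c_gradient_zero:
  assumes "C1c A \<phi> D" "x \<notin> A" shows "D x = 0"
proof (rule GDERIV_unique)
  show "GDERIV \<phi> x :> D x" using C1cD[OF assms(1)] by blast
  have "GDERIV (\<lambda>_. 0) x :> 0" by (rule GDERIV_const)
  then show "GDERIV \<phi> x :> 0"
    by (rule GDERIV_transform_open[where S="- A"])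
      (use assms C1cD[OF assms(1)] in \<open>auto intro: compact_imp_closed\<close>)
qed

lemma C1cI:
  assumes "compact A" "open S" "A \<subseteq> S" "\<And>x. x \<in> S \<Longrightarrow> GDERIV \<phi> x :> D x" "continuous_on S D"
    "\<And>x. x \<notin> A \<Longrightarrow> \<phi> x = 0" "\<And>x. x \<notin> A \<Longrightarrow> D x = 0"
  shows "C1c A \<phi> D"
proof -
  have oA: "open (- A)" using assms(1) compact_imp_closed by blast
  have U: "UNIV = S \<union> (- A)" using assms(3) by auto
  have "GDERIV \<phi> x :> D x" for x
  proof (cases "x \<in> S")
    case False
    then have x: "x \<in> - A" using assms(3) by auto
    have "GDERIV (\<lambda>_. 0) x :> 0" by (rule GDERIV_const)
    then have "GDERIV \<phi> x :> 0"
      by (rule GDERIV_transform_open[OF _ oA x]) (use assms(6) in auto)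
    then show ?thesis using assms(7) x by simp
  qed (rule assms(4))
  moreover have "continuous_on (- A) D"
    using assms(7) by (auto intro!: continuous_on_eq[OF continuous_on_const[of _ 0]])
  then have "continuous_on UNIV D"
    unfolding U by (rule continuous_on_open_Un[OF assms(2) oA assms(5)])
  ultimately show ?thesis using assms(1,6) by (simp add: C1c_def)
qed

text \<open>\<open>F\<close> has to be differentiable only on an open set around \<open>A\<close>.
  This admits factors that are singular at the origin, or logarithms of functions that are positive
  only near \<open>A\<close>.\<close>

lemma C1c_mult:
  assumes a: "C1c A a Da" and S: "open S" "A \<subseteq> S"
    and F: "\<And>x. x \<in> S \<Longrightarrow> GDERIV F x :> DF x" and DF: "continuous_on S DF"
  shows "C1c A (\<lambda>x. a x * F x) (\<lambda>x. F x *\<^sub>R Da x + a x *\<^sub>R DF x)"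
proof (rule C1cI[OF C1cD(1)[OF a] S])
  note a' = C1cD[OF a]
  show "GDERIV (\<lambda>x. a x * F x) x :> F x *\<^sub>R Da x + a x *\<^sub>R DF x" if "x \<in> S" for x
    using GDERIV_mult[OF a'(2) F[OF that]] by (simp add: add.commute)
  have "continuous_on S F"
    using F S by (auto simp: continuous_on_eq_continuous_at intro: GDERIV_isCont)
  then show "continuous_on S (\<lambda>x. F x *\<^sub>R Da x + a x *\<^sub>R DF x)"
    by (intro continuous_intros DF continuous_on_subset[OF a'(3)] continuous_on_subset[OF a'(5)]) auto
qed (use C1cD(4)[OF a] C1c_gradient_zero[OF a] in auto)

lemma test_function_C1c:
  assumes "test_function \<phi>" "compact A" "\<And>x. x \<notin> A \<Longrightarrow> \<phi> x = 0"
  shows "C1c A \<phi> (gradient \<phi>)"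
  using assms Ck_Suc_GDERIV Ck_1_continuous_gradient unfolding C1c_def test_function_def by blast

lemma C1c_integrable:
  assumes "C1c A \<phi> D"
  shows "integrable lborel \<phi>" "integrable lborel D"
  using C1cD[OF assms] C1c_gradient_zero[OF assms]
  by (auto intro!: continuous_compact_support_integrable[of _ A])

lemma C1c_bounded:
  assumes "C1c A \<phi> D"
  obtains M where "M \<ge> 0" "\<And>x. \<bar>\<phi> x\<bar> \<le> M" "\<And>x. norm (D x) \<le> M"
proof -
  note c = C1cD[OF assms]
  have "compact (\<phi> ` A)" "compact (D ` A)"
    using c by (auto intro!: compact_continuous_image intro: continuous_on_subset)
  then obtain M1 M2 where "\<And>x. x \<in> A \<Longrightarrow> norm (\<phi> x) \<le> M1" "\<And>x. x \<in> A \<Longrightarrow> norm (D x) \<le> M2"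
    by (metis bounded_iff compact_imp_bounded image_eqI)
  then have "\<bar>\<phi> x\<bar> \<le> max 0 (max M1 M2) \<and> norm (D x) \<le> max 0 (max M1 M2)" for x
    using c(4)[of x] C1c_gradient_zero[OF assms, of x] by (cases "x \<in> A") fastforce+
  then show thesis using that[of "max 0 (max M1 M2)"] by auto
qed

lemma GDERIV_Lipschitz:
  assumes "\<And>x. GDERIV \<phi> x :> D x" "\<And>x. norm (D x) \<le> M"
  shows "\<bar>\<phi> y - \<phi> x\<bar> \<le> M * norm (y - x)"
proof -
  have "M \<ge> 0" using assms(2)[of x] norm_ge_zero[of "D x"] by linarith
  have "norm (\<phi> y - \<phi> x) \<le> M * norm (y - x)"
  proof (rule differentiable_bound[of UNIV])
    show "(\<phi> has_derivative (\<lambda>h. h \<bullet> D x)) (at x within UNIV)" for x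
      using assms(1) by (simp add: gderiv_def)
    show "onorm (\<lambda>h. h \<bullet> D x) \<le> M" for x
    proof (rule onorm_bound[OF \<open>M \<ge> 0\<close>])
      fix h
      have "norm (h \<bullet> D x) \<le> norm h * norm (D x)" using Cauchy_Schwarz_ineq2 by auto
      also have "\<dots> \<le> norm h * M" by (intro mult_left_mono assms) auto
      finally show "norm (h \<bullet> D x) \<le> M * norm h" by (simp add: mult.commute)
    qed
  qed auto
  then show ?thesis by simp
qed

text \<open>The mean value estimate on the segment from \<open>x\<close> to \<open>x + h\<close>,
  where uniform continuity of \<open>D\<close> on the ball of radius \<open>R + 1\<close> makes
  \<open>d\<close> independent of \<open>x\<close>. This uniformity permits differentiation under a
  convolution integral.\<close>

lemma GDERIV_uniform_linearization:
  fixes \<phi> :: "real^'n \<Rightarrow> real"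
  assumes d: "\<And>x. GDERIV \<phi> x :> D x" and c: "continuous_on UNIV D" and e: "e > 0"
  obtains d where "d > 0"
    "\<And>x h. norm x \<le> R \<Longrightarrow> norm h < d \<Longrightarrow> \<bar>\<phi> (x + h) - \<phi> x - h \<bullet> D x\<bar> \<le> e * norm h"
proof -
  have "uniformly_continuous_on (cball 0 (R + 1)) D"
    by (intro compact_uniformly_continuous) (auto intro: continuous_on_subset[OF c])
  then obtain d where d0: "d > 0" and
    unif: "\<And>x y. x \<in> cball 0 (R+1) \<Longrightarrow> y \<in> cball 0 (R+1) \<Longrightarrow> dist y x < d \<Longrightarrow> dist (D y) (D x) < e"
    using e unfolding uniformly_continuous_on_def by metis
  have "\<bar>\<phi> (x + h) - \<phi> x - h \<bullet> D x\<bar> \<le> e * norm h" if x: "norm x \<le> R" and h: "norm h < min d 1" for x h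
  proof -
    let ?S = "closed_segment x (x + h)"
    have S: "norm (y - x) \<le> norm h" if "y \<in> ?S" for y
      using segment_bound(1)[OF that] by simp
    have "norm (\<phi> (x + h) - \<phi> x - ((x + h) - x) \<bullet> D x) \<le> norm ((x + h) - x) * e"
    proof (rule differentiable_bound_linearization[where f'="\<lambda>y h. h \<bullet> D y" and S="?S"])
      show "x + t *\<^sub>R (x + h - x) \<in> ?S" if "t \<in> {0..1}" for t
        using that by (auto simp: in_segment algebra_simps intro!: exI[of _ t])
      show "(\<phi> has_derivative (\<lambda>h. h \<bullet> D y)) (at y within ?S)" for y
        using d[of y] unfolding gderiv_def by (rule has_derivative_at_withinI)
      show "onorm ((\<lambda>h. h \<bullet> D y) - (\<lambda>h. h \<bullet> D x)) \<le> e" if y: "y \<in> ?S" for y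
      proof (rule onorm_bound)
        show "0 \<le> e" using e by simp
        fix k :: "real^'n"
        have n: "norm (y - x) \<le> norm h" using S[OF y] .
        have "norm y \<le> norm x + norm (y - x)" by (metis norm_triangle_sub)
        then have "dist (D y) (D x) < e"
          using n x h by (intro unif) (auto simp: dist_norm)
        then have "norm k * norm (D y - D x) \<le> norm k * e"
          by (intro mult_left_mono) (auto simp: dist_norm)
        moreover have "norm (k \<bullet> (D y - D x)) \<le> norm k * norm (D y - D x)"
          using Cauchy_Schwarz_ineq2 by auto
        ultimately show "norm (((\<lambda>h. h \<bullet> D y) - (\<lambda>h. h \<bullet> D x)) k) \<le> e * norm k"
          by (simp add: inner_diff_right mult.commute)
      qed
    qed auto
    then show ?thesis by (simp add: mult.commute)
  qed
  then show thesis using that[of "min d 1"] d0 by auto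
qed

subsection \<open>Translation, reflection and integration by parts\<close>

lemma lborel_integral_translate:
  fixes f :: "'a::euclidean_space \<Rightarrow> 'b::{banach, second_countable_topology}"
  assumes [measurable]: "f \<in> borel_measurable borel"
  shows "integral\<^sup>L lborel (\<lambda>x. f (c + x)) = integral\<^sup>L lborel f"
proof -
  have "integral\<^sup>L lborel f = integral\<^sup>L (distr lborel borel ((+) c)) f"
    by (simp add: lborel_distr_plus)
  also have "\<dots> = integral\<^sup>L lborel (\<lambda>x. f (c + x))"
    by (rule integral_distr) auto
  finally show ?thesis by simp
qed

lemma lborel_distr_reflect:
  fixes c :: "'a::euclidean_space"
  shows "distr lborel borel (\<lambda>x. c - x) = lborel"
  using lborel_affine[of "-1" c] by (simp add: density_1)

lemma lborel_integral_reflect: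
  fixes f :: "'a::euclidean_space \<Rightarrow> 'b::{banach, second_countable_topology}"
  assumes [measurable]: "f \<in> borel_measurable borel"
  shows "integral\<^sup>L lborel (\<lambda>x. f (c - x)) = integral\<^sup>L lborel f"
proof -
  have "integral\<^sup>L lborel f = integral\<^sup>L (distr lborel borel (\<lambda>x. c - x)) f"
    by (simp add: lborel_distr_reflect)
  also have "\<dots> = integral\<^sup>L lborel (\<lambda>x. f (c - x))"
    by (rule integral_distr) auto
  finally show ?thesis by simp
qed

lemma lborel_nn_integral_translate:
  fixes f :: "'a::euclidean_space \<Rightarrow> ennreal"
  assumes [measurable]: "f \<in> borel_measurable borel"
  shows "(\<integral>\<^sup>+x. f (x - c) \<partial>lborel) = (\<integral>\<^sup>+x. f x \<partial>lborel)"
proof -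
  have "(\<integral>\<^sup>+x. f x \<partial>lborel) = (\<integral>\<^sup>+x. f x \<partial>distr lborel borel ((+) (- c)))"
    by (simp only: lborel_distr_plus)
  also have "\<dots> = (\<integral>\<^sup>+x. f (x - c) \<partial>lborel)"
    by (subst nn_integral_distr) auto
  finally show ?thesis by simp
qed

text \<open>By translation invariance every difference quotient of a compactly supported function has
  integral 0.\<close>

lemma integral_C1c_gradient:
  fixes v :: "real^'n"
  assumes "C1c A \<phi> D"
  shows "integral\<^sup>L lborel (\<lambda>x. D x \<bullet> v) = 0"
proof -
  note c = C1cD[OF assms]
  obtain M where M: "M \<ge> 0" "\<And>x. \<bar>\<phi> x\<bar> \<le> M" "\<And>x. norm (D x) \<le> M"
    using C1c_bounded[OF assms] by blast
  define t where "t n = inverse (real (Suc n))" for n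
  define s where "s n x = (\<phi> (t n *\<^sub>R v + x) - \<phi> x) / t n" for n x
  have t0: "t n > 0" "t n \<le> 1" for n by (auto simp: t_def field_simps)
  obtain R where R: "\<And>x. x \<in> A \<Longrightarrow> norm x \<le> R"
    using compact_imp_bounded[OF c(1)] by (auto simp: bounded_iff)
  \<comment> \<open>As 0 < \<open>t n\<close> \<le> 1, all difference quotients vanish off this
    ball, which yields an integrable dominating function.\<close>
  let ?B = "cball 0 (R + norm v) :: (real^'n) set"
  have meas: "\<phi> \<in> borel_measurable borel" "D \<in> borel_measurable borel"
    using c by (auto intro: borel_measurable_continuous_onI)
  have int0: "integrable lborel \<phi>" using C1c_integrable[OF assms] by simp
  have "integrable (distr lborel borel ((+) (t n *\<^sub>R v))) \<phi>" for n
    using int0 by (simp add: lborel_distr_plus)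
  then have int1: "integrable lborel (\<lambda>x. \<phi> (t n *\<^sub>R v + x))" for n
    by (subst (asm) integrable_distr_eq) (use meas in auto)
  have zero: "integral\<^sup>L lborel (s n) = 0" for n
    unfolding s_def using int0 int1 lborel_integral_translate[OF meas(1), of "t n *\<^sub>R v"] by simp
  have "(\<lambda>n. integral\<^sup>L lborel (s n)) \<longlonglongrightarrow> integral\<^sup>L lborel (\<lambda>x. D x \<bullet> v)"
  proof (rule integral_dominated_convergence)
    show "(\<lambda>x. D x \<bullet> v) \<in> borel_measurable lborel" using meas by simp
    show "s n \<in> borel_measurable lborel" for n unfolding s_def using meas by measurable
    have "integrable lborel (\<lambda>x. indicator ?B x *\<^sub>R (M * norm v))"
      by (intro borel_integrable_compact) auto
    then show "integrable lborel (\<lambda>x. indicator ?B x * (M * norm v))" by simp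
    show "AE x in lborel. norm (s n x) \<le> indicator ?B x * (M * norm v)" for n
    proof (rule AE_I2)
      fix x :: "real^'n"
      have "norm (t n *\<^sub>R v) \<le> norm v" using t0[of n] by (simp add: mult_left_le_one_le)
      show "norm (s n x) \<le> indicator ?B x * (M * norm v)"
      proof (cases "x \<in> ?B")
        case True
        have "\<bar>\<phi> (t n *\<^sub>R v + x) - \<phi> x\<bar> \<le> M * norm ((t n *\<^sub>R v + x) - x)"
          using c(2) M(3) by (rule GDERIV_Lipschitz)
        then have "\<bar>\<phi> (t n *\<^sub>R v + x) - \<phi> x\<bar> \<le> (M * norm v) * t n"
          using t0[of n] by (simp add: mult_ac)
        then show ?thesis using t0[of n] True by (simp add: s_def divide_le_eq)
      next
        case False
        then have "norm x > R + norm v" by simp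
        moreover have "norm x \<le> norm (t n *\<^sub>R v + x) + norm (t n *\<^sub>R v)"
          by (metis add.commute norm_triangle_sub add_diff_cancel_left' norm_minus_commute)
        ultimately have "norm (t n *\<^sub>R v + x) > R" "norm x > R"
          using \<open>norm (t n *\<^sub>R v) \<le> norm v\<close> norm_ge_zero[of v] by linarith+
        then have "\<phi> (t n *\<^sub>R v + x) = 0" "\<phi> x = 0" using R c(4) by force+
        then show ?thesis using False by (simp add: s_def)
      qed
    qed
    show "AE x in lborel. (\<lambda>n. s n x) \<longlonglongrightarrow> D x \<bullet> v"
    proof (rule AE_I2)
      fix x :: "real^'n"
      have "((\<lambda>r. x + r *\<^sub>R v) has_derivative (\<lambda>r. r *\<^sub>R v)) (at 0)"
        by (auto intro!: derivative_eq_intros)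
      moreover have "(\<phi> has_derivative (\<lambda>h. h \<bullet> D x)) (at (x + 0 *\<^sub>R v))"
        using c(2)[of x] by (simp add: gderiv_def)
      ultimately have "((\<lambda>r. \<phi> (x + r *\<^sub>R v)) has_derivative (\<lambda>r. (r *\<^sub>R v) \<bullet> D x)) (at 0)"
        by (rule has_derivative_compose)
      then have "DERIV (\<lambda>r. \<phi> (x + r *\<^sub>R v)) 0 :> v \<bullet> D x"
        by (simp add: has_field_derivative_def mult.commute[of _ "v \<bullet> D x"])
      then have "((\<lambda>r. (\<phi> (x + r *\<^sub>R v) - \<phi> x) / r) \<longlongrightarrow> v \<bullet> D x) (at 0)"
        by (simp add: DERIV_def)
      moreover have "filterlim t (at 0) sequentially"
        using t0(1) LIMSEQ_inverse_real_of_nat unfolding filterlim_at t_def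
        by (auto simp: eventually_sequentially)
      ultimately have "(\<lambda>n. (\<phi> (x + t n *\<^sub>R v) - \<phi> x) / t n) \<longlonglongrightarrow> v \<bullet> D x"
        by (rule filterlim_compose)
      then show "(\<lambda>n. s n x) \<longlonglongrightarrow> D x \<bullet> v"
        by (simp add: s_def add.commute inner_commute)
    qed
  qed
  then show ?thesis by (simp add: zero LIMSEQ_const_iff)
qed

text \<open>The divergence of \<open>|x|\<^sup>-\<^sup>\<alpha> x\<close> away from the origin is \<open>(N - \<alpha>) |x|\<^sup>-\<^sup>\<alpha>\<close>.\<close>

lemma integral_radial_field:
  fixes \<phi> :: "real^'n \<Rightarrow> real"
  assumes phi: "C1c A \<phi> D" and A: "0 \<notin> A"
  shows "integral\<^sup>L lborel (\<lambda>x. norm x powr (- \<alpha>) * (x \<bullet> D x))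
       = (\<alpha> - real CARD('n)) * integral\<^sup>L lborel (\<lambda>x. norm x powr (- \<alpha>) * \<phi> x)"
proof -
  note c = C1cD[OF phi]
  let ?S = "- {0} :: (real^'n) set"
  have S: "open ?S" "A \<subseteq> ?S" using A by auto
  \<comment> \<open>\<open>F i\<close> is the i-th component of the field. The preceding lemma is
    applied to \<phi> times \<open>F i\<close> in the i-th direction, and the results are summed
    over i.\<close>
  define F where "F i x = x $ i * norm x powr (- \<alpha>)" for i and x :: "real^'n"
  define DF where "DF i x = norm x powr (- \<alpha>) *\<^sub>R axis i 1 - (x $ i * \<alpha> * norm x powr (- \<alpha> - 2)) *\<^sub>R x"
    for i and x :: "real^'n"
  have dF: "GDERIV (F i) x :> DF i x" if "x \<in> ?S" for i x
  proof -
    have x: "x \<noteq> 0" using that by simp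
    have "DERIV (\<lambda>r. r powr (- \<alpha>)) (norm x) :> - \<alpha> * norm x powr (- \<alpha> - 1)"
      using x by (auto intro!: derivative_eq_intros)
    from GDERIV_DERIV_compose[OF GDERIV_norm[OF x] this]
    have 1: "GDERIV (\<lambda>x. norm x powr (- \<alpha>)) x :> (- \<alpha> * norm x powr (- \<alpha> - 1)) *\<^sub>R sgn x" .
    have 2: "GDERIV (\<lambda>x. x $ i) x :> axis i 1"
      unfolding gderiv_def inner_axis
      by (auto intro!: bounded_linear_imp_has_derivative bounded_linear_vec_nth)
    have "norm x powr (- \<alpha> - 1) = norm x powr (- \<alpha> - 2) * norm x"
      using x by (simp add: powr_diff powr_minus powr_numeral power2_eq_square field_simps)
    then have "(- \<alpha> * norm x powr (- \<alpha> - 1)) *\<^sub>R sgn x = (- \<alpha> * norm x powr (- \<alpha> - 2)) *\<^sub>R x"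
      using x by (simp add: sgn_div_norm)
    from GDERIV_mult[OF 2 1, unfolded this] show ?thesis
      by (simp add: F_def[abs_def] DF_def algebra_simps)
  qed
  have cDF: "continuous_on ?S (DF i)" for i
    unfolding DF_def by (intro continuous_intros) auto
  have comp: "C1c A (\<lambda>x. \<phi> x * F i x) (\<lambda>x. F i x *\<^sub>R D x + \<phi> x *\<^sub>R DF i x)" for i
    by (rule C1c_mult[OF phi S dF cDF])
  have "(\<Sum>i\<in>UNIV. (F i x *\<^sub>R D x + \<phi> x *\<^sub>R DF i x) \<bullet> axis i 1) =
      norm x powr (- \<alpha>) * (x \<bullet> D x) + (real CARD('n) - \<alpha>) * (norm x powr (- \<alpha>) * \<phi> x)" for x
  proof (cases "x \<in> A")
    case True
    then have x: "x \<noteq> 0" using A by auto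
    have "(\<Sum>i\<in>UNIV. (F i x *\<^sub>R D x + \<phi> x *\<^sub>R DF i x) \<bullet> axis i 1)
       = norm x powr (- \<alpha>) * (\<Sum>i\<in>UNIV. x $ i * D x $ i) + real CARD('n) * (\<phi> x * norm x powr (- \<alpha>))
         - \<phi> x * \<alpha> * norm x powr (- \<alpha> - 2) * (\<Sum>i\<in>UNIV. x $ i * x $ i)"
      by (simp add: inner_axis F_def DF_def sum.distrib sum_distrib_left sum_subtractf algebra_simps)
    moreover have "(\<Sum>i\<in>UNIV. x $ i * x $ i) = (norm x)\<^sup>2"
      by (simp add: power2_norm_eq_inner inner_vec_def)
    moreover have "norm x powr (- \<alpha> - 2) * (norm x)\<^sup>2 = norm x powr (- \<alpha>)"
      using x by (simp add: powr_diff powr_numeral)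
    ultimately show ?thesis
      by (simp add: inner_vec_def algebra_simps)
  next
    case False
    then show ?thesis using c(4) C1c_gradient_zero[OF phi] by simp
  qed
  then have sum0: "(\<lambda>x. norm x powr (- \<alpha>) * (x \<bullet> D x) + (real CARD('n) - \<alpha>) * (norm x powr (- \<alpha>) * \<phi> x))
      = (\<lambda>x. \<Sum>i\<in>UNIV. (F i x *\<^sub>R D x + \<phi> x *\<^sub>R DF i x) \<bullet> axis i 1)" by (simp add: fun_eq_iff)
  have "integral\<^sup>L lborel (\<lambda>x. \<Sum>i\<in>UNIV. (F i x *\<^sub>R D x + \<phi> x *\<^sub>R DF i x) \<bullet> axis i 1) = 0"
    using C1c_integrable(2)[OF comp]
    by (subst Bochner_Integration.integral_sum) (auto simp: integral_C1c_gradient[OF comp])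
  then have *: "integral\<^sup>L lborel (\<lambda>x. norm x powr (- \<alpha>) * (x \<bullet> D x) +
      (real CARD('n) - \<alpha>) * (norm x powr (- \<alpha>) * \<phi> x)) = 0"
    by (simp add: sum0)
  \<comment> \<open>Powers of \<open>norm x\<close> are continuous only off the origin; gluing with
    0 on the complement of \<open>A\<close> makes the integrands continuous everywhere.\<close>
  have sup: "continuous_on UNIV f" if f: "continuous_on A f" "\<And>x. x \<notin> A \<Longrightarrow> f x = 0"
     "continuous_on ?S f" for f :: "real^'n \<Rightarrow> real"
  proof -
    have oA: "open (- A)" using c(1) compact_imp_closed by blast
    have "continuous_on (- A) f"
      using f(2) by (auto intro!: continuous_on_eq[OF continuous_on_const[of _ 0]])
    from continuous_on_open_Un[OF S(1) oA f(3) this] show ?thesis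
      using S(2) by (metis Un_commute compl_le_swap1 sup.order_iff sup_compl_top_left1 sup_shunt)
  qed
  have i1: "integrable lborel (\<lambda>x. norm x powr (- \<alpha>) * (x \<bullet> D x))"
    by (rule continuous_compact_support_integrable[OF sup c(1)])
      (use A C1c_gradient_zero[OF phi] in \<open>auto intro!: continuous_intros continuous_on_subset[OF c(3)]\<close>)
  have i2: "integrable lborel (\<lambda>x. norm x powr (- \<alpha>) * \<phi> x)"
    by (rule continuous_compact_support_integrable[OF sup c(1)])
      (use A c(4) in \<open>auto intro!: continuous_intros continuous_on_subset[OF c(5)]\<close>)
  have "integral\<^sup>L lborel (\<lambda>x. norm x powr (- \<alpha>) * (x \<bullet> D x)) +
      (real CARD('n) - \<alpha>) * integral\<^sup>L lborel (\<lambda>x. norm x powr (- \<alpha>) * \<phi> x) = 0"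
    using * i1 i2 by simp
  then show ?thesis by (simp add: algebra_simps)
qed

subsection \<open>Mollification\<close>

definition convolution :: "('a::euclidean_space \<Rightarrow> real) \<Rightarrow> ('a \<Rightarrow> 'b::euclidean_space) \<Rightarrow> 'a \<Rightarrow> 'b" where
  "convolution \<kappa> f x = (\<integral>y. \<kappa> (x - y) *\<^sub>R f y \<partial>lborel)"

text \<open>Borel and \<open>lborel\<close> counterpart of \<open>locally_integrable\<close>, which
  refers to Lebesgue measure; closed balls stand in for all compact sets.\<close>

definition loc_int :: "('a::euclidean_space \<Rightarrow> 'b::euclidean_space) \<Rightarrow> bool" where
  "loc_int f \<longleftrightarrow> f \<in> borel_measurable borel \<and> (\<forall>R. integrable lborel (\<lambda>x. indicator (cball 0 R) x *\<^sub>R f x))"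

lemma loc_int_measurable: "loc_int f \<Longrightarrow> f \<in> borel_measurable borel"
  by (simp add: loc_int_def)

lemma integrable_bounded_kernel:
  fixes \<kappa> :: "'a::euclidean_space \<Rightarrow> real" and F :: "'a \<Rightarrow> 'b::euclidean_space"
  assumes "continuous_on UNIV \<kappa>" "\<And>x. \<bar>\<kappa> x\<bar> \<le> M" "integrable lborel F"
  shows "integrable lborel (\<lambda>y. \<kappa> (x - y) *\<^sub>R F y)"
proof (rule Bochner_Integration.integrable_bound)
  have [measurable]: "\<kappa> \<in> borel_measurable borel"
    using assms(1) by (rule borel_measurable_continuous_onI)
  have [measurable]: "F \<in> borel_measurable lborel" using assms(3) by auto
  show "(\<lambda>y. \<kappa> (x - y) *\<^sub>R F y) \<in> borel_measurable lborel" by measurable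
  show "integrable lborel (\<lambda>y. M * norm (F y))" using assms(3) by simp
  show "AE y in lborel. norm (\<kappa> (x - y) *\<^sub>R F y) \<le> norm (M * norm (F y))"
  proof (rule AE_I2)
    fix y
    have "M \<ge> 0" using assms(2)[of 0] by linarith
    then show "norm (\<kappa> (x - y) *\<^sub>R F y) \<le> norm (M * norm (F y))"
      using assms(2) by (simp add: mult_right_mono)
  qed
qed

text \<open>A kernel supported in the ball of radius \<open>e\<close> sees \<open>f\<close> only
  within distance \<open>e\<close> of \<open>x\<close>. Truncating \<open>f\<close> to a ball
  therefore changes nothing near a given point and replaces local integrability by
  integrability.\<close>

lemma kernel_localize:
  fixes f :: "'a::euclidean_space \<Rightarrow> 'b::euclidean_space"
  assumes "\<And>y. e \<le> norm y \<Longrightarrow> \<kappa> y = (0::real)" "norm x + e \<le> R"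
  shows "\<kappa> (x - y) *\<^sub>R f y = \<kappa> (x - y) *\<^sub>R (indicator (cball 0 R) y *\<^sub>R f y)"
proof (cases "norm y \<le> R")
  case True
  then show ?thesis by simp
next
  case False
  have "norm y \<le> norm x + norm (x - y)" using norm_triangle_sub[of y x] norm_minus_commute[of x y] by linarith
  then have "e \<le> norm (x - y)" using False assms(2) by simp
  then have "\<kappa> (x - y) = 0" by (rule assms(1))
  then show ?thesis by (simp only: scaleR_zero_left)
qed

lemma convolution_localize:
  fixes f :: "'a::euclidean_space \<Rightarrow> 'b::euclidean_space"
  assumes "\<And>y. e \<le> norm y \<Longrightarrow> \<kappa> y = (0::real)" "norm x + e \<le> R"
  shows "convolution \<kappa> f x = convolution \<kappa> (\<lambda>y. indicator (cball 0 R) y *\<^sub>R f y) x"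
  unfolding convolution_def
  by (rule Bochner_Integration.integral_cong[OF refl]) (rule kernel_localize[OF assms])

lemma kernel_integrable:
  fixes f :: "'a::euclidean_space \<Rightarrow> 'b::euclidean_space"
  assumes "continuous_on UNIV \<kappa>" "\<And>x. \<bar>\<kappa> x\<bar> \<le> M" "\<And>y. e \<le> norm y \<Longrightarrow> \<kappa> y = (0::real)" "loc_int f"
  shows "integrable lborel (\<lambda>y. \<kappa> (x - y) *\<^sub>R f y)"
proof -
  have loc: "\<kappa> (x - y) *\<^sub>R f y = \<kappa> (x - y) *\<^sub>R (indicator (cball 0 (norm x + e)) y *\<^sub>R f y)" for y
    by (rule kernel_localize[of e]) (use assms(3) in auto)
  have *: "integrable lborel (\<lambda>y. indicator (cball 0 (norm x + e)) y *\<^sub>R f y)"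
    using assms(4) by (simp add: loc_int_def)
  show ?thesis
    using integrable_bounded_kernel[OF assms(1,2) *, of x] by (subst loc)
qed

text \<open>Dominated convergence along a sequence: a convergent sequence is bounded, so one
  truncation of \<open>f\<close> serves all its members.\<close>

lemma continuous_on_convolution:
  fixes f :: "'a::euclidean_space \<Rightarrow> 'b::euclidean_space"
  assumes k: "continuous_on UNIV \<kappa>" "\<And>x. \<bar>\<kappa> x\<bar> \<le> M" "\<And>y. e \<le> norm y \<Longrightarrow> \<kappa> y = (0::real)" "loc_int f"
  shows "continuous_on UNIV (convolution \<kappa> f)"
  unfolding continuous_on_sequentially
proof (intro allI ballI impI, elim conjE)
  fix X a assume "X \<longlonglongrightarrow> (a::'a)"
  then obtain r where r: "\<And>n. norm (X n) \<le> r"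
    using convergent_imp_Bseq[OF convergentI] by (metis BseqD)
  have ra: "norm a \<le> r"
    by (rule LIMSEQ_le_const2[OF tendsto_norm[OF \<open>X \<longlonglongrightarrow> a\<close>]]) (use r in auto)
  define F where "F y = indicator (cball 0 (r + e)) y *\<^sub>R f y" for y
  have iF: "integrable lborel F" using k(4) by (simp add: loc_int_def F_def[abs_def])
  have eq: "convolution \<kappa> f x = convolution \<kappa> F x" if "norm x \<le> r" for x
    unfolding F_def by (rule convolution_localize[OF k(3)]) (use that in auto)
  have [measurable]: "\<kappa> \<in> borel_measurable borel" "F \<in> borel_measurable lborel"
    using k(1) iF by (auto intro: borel_measurable_continuous_onI)
  have "(\<lambda>n. \<integral>y. \<kappa> (X n - y) *\<^sub>R F y \<partial>lborel) \<longlonglongrightarrow> (\<integral>y. \<kappa> (a - y) *\<^sub>R F y \<partial>lborel)"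
  proof (rule integral_dominated_convergence)
    show "integrable lborel (\<lambda>y. M * norm (F y))" using iF by simp
    show "AE y in lborel. (\<lambda>n. \<kappa> (X n - y) *\<^sub>R F y) \<longlonglongrightarrow> \<kappa> (a - y) *\<^sub>R F y"
      by (intro AE_I2 tendsto_intros continuous_on_tendsto_compose[OF k(1)] \<open>X \<longlonglongrightarrow> a\<close>) auto
    show "AE y in lborel. norm (\<kappa> (X n - y) *\<^sub>R F y) \<le> M * norm (F y)" for n
      using k(2) by (intro AE_I2) (simp add: mult_right_mono)
  qed measurable
  then show "(convolution \<kappa> f \<circ> X) \<longlonglongrightarrow> convolution \<kappa> f a"
    using eq[OF ra] eq[OF r] by (simp add: comp_def convolution_def)
qed

text \<open>The uniform linearization of the kernel is multiplied by \<open>f\<close> and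
  integrated; the remainder is at most the accuracy of the linearization times the L1 norm of the
  truncated \<open>f\<close>.\<close>

lemma GDERIV_convolution:
  fixes f :: "real^'n \<Rightarrow> real"
  assumes \<rho>: "C1c (cball 0 e) \<rho> D" and f: "loc_int f"
  shows "GDERIV (convolution \<rho> f) x :> (\<integral>y. f y *\<^sub>R D (x - y) \<partial>lborel)"
proof -
  note c = C1cD[OF \<rho>]
  obtain M where M: "M \<ge> 0" "\<And>x. \<bar>\<rho> x\<bar> \<le> M" "\<And>x. norm (D x) \<le> M"
    using C1c_bounded[OF \<rho>] by blast
  define e' where "e' = \<bar>e\<bar> + 1"
  have sup: "\<rho> y = 0" "D y = 0" if "e' \<le> norm y" for y
    using that c(4)[of y] C1c_gradient_zero[OF \<rho>, of y] by (auto simp: e'_def)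
  define F where "F y = indicator (cball 0 (norm x + 1 + e')) y *\<^sub>R f y" for y
  have iF: "integrable lborel F" using f by (simp add: loc_int_def F_def[abs_def])
  have [measurable]: "D \<in> borel_measurable borel" "F \<in> borel_measurable lborel"
    using c(3) iF by (auto intro: borel_measurable_continuous_onI)
  have iD: "integrable lborel (\<lambda>y. F y *\<^sub>R D (x - y))"
  proof (rule Bochner_Integration.integrable_bound)
    show "integrable lborel (\<lambda>y. M * norm (F y))" using iF by simp
    show "AE y in lborel. norm (F y *\<^sub>R D (x - y)) \<le> norm (M * norm (F y))"
      using M mult_left_mono[OF M(3) abs_ge_zero] by (intro AE_I2) (simp add: mult.commute[of M])
  qed measurable
  have i\<rho>: "integrable lborel (\<lambda>y. \<rho> (u - y) * F y)" for u
    using integrable_bounded_kernel[OF c(5) M(2) iF] by simp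
  have fD: "f y *\<^sub>R D (x - y) = F y *\<^sub>R D (x - y)" for y
  proof (cases "y \<in> cball 0 (norm x + 1 + e')")
    case False
    have "norm y \<le> norm x + norm (x - y)" using norm_triangle_sub[of y x] norm_minus_commute[of x y] by linarith
    then have "e' \<le> norm (x - y)" using False by simp
    then show ?thesis using sup by simp
  qed (simp add: F_def)
  let ?D = "\<integral>y. F y *\<^sub>R D (x - y) \<partial>lborel"
  have "((convolution \<rho> f) has_derivative (\<lambda>h. h \<bullet> ?D)) (at x)"
    unfolding has_derivative_at_alt
  proof (intro conjI allI impI)
    show "bounded_linear (\<lambda>h. h \<bullet> ?D)" by (rule bounded_linear_inner_left)
    fix E :: real assume "E > 0"
    define I where "I = (\<integral>y. norm (F y) \<partial>lborel)"
    have I: "I \<ge> 0" by (simp add: I_def)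
    \<comment> \<open>Dividing by \<open>I + 1\<close> instead of \<open>I\<close> covers the case
      \<open>I = 0\<close>.\<close>
    define E' where "E' = E / (I + 1)"
    have "E' > 0" using I \<open>E > 0\<close> by (simp add: E'_def)
    \<comment> \<open>The radius \<open>2 * norm x + 1 + e'\<close> covers every
      \<open>x - y\<close> for which \<open>F y\<close> can be nonzero.\<close>
    then obtain d where d: "d > 0"
      "\<And>u h. norm u \<le> 2 * norm x + 1 + e' \<Longrightarrow> norm h < d \<Longrightarrow> \<bar>\<rho> (u + h) - \<rho> u - h \<bullet> D u\<bar> \<le> E' * norm h"
      using GDERIV_uniform_linearization[OF c(2) c(3)] by blast
    show "\<exists>d>0. \<forall>y. norm (y - x) < d \<longrightarrow>
       norm (convolution \<rho> f y - convolution \<rho> f x - (y - x) \<bullet> ?D) \<le> E * norm (y - x)"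
    proof (intro exI[of _ "min d 1"] conjI allI impI)
      show "min d 1 > 0" using d by simp
      fix x' assume x': "norm (x' - x) < min d 1"
      define h where "h = x' - x"
      have xh: "x' = x + h" by (simp add: h_def)
      have "norm x' \<le> norm x + norm h" unfolding xh by (rule norm_triangle_ineq)
      then have n1: "norm x' + e' \<le> norm x + 1 + e'" using x' by (simp add: h_def)
      have e1: "convolution \<rho> f x' = (\<integral>y. \<rho> (x' - y) * F y \<partial>lborel)"
        using convolution_localize[OF sup(1) n1, where f=f] by (simp add: convolution_def F_def)
      have e2: "convolution \<rho> f x = (\<integral>y. \<rho> (x - y) * F y \<partial>lborel)"
        using convolution_localize[OF sup(1), where e=e' and x=x and R="norm x + 1 + e'" and f=f] by (simp add: convolution_def F_def)
      have "convolution \<rho> f x' - convolution \<rho> f x - h \<bullet> ?D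
          = (\<integral>y. \<rho> (x' - y) * F y - \<rho> (x - y) * F y - h \<bullet> (F y *\<^sub>R D (x - y)) \<partial>lborel)"
        unfolding e1 e2 using iD
        by (simp add: Bochner_Integration.integral_diff[OF Bochner_Integration.integrable_diff[OF i\<rho> i\<rho>] integrable_inner_right[OF iD]]
          Bochner_Integration.integral_diff[OF i\<rho> i\<rho>] integral_inner_right del: inner_scaleR_right)
      also have "norm \<dots> \<le> (\<integral>y. (E' * norm h) * norm (F y) \<partial>lborel)"
      proof (rule Bochner_Integration.integral_norm_bound_integral)
        show "norm (\<rho> (x' - y) * F y - \<rho> (x - y) * F y - h \<bullet> (F y *\<^sub>R D (x - y)))
           \<le> E' * norm h * norm (F y)" for y
        proof (cases "y \<in> cball 0 (norm x + 1 + e')")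
          case True
          have "norm (x - y) \<le> norm x + norm y" by (rule norm_triangle_ineq4)
          then have "\<bar>\<rho> ((x - y) + h) - \<rho> (x - y) - h \<bullet> D (x - y)\<bar> \<le> E' * norm h"
            using True x' by (intro d(2)) (auto simp: h_def)
          then have "\<bar>\<rho> ((x - y) + h) - \<rho> (x - y) - h \<bullet> D (x - y)\<bar> * \<bar>F y\<bar> \<le> E' * norm h * \<bar>F y\<bar>"
            by (intro mult_right_mono) auto
          then show ?thesis
            unfolding abs_mult[symmetric] xh by (simp add: algebra_simps)
        qed (simp add: F_def)
        show "integrable lborel (\<lambda>y. \<rho> (x' - y) * F y - \<rho> (x - y) * F y - h \<bullet> (F y *\<^sub>R D (x - y)))"
          by (intro Bochner_Integration.integrable_diff i\<rho> integrable_inner_right iD)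
      qed (use iF in simp)
      also have "\<dots> = E' * I * norm h" by (simp add: I_def)
      also have "\<dots> \<le> E * norm h"
      proof (rule mult_right_mono)
        have "E' * I \<le> E' * (I + 1)" using \<open>E' > 0\<close> by simp
        also have "\<dots> = E" using I by (simp add: E'_def)
        finally show "E' * I \<le> E" .
      qed simp
      finally show "norm (convolution \<rho> f x' - convolution \<rho> f x - (x' - x) \<bullet> ?D) \<le> E * norm (x' - x)"
        by (simp add: h_def)
    qed
  qed
  then show ?thesis by (simp add: gderiv_def fD)
qed

lemma gradient_kernel_integrable:
  fixes f :: "real^'n \<Rightarrow> real"
  assumes \<rho>: "C1c (cball 0 e) \<rho> D" and f: "loc_int f"
  shows "integrable lborel (\<lambda>y. f y *\<^sub>R D (x - y))"
proof -
  note c = C1cD[OF \<rho>]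
  obtain M where M: "M \<ge> 0" "\<And>x. \<bar>\<rho> x\<bar> \<le> M" "\<And>x. norm (D x) \<le> M" using C1c_bounded[OF \<rho>] by blast
  have [measurable]: "D \<in> borel_measurable borel" "f \<in> borel_measurable borel"
    using borel_measurable_continuous_onI[OF c(3)] loc_int_measurable[OF f] by auto
  have "integrable lborel (\<lambda>y. norm (D (x - y)) *\<^sub>R f y)"
  proof (rule kernel_integrable[where e="e+1" and M=M and \<kappa>="\<lambda>y. norm (D y)"])
    show "continuous_on UNIV (\<lambda>y. norm (D y))" by (intro continuous_intros c)
    show "norm (D y) = 0" if "e + 1 \<le> norm y" for y
      using C1c_gradient_zero[OF \<rho>, of y] that by simp
  qed (use M f in auto)
  then show ?thesis
    by (rule Bochner_Integration.integrable_bound) (measurable, simp add: mult.commute)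
qed

lemma test_functionI:
  assumes "\<And>k. Ck k \<phi>" "bounded A" "\<And>x. x \<notin> A \<Longrightarrow> \<phi> x = 0"
  shows "test_function \<phi>"
  using assms compact_closure_supportI unfolding test_function_def by blast

lemma smooth_kernel_C1c:
  assumes "\<forall>m. Ck m \<rho>" "\<And>y. e < norm y \<Longrightarrow> \<rho> y = 0"
  shows "C1c (cball 0 e) \<rho> (gradient \<rho>)"
proof (rule test_function_C1c[OF _ compact_cball])
  show 0: "\<rho> y = 0" if "y \<notin> cball 0 e" for y using that assms(2)[of y] by simp
  show "test_function \<rho>"
    by (rule test_functionI[OF _ bounded_cball[of 0 e]]) (use assms(1) 0 in blast)+
qed

text \<open>The kernel varies in the induction: a partial derivative of the convolution is the
  convolution with that partial derivative of the kernel, which is again smooth and has the same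
  support bound.\<close>

lemma Ck_convolution:
  fixes f :: "real^'n \<Rightarrow> real"
  assumes f: "loc_int f"
  shows "\<forall>m. Ck m \<rho> \<Longrightarrow> (\<And>y. e < norm y \<Longrightarrow> \<rho> y = 0) \<Longrightarrow> Ck k (convolution \<rho> f)"
proof (induction k arbitrary: \<rho>)
  case 0
  have "C1c (cball 0 e) \<rho> (gradient \<rho>)"
    by (rule smooth_kernel_C1c[OF 0])
  then obtain M where M0: "M \<ge> 0" and M: "\<And>x. \<bar>\<rho> x\<bar> \<le> M" and M2: "\<And>x. norm (gradient \<rho> x) \<le> M"
    using C1c_bounded by blast
  have "continuous_on UNIV \<rho>" using 0(1)[rule_format, of 0] by simp
  then have "continuous_on UNIV (convolution \<rho> f)"
    using M by (rule continuous_on_convolution[where e="e+1"]) (use 0 f in auto)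
  then show ?case by simp
next
  case (Suc k)
  have c: "C1c (cball 0 e) \<rho> (gradient \<rho>)"
    by (rule smooth_kernel_C1c[OF Suc.prems])
  have g: "(\<integral>y. f y *\<^sub>R gradient \<rho> (x - y) \<partial>lborel) $ i = convolution (\<lambda>x. gradient \<rho> x $ i) f x" for x i
  proof -
    have "integrable lborel (\<lambda>y. f y *\<^sub>R gradient \<rho> (x - y))"
      by (rule gradient_kernel_integrable[OF c f])
    from integral_inner_left[OF this, of "axis i 1"]
    show ?thesis by (simp add: inner_axis convolution_def mult.commute)
  qed
  show ?case
  proof (rule Ck_SucI)
    show "GDERIV (convolution \<rho> f) x :> (\<integral>y. f y *\<^sub>R gradient \<rho> (x - y) \<partial>lborel)" for x
      by (rule GDERIV_convolution[OF c f])
    show "Ck k (\<lambda>x. (\<integral>y. f y *\<^sub>R gradient \<rho> (x - y) \<partial>lborel) $ i)" for i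
      unfolding g using Suc.prems C1c_gradient_zero[OF c]
      by (intro Suc.IH allI Ck_Suc_gradient) auto
  qed
qed

section \<open>Mollifiers as approximate identities, and weak gradients\<close>

lemma mollifierD:
  assumes "mollifier e (\<rho> :: real^'n \<Rightarrow> real)"
  shows "Ck k \<rho>" "0 \<le> \<rho> x" "e \<le> norm x \<Longrightarrow> \<rho> x = 0" "integral\<^sup>L lborel \<rho> = 1"
    "C1c (cball 0 e) \<rho> (gradient \<rho>)" "continuous_on UNIV \<rho>" "test_function \<rho>" "integrable lborel \<rho>"
proof -
  show 1: "Ck k \<rho>" "0 \<le> \<rho> x" "e \<le> norm x \<Longrightarrow> \<rho> x = 0" "integral\<^sup>L lborel \<rho> = 1" for k x
    using assms by (auto simp: mollifier_def)
  show t: "test_function \<rho>"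
    using 1 by (intro test_functionI[OF _ bounded_cball[of 0 e]]) auto
  show c: "C1c (cball 0 e) \<rho> (gradient \<rho>)" using t 1 by (intro test_function_C1c) auto
  show "continuous_on UNIV \<rho>" using C1cD[OF c] by blast
  show "integrable lborel \<rho>" using C1c_integrable[OF c] by blast
qed

text \<open>Unit mass turns the approximation error into an average of the increments
  \<open>f (x - y) - f x\<close>. Both the uniform and the integral estimates of the error start
  from this form.\<close>

lemma convolution_mollifier_diff:
  fixes f :: "real^'n \<Rightarrow> 'b::euclidean_space"
  assumes m: "mollifier e \<rho>" and f: "loc_int f"
  shows "integrable lborel (\<lambda>y. \<rho> y *\<^sub>R (f (x - y) - f x))"
    "convolution \<rho> f x - f x = (\<integral>y. \<rho> y *\<^sub>R (f (x - y) - f x) \<partial>lborel)"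
proof -
  note m' = mollifierD[OF m]
  have [measurable]: "\<rho> \<in> borel_measurable borel" "f \<in> borel_measurable borel"
    using m'(6) f by (auto intro: borel_measurable_continuous_onI simp: loc_int_def)
  obtain M where M: "M \<ge> 0" "\<And>x. \<bar>\<rho> x\<bar> \<le> M" "\<And>x. norm (gradient \<rho> x) \<le> M" using C1c_bounded[OF m'(5)] by blast
  have i: "integrable lborel (\<lambda>y. \<rho> (x - y) *\<^sub>R f y)"
    using m'(6) M(2) m'(3) f by (rule kernel_integrable)
  have "integrable (distr lborel borel (\<lambda>y. x - y)) (\<lambda>y. \<rho> (x - y) *\<^sub>R f y)"
    using i by (simp add: lborel_distr_reflect)
  then have i2: "integrable lborel (\<lambda>y. \<rho> y *\<^sub>R f (x - y))"
    by (subst (asm) integrable_distr_eq) auto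
  have i3: "integrable lborel (\<lambda>y. \<rho> y *\<^sub>R f x)" using m'(8) by simp
  show "integrable lborel (\<lambda>y. \<rho> y *\<^sub>R (f (x - y) - f x))"
    using Bochner_Integration.integrable_diff[OF i2 i3] by (simp add: scaleR_diff_right)
  have "convolution \<rho> f x = (\<integral>y. \<rho> y *\<^sub>R f (x - y) \<partial>lborel)"
    using lborel_integral_reflect[of "\<lambda>y. \<rho> (x - y) *\<^sub>R f y" x] by (simp add: convolution_def)
  moreover have "f x = (\<integral>y. \<rho> y *\<^sub>R f x \<partial>lborel)" using m'(4,8) by simp
  ultimately show "convolution \<rho> f x - f x = (\<integral>y. \<rho> y *\<^sub>R (f (x - y) - f x) \<partial>lborel)"
    using Bochner_Integration.integral_diff[OF i2 i3] by (simp add: scaleR_diff_right)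
qed

lemma convolution_close:
  fixes f :: "real^'n \<Rightarrow> 'b::euclidean_space"
  assumes m: "mollifier e \<rho>" and f: "loc_int f"
    and close: "\<And>y. norm y < e \<Longrightarrow> norm (f (x - y) - f x) \<le> d"
  shows "norm (convolution \<rho> f x - f x) \<le> d"
proof -
  note m' = mollifierD[OF m]
  have "norm (convolution \<rho> f x - f x) \<le> (\<integral>y. \<rho> y * d \<partial>lborel)"
    unfolding convolution_mollifier_diff(2)[OF m f]
  proof (rule Bochner_Integration.integral_norm_bound_integral)
    show "norm (\<rho> y *\<^sub>R (f (x - y) - f x)) \<le> \<rho> y * d" for y
      using m'(2,3)[of y] close[of y] by (cases "norm y < e") (auto simp: mult_left_mono)
  qed (use m'(8) convolution_mollifier_diff(1)[OF m f] in auto)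
  also have "\<dots> = d" using m'(4,8) by simp
  finally show ?thesis .
qed

text \<open>Borel and \<open>lborel\<close> counterpart of \<open>has_weak_gradient\<close>. Asking
  only for local integrability lets constants be added to \<open>z\<close>.\<close>

definition weak_gradient :: "(real^'n \<Rightarrow> real) \<Rightarrow> (real^'n \<Rightarrow> real^'n) \<Rightarrow> bool" where
  "weak_gradient z g \<longleftrightarrow> loc_int z \<and> loc_int g \<and>
    (\<forall>\<phi> i. test_function \<phi> \<longrightarrow> (\<integral>x. z x * partial_deriv i \<phi> x \<partial>lborel) = - (\<integral>x. g x $ i * \<phi> x \<partial>lborel))"

text \<open>The weak gradient is tested with the reflected kernel y |-> \<rho>(x - y). The sign from
  the reflection cancels the sign in the integration by parts.\<close>

lemma GDERIV_convolution_mollifier: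
  assumes m: "mollifier e \<rho>" and z: "weak_gradient z g"
  shows "GDERIV (convolution \<rho> z) x :> convolution \<rho> g x"
proof -
  note m' = mollifierD[OF m]
  have lz: "loc_int z" and lg: "loc_int g" using z by (auto simp: weak_gradient_def)
  obtain M where M: "M \<ge> 0" "\<And>x. \<bar>\<rho> x\<bar> \<le> M" "\<And>x. norm (gradient \<rho> x) \<le> M" using C1c_bounded[OF m'(5)] by blast
  define \<phi> where "\<phi> y = \<rho> (x - y)" for y
  have t: "test_function \<phi>"
  proof (rule test_functionI[OF _ bounded_cball])
    show "Ck k \<phi>" for k using Ck_reflect[OF m'(1), of k 1 x] by (simp add: \<phi>_def[abs_def])
    show "\<phi> y = 0" if "y \<notin> cball x e" for y
      using that m'(3)[of "x - y"] by (simp add: \<phi>_def dist_norm)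
  qed
  have pd: "partial_deriv i \<phi> y = - (gradient \<rho> (x - y) $ i)" for i y
  proof -
    have "((\<lambda>y. x - y) has_derivative (\<lambda>h. - h)) (at y)"
      by (auto intro!: derivative_eq_intros)
    from has_derivative_compose[OF this, of \<rho> "\<lambda>h. h \<bullet> gradient \<rho> (x - y)"]
    have "GDERIV \<phi> y :> - gradient \<rho> (x - y)"
      using C1cD(2)[OF m'(5), of "x - y"] by (simp add: gderiv_def \<phi>_def[abs_def])
    from partial_deriv_eq[OF this] show ?thesis by simp
  qed
  have i1: "integrable lborel (\<lambda>y. z y *\<^sub>R gradient \<rho> (x - y))"
    by (rule gradient_kernel_integrable[OF m'(5) lz])
  have i2: "integrable lborel (\<lambda>y. \<rho> (x - y) *\<^sub>R g y)"
    using m'(6) M(2) m'(3) lg by (rule kernel_integrable)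
  have "(\<integral>y. z y *\<^sub>R gradient \<rho> (x - y) \<partial>lborel) $ i = convolution \<rho> g x $ i" for i
  proof -
    have "(\<integral>y. z y *\<^sub>R gradient \<rho> (x - y) \<partial>lborel) $ i = - (\<integral>y. z y * partial_deriv i \<phi> y \<partial>lborel)"
      using integral_inner_left[OF i1, of "axis i 1"] by (simp add: inner_axis pd)
    also have "\<dots> = (\<integral>y. g y $ i * \<phi> y \<partial>lborel)"
      using z t by (simp add: weak_gradient_def)
    also have "\<dots> = convolution \<rho> g x $ i"
      using integral_inner_left[OF i2, of "axis i 1"]
      by (simp add: inner_axis convolution_def \<phi>_def mult.commute)
    finally show ?thesis .
  qed
  then have "(\<integral>y. z y *\<^sub>R gradient \<rho> (x - y) \<partial>lborel) = convolution \<rho> g x"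
    by (simp add: vec_eq_iff)
  then show ?thesis using GDERIV_convolution[OF m'(5) lz, of x] by simp
qed

lemma continuous_on_convolution_mollifier:
  fixes g :: "real^'n \<Rightarrow> 'b::euclidean_space"
  assumes m: "mollifier e \<rho>" and g: "loc_int g"
  shows "continuous_on UNIV (convolution \<rho> g)"
proof -
  note m' = mollifierD[OF m]
  obtain M where M: "M \<ge> 0" "\<And>x. \<bar>\<rho> x\<bar> \<le> M" "\<And>x. norm (gradient \<rho> x) \<le> M" using C1c_bounded[OF m'(5)] by blast
  from m'(6) M(2) m'(3) g show ?thesis by (rule continuous_on_convolution)
qed

lemma continuous_loc_int:
  fixes f :: "'a::euclidean_space \<Rightarrow> 'b::euclidean_space"
  assumes "continuous_on UNIV f" shows "loc_int f"
  unfolding loc_int_def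
  using assms by (auto intro!: borel_measurable_continuous_onI borel_integrable_compact intro: continuous_on_subset)

lemma C1c_weak_gradient:
  assumes "C1c A \<phi> D" shows "weak_gradient \<phi> D"
  unfolding weak_gradient_def
proof (intro conjI allI impI)
  note c = C1cD[OF assms]
  show "loc_int \<phi>" "loc_int D" using c by (auto intro: continuous_loc_int)
  fix \<psi> :: "real^'a \<Rightarrow> real" and i assume t: "test_function \<psi>"
  have g: "GDERIV \<psi> x :> gradient \<psi> x" for x
    using t Ck_Suc_GDERIV unfolding test_function_def by blast
  have cg: "continuous_on UNIV (gradient \<psi>)"
    using t Ck_1_continuous_gradient unfolding test_function_def by blast
  have c\<psi>: "continuous_on UNIV \<psi>" using g GDERIV_isCont continuous_at_imp_continuous_on by blast
  have p: "C1c A (\<lambda>x. \<phi> x * \<psi> x) (\<lambda>x. \<psi> x *\<^sub>R D x + \<phi> x *\<^sub>R gradient \<psi> x)"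
    by (rule C1c_mult[OF assms open_UNIV]) (use g cg in auto)
  have i1: "integrable lborel (\<lambda>x. D x $ i * \<psi> x)"
    by (rule continuous_compact_support_integrable[OF _ c(1)])
      (use C1c_gradient_zero[OF assms] in \<open>auto intro!: continuous_intros c c\<psi>\<close>)
  have i2: "integrable lborel (\<lambda>x. \<phi> x * partial_deriv i \<psi> x)"
    using partial_deriv_eq[OF g] c(4)
    by (intro continuous_compact_support_integrable[OF _ c(1)])
      (auto intro!: continuous_intros c cg)
  have "(\<integral>x. (\<psi> x *\<^sub>R D x + \<phi> x *\<^sub>R gradient \<psi> x) \<bullet> axis i 1 \<partial>lborel) = 0"
    by (rule integral_C1c_gradient[OF p])
  then have "(\<integral>x. D x $ i * \<psi> x + \<phi> x * partial_deriv i \<psi> x \<partial>lborel) = 0"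
    by (simp add: inner_axis partial_deriv_eq[OF g] mult.commute)
  then show "(\<integral>x. \<phi> x * partial_deriv i \<psi> x \<partial>lborel) = - (\<integral>x. D x $ i * \<psi> x \<partial>lborel)"
    using i1 i2 by simp
qed

text \<open>This passes from the smooth test functions in the notion of a weak solution to C1 ones.
  Mollification widens the support a little; \<open>B\<close> is a compact neighbourhood of
  \<open>A\<close> inside \<open>U\<close>, common to all n, so for \<open>U = - {0}\<close> the
  approximations stay away from the origin uniformly.\<close>

lemma C1c_approx_test_functions:
  fixes \<phi> :: "real^'n \<Rightarrow> real"
  assumes \<phi>: "C1c A \<phi> D" and U: "open U" "A \<subseteq> U" and nn: "\<And>x. 0 \<le> \<phi> x"
  obtains B \<psi> where "compact B" "B \<subseteq> U" "\<And>n. test_function (\<psi> n)" "\<And>n x. 0 \<le> \<psi> n x"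
    "\<And>n x. x \<notin> B \<Longrightarrow> \<psi> n x = 0"
    "\<And>n x. \<bar>\<psi> n x - \<phi> x\<bar> \<le> inverse (real (Suc n))"
    "\<And>n x. norm (gradient (\<psi> n) x - D x) \<le> inverse (real (Suc n))"
proof -
  note c = C1cD[OF \<phi>]
  have w: "weak_gradient \<phi> D" by (rule C1c_weak_gradient[OF \<phi>])
  have l: "loc_int \<phi>" "loc_int D" using w by (auto simp: weak_gradient_def)
  obtain r where r: "r > 0" and rU: "{x + y |x y. x \<in> A \<and> y \<in> cball 0 r} \<subseteq> U"
  proof -
    obtain r where "r > 0" and sub: "(\<Union>x\<in>A. ball x r) \<subseteq> U"
      using c(1) U compact_subset_open_imp_ball_epsilon_subset by blast
    show thesis
    proof (rule that[of "r/2"])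
      show "r / 2 > 0" using \<open>r > 0\<close> by simp
      show "{x + y |x y. x \<in> A \<and> y \<in> cball 0 (r/2)} \<subseteq> U"
      proof clarify
        fix x y :: "real^'n" assume "x \<in> A" "y \<in> cball 0 (r/2)"
        then have "x + y \<in> ball x r" using \<open>r > 0\<close> by (simp add: dist_norm)
        then show "x + y \<in> U" using sub \<open>x \<in> A\<close> by blast
      qed
    qed
  qed
  define B where "B = {x + y |x y. x \<in> A \<and> y \<in> cball 0 r}"
  have cB: "compact B" unfolding B_def by (intro compact_sums c(1) compact_cball)
  have ex: "\<exists>\<psi>. test_function \<psi> \<and> (\<forall>x. 0 \<le> \<psi> x) \<and> (\<forall>x. x \<notin> B \<longrightarrow> \<psi> x = 0) \<and>
      (\<forall>x. \<bar>\<psi> x - \<phi> x\<bar> \<le> d) \<and> (\<forall>x. norm (gradient \<psi> x - D x) \<le> d)" if d: "d > 0" for d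
  proof -
    obtain M where M: "M \<ge> 0" "\<And>x. \<bar>\<phi> x\<bar> \<le> M" "\<And>x. norm (D x) \<le> M" using C1c_bounded[OF \<phi>] by blast
    obtain R where R: "\<And>x. x \<in> A \<Longrightarrow> norm x \<le> R"
      using compact_imp_bounded[OF c(1)] by (auto simp: bounded_iff)
    have "uniformly_continuous_on (cball 0 (R+2)) D"
      by (intro compact_uniformly_continuous) (auto intro: continuous_on_subset[OF c(3)])
    then obtain d1 where d1: "d1 > 0"
      "\<And>x y. x \<in> cball 0 (R+2) \<Longrightarrow> y \<in> cball 0 (R+2) \<Longrightarrow> dist y x < d1 \<Longrightarrow> dist (D y) (D x) < d"
      using d unfolding uniformly_continuous_on_def by metis
    \<comment> \<open>\<open>d1\<close> controls the gradient by uniform continuity,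
      \<open>d / (M + 1)\<close> the function by its Lipschitz constant \<open>M\<close>;
      \<open>r\<close> keeps the support in \<open>B\<close>, and 1 keeps the shifted points in the
      ball of radius \<open>R + 2\<close>.\<close>
    define e where "e = min (min d1 1) (min r (d / (M + 1)))"
    have e: "e > 0" "e \<le> d1" "e \<le> 1" "e \<le> r" "e \<le> d / (M + 1)" using d d1 r M by (auto simp: e_def)
    obtain \<rho> :: "real^'n \<Rightarrow> real" where m: "mollifier e \<rho>" using mollifier_exists[OF e(1)] .
    note m' = mollifierD[OF m]
    let ?\<psi> = "convolution \<rho> \<phi>"
    have s: "?\<psi> x = 0" if "x \<notin> B" for x
    proof -
      have "\<rho> (x - y) *\<^sub>R \<phi> y = 0" for y
      proof (cases "y \<in> A")
        case True
        have "x = y + (x - y)" by simp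
        then have "x - y \<notin> cball 0 r" using that True unfolding B_def by blast
        then have "\<rho> (x - y) = 0" using e(4) by (intro m'(3)) auto
        then show ?thesis by simp
      qed (use c(4) in simp)
      then show ?thesis by (simp only: convolution_def Bochner_Integration.integral_zero)
    qed
    have nn': "0 \<le> ?\<psi> x" for x
      unfolding convolution_def using m'(2) nn by (auto intro!: Bochner_Integration.integral_nonneg)
    have "Ck k ?\<psi>" for k
    proof (rule Ck_convolution[OF l(1)])
      show "\<forall>m. Ck m \<rho>" using m'(1) by blast
      show "\<rho> y = 0" if "e < norm y" for y using m'(3) that by simp
    qed
    then have t: "test_function ?\<psi>"
      using s compact_imp_bounded[OF cB] by (intro test_functionI[of _ B]) auto
    have gr: "gradient ?\<psi> x = convolution \<rho> D x" for x
      by (rule gradient_eq[OF GDERIV_convolution_mollifier[OF m w]])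
    have c1: "norm (?\<psi> x - \<phi> x) \<le> d" for x
    proof (rule convolution_close[OF m l(1)])
      fix y :: "real^'n" assume y: "norm y < e"
      have "\<bar>\<phi> (x - y) - \<phi> x\<bar> \<le> M * norm ((x - y) - x)"
        by (rule GDERIV_Lipschitz[OF c(2) M(3)])
      also have "\<dots> \<le> M * (d / (M + 1))" using y e(5) M(1) by (intro mult_left_mono) auto
      also have "\<dots> \<le> d" using d M(1) by (simp add: field_simps)
      finally show "norm (\<phi> (x - y) - \<phi> x) \<le> d" by simp
    qed
    have c2: "norm (convolution \<rho> D x - D x) \<le> d" for x
    proof (rule convolution_close[OF m l(2)])
      fix y :: "real^'n" assume y: "norm y < e"
      have n: "norm x \<le> norm (x - y) + norm y" "norm (x - y) \<le> norm x + norm y"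
        using norm_triangle_ineq[of "x - y" y] norm_triangle_ineq4[of x y] by auto
      show "norm (D (x - y) - D x) \<le> d"
      proof (cases "norm x \<le> R + 1")
        case True
        then have "x \<in> cball 0 (R+2)" "x - y \<in> cball 0 (R+2)" using y e n by auto
        moreover have "dist (x - y) x < d1" using y e(2) by (simp add: dist_norm)
        ultimately have "dist (D (x - y)) (D x) < d" by (rule d1(2))
        then show ?thesis by (simp add: dist_norm)
      next
        case False
        then have "\<not> norm x \<le> R" "\<not> norm (x - y) \<le> R" using y e(3) n(1) by linarith+
        then have "x \<notin> A" "x - y \<notin> A" using R by blast+
        then show ?thesis using C1c_gradient_zero[OF \<phi>] d by simp
      qed
    qed
    show ?thesis
      using t s nn' c1 c2 gr by (intro exI[of _ ?\<psi>]) simp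
  qed
  have "\<forall>n. \<exists>\<psi>. test_function \<psi> \<and> (\<forall>x. 0 \<le> \<psi> x) \<and> (\<forall>x. x \<notin> B \<longrightarrow> \<psi> x = 0) \<and>
      (\<forall>x. \<bar>\<psi> x - \<phi> x\<bar> \<le> inverse (real (Suc n))) \<and> (\<forall>x. norm (gradient \<psi> x - D x) \<le> inverse (real (Suc n)))"
    by (intro allI ex) simp
  from choice[OF this] obtain \<psi> where \<psi>: "\<And>n. test_function (\<psi> n) \<and> (\<forall>x. 0 \<le> \<psi> n x) \<and> (\<forall>x. x \<notin> B \<longrightarrow> \<psi> n x = 0) \<and>
      (\<forall>x. \<bar>\<psi> n x - \<phi> x\<bar> \<le> inverse (real (Suc n))) \<and> (\<forall>x. norm (gradient (\<psi> n) x - D x) \<le> inverse (real (Suc n)))"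
    by blast
  show thesis
    by (rule that[OF cB, of \<psi>]) (use \<psi> rU in \<open>simp_all add: B_def\<close>)
qed

subsection \<open>Convergence of mollified weak gradients\<close>

lemma borel_compact_open_approx:
  fixes A :: "'a::euclidean_space set"
  assumes A: "A \<in> sets borel" "emeasure lborel A < \<infinity>" and e: "e > 0"
  obtains K U where "compact K" "open U" "K \<subseteq> A" "A \<subseteq> U" "emeasure lborel (U - K) \<le> ennreal e"
proof -
  obtain U where U: "open U" "A \<subseteq> U" "emeasure lborel (U - A) < e/2"
    using outer_regular_lborel[OF A(1), of "e/2"] e by auto
  \<comment> \<open>Lebesgue measure restricted to \<open>A\<close> is a finite measure, to which
    inner regularity applies.\<close>
  let ?M = "density lborel (indicator A)"
  define r where "r = measure lborel A"
  have r: "emeasure lborel A = ennreal r"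
    using A(2) by (simp add: r_def emeasure_eq_ennreal_measure)
  have em: "emeasure ?M B = emeasure lborel (A \<inter> B)" if "B \<in> sets borel" for B
    using A(1) that by (simp add: emeasure_density flip: indicator_inter_arith)
  have "\<exists>K. K \<subseteq> A \<and> compact K \<and> emeasure lborel (A - K) \<le> ennreal (e/2)"
  proof (cases "r > 0")
    case True
    have "emeasure ?M A = (SUP K \<in> {K. K \<subseteq> A \<and> compact K}. emeasure ?M K)"
      by (rule inner_regular) (use A em in auto)
    moreover have "ennreal (r - e/2) < emeasure ?M A"
      using em[OF A(1)] r True e by (simp add: ennreal_lessI)
    ultimately have "ennreal (r - e/2) < (SUP K \<in> {K. K \<subseteq> A \<and> compact K}. emeasure ?M K)"
      by simp
    then obtain K where K: "K \<subseteq> A" "compact K" "ennreal (r - e/2) < emeasure ?M K"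
      unfolding less_SUP_iff by auto
    have Kb: "K \<in> sets borel" using K(2) by (simp add: borel_compact)
    have eK: "emeasure ?M K = emeasure lborel K" using em[OF Kb] K(1) by (simp add: Int_absorb1)
    have fin: "emeasure lborel K \<noteq> \<infinity>" using emeasure_compact_finite[OF K(2)] by simp
    then have "r - e/2 < measure lborel K"
      using K(3) by (simp add: eK emeasure_eq_ennreal_measure) (metis ennreal_leI not_le)
    moreover have "emeasure lborel (A - K) = ennreal r - emeasure lborel K"
      using emeasure_Diff[OF fin _ _ K(1)] A(1) Kb r by simp
    ultimately have "emeasure lborel (A - K) \<le> ennreal (e/2)"
      using fin by (simp add: emeasure_eq_ennreal_measure ennreal_minus ennreal_leI)
    then show ?thesis using K by blast
  next
    case False
    then have "r = 0" by (simp add: r_def not_less measure_le_0_iff)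
    then show ?thesis using r by (intro exI[of _ "{}"]) simp
  qed
  then obtain K where K: "K \<subseteq> A" "compact K" "emeasure lborel (A - K) \<le> ennreal (e/2)" by blast
  have sK: "K \<in> sets lborel" and sU: "U \<in> sets lborel" using K(2) U(1) by (auto simp: borel_compact)
  have "U - K = (U - A) \<union> (A - K)" using K(1) U(2) by auto
  then have "emeasure lborel (U - K) \<le> emeasure lborel (U - A) + emeasure lborel (A - K)"
    using emeasure_subadditive[of "U - A" lborel "A - K"] sK sU A(1) by simp
  also have "\<dots> \<le> ennreal (e/2) + ennreal (e/2)"
    using U(3) K(3) by (intro add_mono) auto
  also have "\<dots> = ennreal e" using e by (simp flip: ennreal_plus)
  finally show thesis using that[OF K(2) U(1) K(1) U(2)] by simp
qed

lemma compact_open_margin: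
  fixes K :: "'a::euclidean_space set"
  assumes "compact K" "open U" "K \<subseteq> U"
  obtains d where "d > 0" "\<And>x y. x \<in> K \<Longrightarrow> norm y < d \<Longrightarrow> x + y \<in> U \<and> x - y \<in> U"
proof -
  obtain d where d: "d > 0" "(\<Union>x\<in>K. ball x d) \<subseteq> U"
    using compact_subset_open_imp_ball_epsilon_subset[OF assms] by blast
  have "x + y \<in> U \<and> x - y \<in> U" if "x \<in> K" "norm y < d" for x y
  proof -
    have "x + y \<in> ball x d" "x - y \<in> ball x d" using that(2) by (auto simp: dist_norm)
    then show ?thesis using d(2) that(1) by blast
  qed
  with d(1) show thesis by (rule that)
qed

text \<open>Approximation by indicators, sums and limits. For an indicator of \<open>A\<close> take
  a compact \<open>K\<close> inside and an open \<open>U\<close> around it: a shift shorter than the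
  margin between \<open>K\<close> and the complement of \<open>U\<close> alters the indicator only
  on \<open>U - K\<close> and on its translate. In the limit step translation invariance makes the
  two approximation errors equal.\<close>

lemma L1_translation_continuous:
  fixes f :: "'a::euclidean_space \<Rightarrow> 'b::euclidean_space"
  assumes "integrable lborel f"
  shows "\<forall>e>0. \<exists>d>0. \<forall>y. norm y < d \<longrightarrow> (\<integral>\<^sup>+x. ennreal (norm (f (x - y) - f x)) \<partial>lborel) \<le> ennreal e"
  using assms
proof (induction rule: integrable_induct)
  case (base A c)
  show ?case
  proof (intro allI impI)
    fix e :: real assume "e > 0"
    define e' where "e' = e / (2 * (norm c + 1))"
    have cp: "norm c + 1 > 0" using norm_ge_zero[of c] by linarith
    have "e' > 0" using \<open>e > 0\<close> cp by (simp add: e'_def)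
    moreover have "A \<in> sets borel" using base(1) by simp
    ultimately obtain K U where KU: "compact K" "open U" "K \<subseteq> A" "A \<subseteq> U" "emeasure lborel (U - K) \<le> ennreal e'"
      using borel_compact_open_approx base(2) by blast
    have [measurable]: "U - K \<in> sets borel" using KU(1,2) by (auto simp: borel_compact)
    obtain d where d: "d > 0" "\<And>x y. x \<in> K \<Longrightarrow> norm y < d \<Longrightarrow> x + y \<in> U \<and> x - y \<in> U"
      using compact_open_margin[OF KU(1,2)] KU(3,4) by blast
    show "\<exists>d>0. \<forall>y. norm y < d \<longrightarrow>
      (\<integral>\<^sup>+x. ennreal (norm (indicat_real A (x - y) *\<^sub>R c - indicat_real A x *\<^sub>R c)) \<partial>lborel) \<le> ennreal e"
    proof (intro exI[of _ d] conjI d(1) allI impI)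
      fix y :: 'a assume y: "norm y < d"
      have "(\<integral>\<^sup>+x. ennreal (norm (indicat_real A (x - y) *\<^sub>R c - indicat_real A x *\<^sub>R c)) \<partial>lborel)
        \<le> (\<integral>\<^sup>+x. ennreal (norm c) * (indicator (U - K) x + indicator (U - K) (x - y)) \<partial>lborel)"
      proof (rule nn_integral_mono)
        fix x
        have "x - y \<in> K \<Longrightarrow> x \<in> U" "x \<in> K \<Longrightarrow> x - y \<in> U"
          using d(2)[of "x - y" y] d(2)[of x y] y by auto
        then have "norm (indicat_real A (x - y) - indicat_real A x) \<le> indicator (U - K) x + indicator (U - K) (x - y)"
          using KU(3,4) by (auto simp: indicator_def)
        then have "norm c * norm (indicat_real A (x - y) - indicat_real A x)
           \<le> norm c * (indicator (U - K) x + indicator (U - K) (x - y))"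
          by (rule mult_left_mono) simp
        then have "norm (indicat_real A (x - y) *\<^sub>R c - indicat_real A x *\<^sub>R c)
           \<le> norm c * (indicator (U - K) x + indicator (U - K) (x - y))"
          by (simp add: mult.commute flip: scaleR_diff_left)
        then have "ennreal (norm (indicat_real A (x - y) *\<^sub>R c - indicat_real A x *\<^sub>R c))
           \<le> ennreal (norm c * (indicator (U - K) x + indicator (U - K) (x - y)))"
          by (rule ennreal_leI)
        also have "\<dots> = ennreal (norm c) * (indicator (U - K) x + indicator (U - K) (x - y))"
          by (simp add: ennreal_mult ennreal_plus ennreal_indicator)
        finally show "ennreal (norm (indicat_real A (x - y) *\<^sub>R c - indicat_real A x *\<^sub>R c))
           \<le> ennreal (norm c) * (indicator (U - K) x + indicator (U - K) (x - y))" .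
      qed
      also have "\<dots> = ennreal (norm c) * (emeasure lborel (U - K) + emeasure lborel (U - K))"
        by (simp add: nn_integral_cmult nn_integral_add lborel_nn_integral_translate[of "indicator (U - K)"])
      also have "\<dots> \<le> ennreal (norm c) * (ennreal e' + ennreal e')"
        by (intro mult_left_mono add_mono KU(5)) auto
      also have "\<dots> = ennreal (norm c * (2 * e'))"
        using \<open>e' > 0\<close> by (simp add: ennreal_mult flip: ennreal_plus)
      also have "\<dots> \<le> ennreal e"
      proof (rule ennreal_leI)
        have "norm c * (2 * e') \<le> (norm c + 1) * (2 * e')" using \<open>e' > 0\<close> by (intro mult_right_mono) auto
        also have "\<dots> = e" using cp by (simp add: e'_def field_simps)
        finally show "norm c * (2 * e') \<le> e" .
      qed
      finally show "(\<integral>\<^sup>+x. ennreal (norm (indicat_real A (x - y) *\<^sub>R c - indicat_real A x *\<^sub>R c)) \<partial>lborel) \<le> ennreal e" .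
    qed
  qed
next
  case (add f g)
  have [measurable]: "f \<in> borel_measurable borel" "g \<in> borel_measurable borel"
    using borel_measurable_integrable[OF add.hyps(1)] borel_measurable_integrable[OF add.hyps(2)] by auto
  show ?case
  proof (intro allI impI)
    fix e :: real assume "e > 0"
    then have e2: "e/2 > 0" by simp
    obtain d1 d2 where d: "d1 > 0" "d2 > 0"
      "\<And>y. norm y < d1 \<Longrightarrow> (\<integral>\<^sup>+x. ennreal (norm (f (x - y) - f x)) \<partial>lborel) \<le> ennreal (e/2)"
      "\<And>y. norm y < d2 \<Longrightarrow> (\<integral>\<^sup>+x. ennreal (norm (g (x - y) - g x)) \<partial>lborel) \<le> ennreal (e/2)"
      using add.IH(1)[rule_format, OF e2] add.IH(2)[rule_format, OF e2] by blast
    show "\<exists>d>0. \<forall>y. norm y < d \<longrightarrow> (\<integral>\<^sup>+x. ennreal (norm (f (x - y) + g (x - y) - (f x + g x))) \<partial>lborel) \<le> ennreal e"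
    proof (intro exI[of _ "min d1 d2"] conjI allI impI)
      fix y :: 'a assume y: "norm y < min d1 d2"
      have "(\<integral>\<^sup>+x. ennreal (norm (f (x - y) + g (x - y) - (f x + g x))) \<partial>lborel)
        \<le> (\<integral>\<^sup>+x. ennreal (norm (f (x - y) - f x)) + ennreal (norm (g (x - y) - g x)) \<partial>lborel)"
        by (intro nn_integral_mono) (simp add: ennreal_leI norm_diff_triangle_ineq flip: ennreal_plus)
      also have "\<dots> = (\<integral>\<^sup>+x. ennreal (norm (f (x - y) - f x)) \<partial>lborel) + (\<integral>\<^sup>+x. ennreal (norm (g (x - y) - g x)) \<partial>lborel)"
        by (rule nn_integral_add) auto
      also have "\<dots> \<le> ennreal (e/2) + ennreal (e/2)"
        using y by (intro add_mono d) auto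
      also have "\<dots> = ennreal e" using \<open>e > 0\<close> by (simp flip: ennreal_plus)
      finally show "(\<integral>\<^sup>+x. ennreal (norm (f (x - y) + g (x - y) - (f x + g x))) \<partial>lborel) \<le> ennreal e" .
    qed (use d in auto)
  qed
next
  case (lim f s)
  have [measurable]: "f \<in> borel_measurable borel" "s i \<in> borel_measurable borel" for i
    using borel_measurable_integrable[OF lim.hyps(4)] borel_measurable_integrable[OF lim.hyps(1)] by auto
  have conv: "(\<lambda>i. \<integral>\<^sup>+x. ennreal (norm (s i x - f x)) \<partial>lborel) \<longlonglongrightarrow> ennreal 0"
  proof -
    have "(\<lambda>i. \<integral>\<^sup>+x. ennreal (norm (f x - s i x)) \<partial>lborel) \<longlonglongrightarrow> 0"
    proof (rule nn_integral_dominated_convergence_norm)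
      show "AE x in lborel. norm (s i x) \<le> 2 * norm (f x)" for i using lim.hyps(3) by simp
      show "(\<integral>\<^sup>+x. ennreal (2 * norm (f x)) \<partial>lborel) < \<infinity>"
        using lim.hyps(4) by (simp add: integrable_iff_bounded ennreal_mult nn_integral_cmult ennreal_mult_less_top)
      show "AE x in lborel. (\<lambda>i. s i x) \<longlonglongrightarrow> f x" using lim.hyps(2) by simp
    qed measurable
    then show ?thesis by (simp add: norm_minus_commute)
  qed
  show ?case
  proof (intro allI impI)
    fix e :: real assume "e > 0"
    then have "ennreal 0 < ennreal (e/3)" by (intro ennreal_lessI) auto
    from order_tendstoD(2)[OF conv this] obtain i where i: "(\<integral>\<^sup>+x. ennreal (norm (s i x - f x)) \<partial>lborel) < ennreal (e/3)"
      by (auto simp: eventually_sequentially)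
    have e3: "e/3 > 0" using \<open>e > 0\<close> by simp
    obtain d where d: "d > 0"
      "\<And>y. norm y < d \<Longrightarrow> (\<integral>\<^sup>+x. ennreal (norm (s i (x - y) - s i x)) \<partial>lborel) \<le> ennreal (e/3)"
      using lim.IH[rule_format, OF e3] by blast
    show "\<exists>d>0. \<forall>y. norm y < d \<longrightarrow> (\<integral>\<^sup>+x. ennreal (norm (f (x - y) - f x)) \<partial>lborel) \<le> ennreal e"
    proof (intro exI[of _ d] conjI d(1) allI impI)
      fix y :: 'a assume y: "norm y < d"
      let ?N = "\<lambda>x. ennreal (norm (s i x - f x))"
      have "(\<integral>\<^sup>+x. ennreal (norm (f (x - y) - f x)) \<partial>lborel)
        \<le> (\<integral>\<^sup>+x. (?N (x - y) + ennreal (norm (s i (x - y) - s i x))) + ?N x \<partial>lborel)"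
      proof (intro nn_integral_mono)
        fix x
        have "norm (f (x - y) - f x) \<le> norm (f (x - y) - s i (x - y)) + norm (s i (x - y) - s i x) + norm (s i x - f x)"
          using norm_triangle_ineq[of "f (x - y) - s i (x - y)" "s i (x - y) - s i x"]
            norm_triangle_ineq[of "(f (x - y) - s i (x - y)) + (s i (x - y) - s i x)" "s i x - f x"] by simp
        then show "ennreal (norm (f (x - y) - f x)) \<le> (?N (x - y) + ennreal (norm (s i (x - y) - s i x))) + ?N x"
          by (simp add: ennreal_leI norm_minus_commute[of "s i (x - y)" "f (x - y)"] flip: ennreal_plus)
      qed
      also have "\<dots> = (\<integral>\<^sup>+x. ?N (x - y) \<partial>lborel) + (\<integral>\<^sup>+x. ennreal (norm (s i (x - y) - s i x)) \<partial>lborel) + (\<integral>\<^sup>+x. ?N x \<partial>lborel)"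
        by (simp add: nn_integral_add)
      also have "(\<integral>\<^sup>+x. ?N (x - y) \<partial>lborel) = (\<integral>\<^sup>+x. ?N x \<partial>lborel)"
        by (rule lborel_nn_integral_translate) simp
      also have "(\<integral>\<^sup>+x. ?N x \<partial>lborel) + (\<integral>\<^sup>+x. ennreal (norm (s i (x - y) - s i x)) \<partial>lborel) + (\<integral>\<^sup>+x. ?N x \<partial>lborel)
         \<le> ennreal (e/3) + ennreal (e/3) + ennreal (e/3)"
        using i d(2)[OF y] by (intro add_mono) auto
      also have "\<dots> = ennreal e" using \<open>e > 0\<close> by (simp flip: ennreal_plus)
      finally show "(\<integral>\<^sup>+x. ennreal (norm (f (x - y) - f x)) \<partial>lborel) \<le> ennreal e" .
    qed
  qed
qed

section \<open>Weighted L1 estimates for translates and mollifications of Lp functions\<close>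

lemma Young_weighted:
  fixes p \<theta> :: real
  assumes p: "p > 1" and l: "\<theta> > 0"
  obtains C where "C > 0" "\<And>a b. 0 \<le> a \<Longrightarrow> 0 \<le> b \<Longrightarrow> a * b \<le> \<theta> * b powr p + C * a powr (p / (p - 1))"
proof -
  define q where "q = p / (p - 1)"
  have q: "q > 1" "1/p + 1/q = 1" using p by (auto simp: q_def field_simps)
  \<comment> \<open>Young's inequality is applied to \<open>t * b\<close> and \<open>a / t\<close>,
    with \<open>t\<close> chosen so that the first term has the coefficient \<theta>.\<close>
  define t where "t = \<theta> powr (1/p)"
  have t: "t > 0" "t powr p = \<theta>" using l p by (auto simp: t_def powr_powr)
  have "a * b \<le> \<theta> * b powr p + t powr (- q) * a powr q" if "0 \<le> a" "0 \<le> b" for a b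
  proof -
    have "(t * b) * (a / t) \<le> (t * b) powr p / p + (a / t) powr q / q"
      using p q t that by (intro Youngs_inequality) auto
    also have "(t * b) powr p / p \<le> (t * b) powr p"
      using p divide_left_mono[of 1 p "(t * b) powr p"] by simp
    also have "(a / t) powr q / q \<le> (a / t) powr q"
      using q divide_left_mono[of 1 q "(a / t) powr q"] by simp
    also have "(t * b) powr p = \<theta> * b powr p" using t that by (simp add: powr_mult)
    also have "(a / t) powr q = t powr (- q) * a powr q"
      using t that by (simp add: powr_divide powr_minus_divide)
    finally show ?thesis using t by (simp add: mult.commute)
  qed
  then show thesis using that[of "t powr (- q)"] t by (simp add: q_def)
qed

lemma Lp_loc_int:
  fixes g :: "'a::euclidean_space \<Rightarrow> 'b::euclidean_space"
  assumes p: "p \<ge> 1" and g: "g \<in> borel_measurable borel" "integrable lborel (\<lambda>x. norm (g x) powr p)"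
  shows "loc_int g"
  unfolding loc_int_def
proof (intro conjI allI)
  show "g \<in> borel_measurable borel" by fact
  fix R
  have "integrable lborel (\<lambda>x. indicator (cball 0 R) x *\<^sub>R (1::real))"
    by (intro borel_integrable_compact) auto
  then have "integrable lborel (\<lambda>x. indicator (cball 0 R) x + norm (g x) powr p)"
    using g(2) by (intro Bochner_Integration.integrable_add) simp_all
  then show "integrable lborel (\<lambda>x. indicator (cball 0 R) x *\<^sub>R g x)"
  proof (rule Bochner_Integration.integrable_bound)
    show "(\<lambda>x. indicat_real (cball 0 R) x *\<^sub>R g x) \<in> borel_measurable lborel"
      by (intro borel_measurable_scaleR borel_measurable_indicator) (use g(1) in auto)
    have "norm (g x) \<le> 1 + norm (g x) powr p" for x
    proof (cases "norm (g x) \<le> 1")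
      case False
      then have "norm (g x) powr 1 \<le> norm (g x) powr p" using p by (intro powr_mono) auto
      then show ?thesis by simp
    qed (smt (verit) powr_ge_zero)
    then show "AE x in lborel. norm (indicat_real (cball 0 R) x *\<^sub>R g x) \<le> norm (indicat_real (cball 0 R) x + norm (g x) powr p)"
      by (intro AE_I2) (auto simp: indicator_def)
  qed
qed

text \<open>By Hoelder's inequality only the truncations of \<open>V\<close> matter, and for these continuity of
  translations in \<open>L\<^sup>1\<close> suffices.\<close>

lemma weighted_translation_continuous:
  fixes g :: "'a::euclidean_space \<Rightarrow> 'b::euclidean_space" and V :: "'a \<Rightarrow> real"
  assumes p: "p > 1" and g: "g \<in> borel_measurable borel" "integrable lborel (\<lambda>x. norm (g x) powr p)"
    and V: "V \<in> borel_measurable borel" "\<And>x. 0 \<le> V x" "integrable lborel (\<lambda>x. V x powr (p / (p - 1)))"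
    and supp: "\<And>x. R < norm x \<Longrightarrow> V x = 0" and e: "e > 0"
  obtains d where "d > 0"
    "\<And>y. norm y < d \<Longrightarrow> (\<integral>\<^sup>+x. ennreal (V x * norm (g (x - y) - g x)) \<partial>lborel) \<le> ennreal e"
proof -
  define q where "q = p / (p - 1)"
  define J where "J = (\<integral>x. norm (g x) powr p \<partial>lborel)"
  have J: "J \<ge> 0" by (simp add: J_def)
  have J': "(\<integral>\<^sup>+x. ennreal (norm (g x) powr p) \<partial>lborel) = ennreal J"
    unfolding J_def using g(2) by (intro nn_integral_eq_integral) auto
  \<comment> \<open>The error \<open>e\<close> is split into thirds: this \<theta> pays for the p-th
    powers of \<open>g\<close> and its translate in Young's inequality, the tail \<open>T n\<close>
    of \<open>V\<close> for the other term, and the L1 translation error is multiplied by the bound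
    n for \<open>V\<close> off the tail.\<close>
  define \<theta> where "\<theta> = e / (6 * (J + 1))"
  have l: "\<theta> > 0" "2 * \<theta> * J \<le> e / 3" using e J by (auto simp: \<theta>_def field_simps)
  obtain C where C: "C > 0" "\<And>a b. 0 \<le> a \<Longrightarrow> 0 \<le> b \<Longrightarrow> a * b \<le> \<theta> * b powr p + C * a powr q"
    using Young_weighted[OF p l(1)] unfolding q_def by blast
  define T where "T n x = (if V x > real n then V x powr q else 0)" for n :: nat and x
  have [measurable]: "g \<in> borel_measurable borel" "V \<in> borel_measurable borel" by fact+
  have [measurable]: "T n \<in> borel_measurable borel" for n unfolding T_def by measurable
  have "(\<lambda>n. integral\<^sup>L lborel (T n)) \<longlonglongrightarrow> integral\<^sup>L lborel (\<lambda>_::'a. 0::real)"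
  proof (rule integral_dominated_convergence)
    show "integrable lborel (\<lambda>x. V x powr q)" using V(3) by (simp add: q_def)
    show "AE x in lborel. norm (T n x) \<le> V x powr q" for n by (simp add: T_def)
    show "AE x in lborel. (\<lambda>n. T n x) \<longlonglongrightarrow> 0"
    proof (intro AE_I2 tendsto_eventually)
      fix x
      obtain m :: nat where "V x < real m" using reals_Archimedean2 by blast
      then show "eventually (\<lambda>n. T n x = 0) sequentially"
        unfolding eventually_sequentially by (intro exI[of _ m]) (auto simp: T_def)
    qed
  qed measurable
  moreover have "e / (6 * C) > 0" using e C by simp
  ultimately have "eventually (\<lambda>n. integral\<^sup>L lborel (T n) < e / (6 * C)) sequentially"
    using order_tendstoD(2) by force
  then obtain n where n: "integral\<^sup>L lborel (T n) < e / (6 * C)"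
    by (auto simp: eventually_sequentially)
  have iT: "integrable lborel (T n)"
    by (rule Bochner_Integration.integrable_bound[OF V(3)]) (auto simp: T_def q_def)
  have T': "(\<integral>\<^sup>+x. ennreal (T n x) \<partial>lborel) = ennreal (integral\<^sup>L lborel (T n))"
    by (rule nn_integral_eq_integral[OF iT]) (simp add: T_def)
  \<comment> \<open>\<open>V\<close> vanishes beyond \<open>R\<close> and shifts are shorter than 1,
    so \<open>g\<close> may be cut off at radius \<open>R + 1\<close>, where it becomes
    integrable.\<close>
  define G where "G x = indicator (cball 0 (R + 1)) x *\<^sub>R g x" for x
  have iG: "integrable lborel G"
    using Lp_loc_int[OF _ g] p by (simp add: loc_int_def G_def[abs_def])
  from L1_translation_continuous[OF iG, rule_format, of "e / (3 * (real n + 1))"] e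
  obtain d where d: "d > 0"
    "\<And>y. norm y < d \<Longrightarrow> (\<integral>\<^sup>+x. ennreal (norm (G (x - y) - G x)) \<partial>lborel) \<le> ennreal (e / (3 * (real n + 1)))"
    by auto
  have [measurable]: "G \<in> borel_measurable borel" using borel_measurable_integrable[OF iG] by simp
  have "(\<integral>\<^sup>+x. ennreal (V x * norm (g (x - y) - g x)) \<partial>lborel) \<le> ennreal e" if y: "norm y < min d 1" for y
  proof -
    have "(\<integral>\<^sup>+x. ennreal (V x * norm (g (x - y) - g x)) \<partial>lborel) \<le>
      (\<integral>\<^sup>+x. ennreal (real n) * ennreal (norm (G (x - y) - G x)) +
         (ennreal \<theta> * (ennreal (norm (g (x - y)) powr p) + ennreal (norm (g x) powr p)) + ennreal (2 * C) * ennreal (T n x)) \<partial>lborel)"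
    proof (rule nn_integral_mono)
      fix x
      let ?N = "norm (g (x - y) - g x)"
      have "V x * ?N \<le> real n * norm (G (x - y) - G x) + (\<theta> * (norm (g (x - y)) powr p + norm (g x) powr p) + (2 * C) * T n x)"
      proof (cases "V x > real n")
        case True
        have "V x * ?N \<le> V x * (norm (g (x - y)) + norm (g x))"
          using V(2) by (intro mult_left_mono norm_triangle_ineq4) auto
        also have "\<dots> \<le> (\<theta> * norm (g (x - y)) powr p + C * V x powr q) + (\<theta> * norm (g x) powr p + C * V x powr q)"
          using C(2)[OF V(2)[of x], of "norm (g (x - y))"] C(2)[OF V(2)[of x], of "norm (g x)"] by (simp add: distrib_left)
        finally have "V x * ?N \<le> \<theta> * (norm (g (x - y)) powr p + norm (g x) powr p) + (2 * C) * T n x"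
          using True by (simp add: T_def algebra_simps)
        moreover have "0 \<le> real n * norm (G (x - y) - G x)" by simp
        ultimately show ?thesis by linarith
      next
        case False
        have "V x * ?N \<le> real n * norm (G (x - y) - G x)"
        proof (cases "norm x \<le> R")
          case True
          have "norm (x - y) \<le> norm x + norm y" by (rule norm_triangle_ineq4)
          then have "g (x - y) - g x = G (x - y) - G x" using True y by (simp add: G_def)
          then show ?thesis using False by (simp add: mult_right_mono)
        next
          case f: False
          then show ?thesis using supp[of x] by simp
        qed
        moreover have "0 \<le> \<theta> * (norm (g (x - y)) powr p + norm (g x) powr p) + (2 * C) * T n x"
          using l C by (intro add_nonneg_nonneg mult_nonneg_nonneg) (auto simp: T_def)
        ultimately show ?thesis by linarith
      qed
      then have "ennreal (V x * ?N) \<le> ennreal (real n * norm (G (x - y) - G x) + (\<theta> * (norm (g (x - y)) powr p + norm (g x) powr p) + (2 * C) * T n x))"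
        by (rule ennreal_leI)
      also have "\<dots> = ennreal (real n) * ennreal (norm (G (x - y) - G x)) +
         (ennreal \<theta> * (ennreal (norm (g (x - y)) powr p) + ennreal (norm (g x) powr p)) + ennreal (2 * C) * ennreal (T n x))"
        using l C by (simp add: ennreal_plus ennreal_mult T_def)
      finally show "ennreal (V x * ?N) \<le> \<dots>" .
    qed
    also have "\<dots> = ennreal (real n) * (\<integral>\<^sup>+x. ennreal (norm (G (x - y) - G x)) \<partial>lborel) +
       (ennreal \<theta> * ((\<integral>\<^sup>+x. ennreal (norm (g (x - y)) powr p) \<partial>lborel) + (\<integral>\<^sup>+x. ennreal (norm (g x) powr p) \<partial>lborel))
        + ennreal (2 * C) * (\<integral>\<^sup>+x. ennreal (T n x) \<partial>lborel))"
      by (simp add: nn_integral_add nn_integral_cmult)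
    also have "(\<integral>\<^sup>+x. ennreal (norm (g (x - y)) powr p) \<partial>lborel) = (\<integral>\<^sup>+x. ennreal (norm (g x) powr p) \<partial>lborel)"
      by (rule lborel_nn_integral_translate[of "\<lambda>x. ennreal (norm (g x) powr p)"]) simp
    also have "ennreal (real n) * (\<integral>\<^sup>+x. ennreal (norm (G (x - y) - G x)) \<partial>lborel) +
       (ennreal \<theta> * ((\<integral>\<^sup>+x. ennreal (norm (g x) powr p) \<partial>lborel) + (\<integral>\<^sup>+x. ennreal (norm (g x) powr p) \<partial>lborel))
        + ennreal (2 * C) * (\<integral>\<^sup>+x. ennreal (T n x) \<partial>lborel))
       \<le> ennreal (real n) * ennreal (e / (3 * (real n + 1))) + (ennreal \<theta> * (ennreal J + ennreal J)
         + ennreal (2 * C) * ennreal (e / (6 * C)))"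
      unfolding J' T' using y n by (intro add_mono mult_left_mono d(2) ennreal_leI) auto
    also have "\<dots> = ennreal (real n * (e / (3 * (real n + 1))) + (\<theta> * (J + J) + (2 * C) * (e / (6 * C))))"
    proof -
      have aux: "ennreal a * ennreal b + (ennreal c * (ennreal d + ennreal d2) + ennreal f * ennreal h) =
         ennreal (a * b + (c * (d + d2) + f * h))"
        if "0 \<le> a" "0 \<le> b" "0 \<le> c" "0 \<le> d" "0 \<le> d2" "0 \<le> f" "0 \<le> h" for a b c d d2 f h
        using that by (simp add: ennreal_plus ennreal_mult)
      show ?thesis by (rule aux) (use J l C e in auto)
    qed
    also have "\<dots> \<le> ennreal e"
    proof (rule ennreal_leI)
      have part1: "real n * (e / (3 * (real n + 1))) \<le> e / 3" using e by (simp add: field_simps)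
      have part2: "(2 * C) * (e / (6 * C)) = e / 3" using C by simp
      show "real n * (e / (3 * (real n + 1))) + (\<theta> * (J + J) + (2 * C) * (e / (6 * C))) \<le> e"
      proof -
        have "\<theta> * (J + J) = 2 * \<theta> * J" by simp
        with part1 part2 l(2) show ?thesis by linarith
      qed
    qed
    finally show ?thesis .
  qed
  then show thesis using that[of "min d 1"] d(1) by simp
qed

text \<open>By Fubini the weighted mollification error is at most the \<rho>-average of the weighted
  translation errors, each of which is small when the kernel has small support.\<close>

lemma weighted_mollification:
  fixes g :: "real^'n \<Rightarrow> real^'n" and V :: "real^'n \<Rightarrow> real"
  assumes p: "p > 1" and g: "g \<in> borel_measurable borel" "integrable lborel (\<lambda>x. norm (g x) powr p)"
    and V: "V \<in> borel_measurable borel" "\<And>x. 0 \<le> V x" "integrable lborel (\<lambda>x. V x powr (p / (p - 1)))"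
    and supp: "\<And>x. R < norm x \<Longrightarrow> V x = 0" and e: "e > 0"
  obtains d where "d > 0"
    "\<And>r \<rho>. r \<le> d \<Longrightarrow> mollifier r \<rho> \<Longrightarrow> (\<integral>\<^sup>+x. ennreal (V x * norm (convolution \<rho> g x - g x)) \<partial>lborel) \<le> ennreal e"
proof -
  obtain d where d: "d > 0"
    "\<And>y. norm y < d \<Longrightarrow> (\<integral>\<^sup>+x. ennreal (V x * norm (g (x - y) - g x)) \<partial>lborel) \<le> ennreal e"
    using weighted_translation_continuous[OF p g V supp e] by blast
  have lg: "loc_int g" using Lp_loc_int[OF _ g] p by simp
  have [measurable]: "g \<in> borel_measurable borel" "V \<in> borel_measurable borel" by fact+
  have "(\<integral>\<^sup>+x. ennreal (V x * norm (convolution \<rho> g x - g x)) \<partial>lborel) \<le> ennreal e"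
    if r: "r \<le> d" and m: "mollifier r \<rho>" for r and \<rho> :: "real^'n \<Rightarrow> real"
  proof -
    note m' = mollifierD[OF m]
    have [measurable]: "\<rho> \<in> borel_measurable borel" using m'(6) by (rule borel_measurable_continuous_onI)
    let ?F = "\<lambda>x y. ennreal (V x) * (ennreal (\<rho> y) * ennreal (norm (g (x - y) - g x)))"
    have "(\<integral>\<^sup>+x. ennreal (V x * norm (convolution \<rho> g x - g x)) \<partial>lborel) \<le> (\<integral>\<^sup>+x. \<integral>\<^sup>+y. ?F x y \<partial>lborel \<partial>lborel)"
    proof (rule nn_integral_mono)
      fix x
      have "ennreal (norm (convolution \<rho> g x - g x)) \<le> (\<integral>\<^sup>+y. ennreal (norm (\<rho> y *\<^sub>R (g (x - y) - g x))) \<partial>lborel)"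
        unfolding convolution_mollifier_diff(2)[OF m lg]
        using convolution_mollifier_diff(1)[OF m lg] by (rule integral_norm_bound_ennreal)
      also have "\<dots> = (\<integral>\<^sup>+y. ennreal (\<rho> y) * ennreal (norm (g (x - y) - g x)) \<partial>lborel)"
        using m'(2) by (simp add: ennreal_mult)
      finally have "ennreal (V x) * ennreal (norm (convolution \<rho> g x - g x)) \<le>
         ennreal (V x) * (\<integral>\<^sup>+y. ennreal (\<rho> y) * ennreal (norm (g (x - y) - g x)) \<partial>lborel)"
        by (rule mult_left_mono) simp
      then show "ennreal (V x * norm (convolution \<rho> g x - g x)) \<le> (\<integral>\<^sup>+y. ?F x y \<partial>lborel)"
        using V(2) by (simp add: ennreal_mult nn_integral_cmult)
    qed
    also have "\<dots> = (\<integral>\<^sup>+y. \<integral>\<^sup>+x. ?F x y \<partial>lborel \<partial>lborel)"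
      by (rule lborel_pair.Fubini'[symmetric]) measurable
    also have "\<dots> \<le> (\<integral>\<^sup>+y. ennreal (\<rho> y) * ennreal e \<partial>lborel)"
    proof (rule nn_integral_mono)
      fix y
      have "(\<integral>\<^sup>+x. ?F x y \<partial>lborel) = (\<integral>\<^sup>+x. ennreal (\<rho> y) * ennreal (V x * norm (g (x - y) - g x)) \<partial>lborel)"
        using V(2) by (simp add: ennreal_mult mult_ac)
      also have "\<dots> = ennreal (\<rho> y) * (\<integral>\<^sup>+x. ennreal (V x * norm (g (x - y) - g x)) \<partial>lborel)"
        by (rule nn_integral_cmult) measurable
      also have "\<dots> \<le> ennreal (\<rho> y) * ennreal e"
      proof (cases "norm y < d")
        case True
        then show ?thesis by (intro mult_left_mono d(2)) auto
      next
        case False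
        then show ?thesis using m'(3)[of y] r by simp
      qed
      finally show "(\<integral>\<^sup>+x. ?F x y \<partial>lborel) \<le> ennreal (\<rho> y) * ennreal e" .
    qed
    also have "\<dots> = (\<integral>\<^sup>+y. ennreal (\<rho> y) \<partial>lborel) * ennreal e"
      by (rule nn_integral_multc) measurable
    also have "(\<integral>\<^sup>+y. ennreal (\<rho> y) \<partial>lborel) = 1"
      using m'(2,4,8) by (subst nn_integral_eq_integral) auto
    finally show ?thesis by simp
  qed
  with d(1) show thesis by (rule that)
qed

subsection \<open>Nonlinear test functions\<close>

lemma loc_int_compact:
  fixes f :: "'a::euclidean_space \<Rightarrow> 'b::euclidean_space"
  assumes f: "loc_int f" and A: "compact A"
  shows "integrable lborel (\<lambda>x. indicator A x *\<^sub>R f x)"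
proof -
  obtain R where R: "\<And>x. x \<in> A \<Longrightarrow> norm x \<le> R"
    using compact_imp_bounded[OF A] by (auto simp: bounded_iff)
  have "integrable lborel (\<lambda>x. indicator (cball 0 R) x *\<^sub>R f x)" using f by (simp add: loc_int_def)
  then show ?thesis
  proof (rule Bochner_Integration.integrable_bound)
    have "A \<in> sets borel" using A by (simp add: borel_compact)
    then show "(\<lambda>x. indicat_real A x *\<^sub>R f x) \<in> borel_measurable lborel"
      using loc_int_measurable[OF f] by (intro borel_measurable_scaleR borel_measurable_indicator) auto
    show "AE x in lborel. norm (indicat_real A x *\<^sub>R f x) \<le> norm (indicat_real (cball 0 R) x *\<^sub>R f x)"
      using R by (intro AE_I2) (auto simp: indicator_def)
  qed
qed

text \<open>All approximating smooth functions live on one compact \<open>B\<close> that avoids the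
  origin, and they are bounded together with their gradients. Hence \<open>V\<close> and
  \<open>b\<close> restricted to \<open>B\<close> dominate, although \<open>b\<close> may blow up at
  0.\<close>

lemma C1c_supersolution:
  fixes V :: "real^'n \<Rightarrow> real^'n" and b :: "real^'n \<Rightarrow> real"
  assumes V: "loc_int V" and b: "continuous_on (- {0}) b"
    and super: "\<And>B \<phi>. compact B \<Longrightarrow> 0 \<notin> B \<Longrightarrow> test_function \<phi> \<Longrightarrow> (\<And>x. 0 \<le> \<phi> x) \<Longrightarrow>
      (\<And>x. x \<notin> B \<Longrightarrow> \<phi> x = 0) \<Longrightarrow> (\<integral>x. b x * \<phi> x \<partial>lborel) \<le> (\<integral>x. V x \<bullet> gradient \<phi> x \<partial>lborel)"
    and \<phi>: "C1c A \<phi> D" "0 \<notin> A" "\<And>x. 0 \<le> \<phi> x"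
  shows "(\<integral>x. b x * \<phi> x \<partial>lborel) \<le> (\<integral>x. V x \<bullet> D x \<partial>lborel)"
proof -
  have "A \<subseteq> - {0}" using \<phi>(2) by auto
  then obtain B \<psi> where B: "compact B" "B \<subseteq> - {0}" and \<psi>: "\<And>n. test_function (\<psi> n)" "\<And>n x. 0 \<le> \<psi> n x"
    "\<And>n x. x \<notin> B \<Longrightarrow> \<psi> n x = 0"
    "\<And>n x. \<bar>\<psi> n x - \<phi> x\<bar> \<le> inverse (real (Suc n))"
    "\<And>n x. norm (gradient (\<psi> n) x - D x) \<le> inverse (real (Suc n))"
    using C1c_approx_test_functions[OF \<phi>(1) _ _ \<phi>(3), of "- {0}"] by blast
  obtain M where M: "M \<ge> 0" "\<And>x. \<bar>\<phi> x\<bar> \<le> M" "\<And>x. norm (D x) \<le> M"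
    using C1c_bounded[OF \<phi>(1)] by blast
  have c: "C1c B (\<psi> n) (gradient (\<psi> n))" for n
    by (rule test_function_C1c[OF \<psi>(1) B(1) \<psi>(3)])
  have le1: "inverse (real (Suc n)) \<le> 1" for n by (simp add: field_simps)
  have bd: "\<bar>\<psi> n x\<bar> \<le> M + 1" "norm (gradient (\<psi> n) x) \<le> M + 1" for n x
  proof -
    show "\<bar>\<psi> n x\<bar> \<le> M + 1" using \<psi>(4)[of n x] M(2)[of x] le1[of n] by linarith
    show "norm (gradient (\<psi> n) x) \<le> M + 1"
      using \<psi>(5)[of n x] M(3)[of x] le1[of n] norm_triangle_sub[of "gradient (\<psi> n) x" "D x"] by linarith
  qed
  have inv0: "(\<lambda>n. inverse (real (Suc n))) \<longlonglongrightarrow> 0" by (rule LIMSEQ_inverse_real_of_nat)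
  have lim: "(\<lambda>n. \<psi> n x) \<longlonglongrightarrow> \<phi> x" "(\<lambda>n. gradient (\<psi> n) x) \<longlonglongrightarrow> D x" for x
  proof -
    show "(\<lambda>n. \<psi> n x) \<longlonglongrightarrow> \<phi> x"
      using \<psi>(4) by (intro LIM_zero_cancel[OF Lim_null_comparison[OF _ inv0]]) auto
    show "(\<lambda>n. gradient (\<psi> n) x) \<longlonglongrightarrow> D x"
      using \<psi>(5) by (intro LIM_zero_cancel[OF Lim_null_comparison[OF _ inv0]]) auto
  qed
  have sB: "B \<in> sets borel" using B(1) by (simp add: borel_compact)
  have [measurable]: "V \<in> borel_measurable borel" by (rule loc_int_measurable[OF V])
  have mgrad[measurable]: "gradient (\<psi> n) \<in> borel_measurable borel" "\<psi> n \<in> borel_measurable borel" for n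
    using borel_measurable_continuous_onI[OF C1cD(3)[OF c]] borel_measurable_continuous_onI[OF C1cD(5)[OF c]] by auto
  have [measurable]: "D \<in> borel_measurable borel" "\<phi> \<in> borel_measurable borel"
    using borel_measurable_continuous_onI[OF C1cD(3)[OF \<phi>(1)]] borel_measurable_continuous_onI[OF C1cD(5)[OF \<phi>(1)]] by auto
  have ib: "integrable lborel (\<lambda>x. indicator B x *\<^sub>R b x)"
    by (rule borel_integrable_compact[OF B(1) continuous_on_subset[OF b B(2)]])
  have l1: "(\<lambda>n. \<integral>x. V x \<bullet> gradient (\<psi> n) x \<partial>lborel) \<longlonglongrightarrow> (\<integral>x. V x \<bullet> D x \<partial>lborel)"
  proof (rule integral_dominated_convergence)
    have "integrable lborel (\<lambda>x. norm (indicator B x *\<^sub>R V x) * (M + 1))"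
      using loc_int_compact[OF V B(1)] by (intro integrable_mult_left) (rule integrable_norm)
    then show "integrable lborel (\<lambda>x. norm (indicator B x *\<^sub>R V x) * (M + 1))" .
    show "AE x in lborel. (\<lambda>n. V x \<bullet> gradient (\<psi> n) x) \<longlonglongrightarrow> V x \<bullet> D x"
      by (intro AE_I2 tendsto_intros lim)
    show "AE x in lborel. norm (V x \<bullet> gradient (\<psi> n) x) \<le> norm (indicat_real B x *\<^sub>R V x) * (M + 1)" for n
    proof (rule AE_I2)
      fix x
      show "norm (V x \<bullet> gradient (\<psi> n) x) \<le> norm (indicat_real B x *\<^sub>R V x) * (M + 1)"
      proof (cases "x \<in> B")
        case True
        have "norm (V x \<bullet> gradient (\<psi> n) x) \<le> norm (V x) * norm (gradient (\<psi> n) x)"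
          using Cauchy_Schwarz_ineq2 by auto
        also have "\<dots> \<le> norm (V x) * (M + 1)" by (intro mult_left_mono bd) auto
        finally show ?thesis using True by simp
      next
        case False
        then show ?thesis using C1c_gradient_zero[OF c False] by simp
      qed
    qed
  qed measurable
  have meas_b: "(\<lambda>x. b x * f x) \<in> borel_measurable lborel"
    if "f \<in> borel_measurable borel" "\<And>x. x \<notin> B \<Longrightarrow> f x = 0" for f :: "real^'n \<Rightarrow> real"
  proof -
    have "(\<lambda>x. (indicator B x *\<^sub>R b x) * f x) \<in> borel_measurable lborel"
      using borel_measurable_integrable[OF ib] that(1) by (intro borel_measurable_times) auto
    moreover have "(\<lambda>x. (indicator B x *\<^sub>R b x) * f x) = (\<lambda>x. b x * f x)"
      using that(2) by (auto simp: indicator_def fun_eq_iff)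
    ultimately show ?thesis by simp
  qed
  have \<phi>B: "\<phi> x = 0" if "x \<notin> B" for x
  proof -
    have "(\<lambda>n. \<psi> n x) \<longlonglongrightarrow> 0" using \<psi>(3)[OF that] by simp
    then show ?thesis using lim(1) LIMSEQ_unique by blast
  qed
  have l2: "(\<lambda>n. \<integral>x. b x * \<psi> n x \<partial>lborel) \<longlonglongrightarrow> (\<integral>x. b x * \<phi> x \<partial>lborel)"
  proof (rule integral_dominated_convergence)
    show "integrable lborel (\<lambda>x. norm (indicator B x *\<^sub>R b x) * (M + 1))"
      using ib by (intro integrable_mult_left) (rule integrable_norm)
    show "AE x in lborel. (\<lambda>n. b x * \<psi> n x) \<longlonglongrightarrow> b x * \<phi> x"
      by (intro AE_I2 tendsto_intros lim)
    show "AE x in lborel. norm (b x * \<psi> n x) \<le> norm (indicat_real B x *\<^sub>R b x) * (M + 1)" for n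
    proof (rule AE_I2)
      fix x
      show "norm (b x * \<psi> n x) \<le> norm (indicat_real B x *\<^sub>R b x) * (M + 1)"
        using bd(1)[of n x] \<psi>(3)[of x n] by (cases "x \<in> B") (auto simp: abs_mult mult_left_mono)
    qed
    show "(\<lambda>x. b x * \<psi> n x) \<in> borel_measurable lborel" for n by (rule meas_b[OF mgrad(2) \<psi>(3)])
    show "(\<lambda>x. b x * \<phi> x) \<in> borel_measurable lborel" by (rule meas_b[OF _ \<phi>B]) auto
  qed
  have "(\<integral>x. b x * \<psi> n x \<partial>lborel) \<le> (\<integral>x. V x \<bullet> gradient (\<psi> n) x \<partial>lborel)" for n
    using B by (intro super[OF B(1)] \<psi>) auto
  then show ?thesis by (intro LIMSEQ_le[OF l2 l1]) auto
qed

lemma uniform_shift_close: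
  fixes z :: "'a::euclidean_space \<Rightarrow> real"
  assumes A: "compact A" "A \<subseteq> U" "open U" and z: "continuous_on U z" and e: "e > 0"
  obtains d where "d > 0" "\<And>x y. x \<in> A \<Longrightarrow> norm y < d \<Longrightarrow> \<bar>z (x - y) - z x\<bar> \<le> e"
proof -
  obtain r where r: "r > 0" "\<And>x y. x \<in> A \<Longrightarrow> norm y < r \<Longrightarrow> x + y \<in> U \<and> x - y \<in> U"
    using compact_open_margin[OF A(1,3,2)] by blast
  define B where "B = {x + y |x y. x \<in> A \<and> y \<in> cball 0 (r/2)}"
  have "compact B" unfolding B_def by (intro compact_sums A(1) compact_cball)
  moreover have "B \<subseteq> U" unfolding B_def using r by auto
  ultimately have "uniformly_continuous_on B z"
    using z by (intro compact_uniformly_continuous) (auto intro: continuous_on_subset)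
  then obtain d where d: "d > 0" "\<And>x y. x \<in> B \<Longrightarrow> y \<in> B \<Longrightarrow> dist y x < d \<Longrightarrow> dist (z y) (z x) < e"
    using e unfolding uniformly_continuous_on_def by metis
  have "\<bar>z (x - y) - z x\<bar> \<le> e" if x: "x \<in> A" and y: "norm y < min d (r/2)" for x y
  proof -
    have "x = x + 0" "0 \<in> cball (0::'a) (r/2)" using r(1) by auto
    then have 1: "x \<in> B" unfolding B_def using x by blast
    have "x - y = x + (- y)" "- y \<in> cball 0 (r/2)" using y by auto
    then have 2: "x - y \<in> B" unfolding B_def using x by blast
    have "dist (x - y) x < d" using y by (simp add: dist_norm)
    then have "dist (z (x - y)) (z x) < e" by (rule d(2)[OF 1 2])
    then show ?thesis by (simp add: dist_real_def)
  qed
  then show thesis using that[of "min d (r/2)"] d(1) r(1) by auto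
qed

lemma continuous_compact_pos_bounds:
  fixes z :: "'a::topological_space \<Rightarrow> real"
  assumes "compact A" "continuous_on A z" "\<And>x. x \<in> A \<Longrightarrow> z x > 0"
  obtains c Z where "c > 0" "\<And>x. x \<in> A \<Longrightarrow> c \<le> z x" "\<And>x. x \<in> A \<Longrightarrow> z x \<le> Z"
proof (cases "A = {}")
  case False
  obtain x1 where "x1 \<in> A" "\<And>x. x \<in> A \<Longrightarrow> z x1 \<le> z x"
    using continuous_attains_inf[OF assms(1) False assms(2)] by blast
  moreover obtain x2 where "x2 \<in> A" "\<And>x. x \<in> A \<Longrightarrow> z x \<le> z x2"
    using continuous_attains_sup[OF assms(1) False assms(2)] by blast
  ultimately show thesis using that assms(3) by blast
qed (use that[of 1] in auto)

lemma GDERIV_ln_ratio: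
  fixes \<zeta> :: "real^'n \<Rightarrow> real"
  assumes "GDERIV \<zeta> x :> E" "\<zeta> x > 0" "x \<noteq> 0"
  shows "GDERIV (\<lambda>x. ln (\<zeta> x) + \<gamma> * ln (norm x) - l) x :> (1 / \<zeta> x) *\<^sub>R E + (\<gamma> / (norm x)\<^sup>2) *\<^sub>R x"
proof -
  have "DERIV ln (\<zeta> x) :> 1 / \<zeta> x" "DERIV (\<lambda>r. \<gamma> * ln r) (norm x) :> \<gamma> / norm x"
    using assms by (auto intro!: derivative_eq_intros)
  from GDERIV_diff[OF GDERIV_add[OF GDERIV_DERIV_compose[OF assms(1) this(1)] GDERIV_DERIV_compose[OF GDERIV_norm[OF assms(3)] this(2)]] GDERIV_const[of l]]
  show ?thesis using assms(3) by (simp add: sgn_div_norm power2_eq_square divide_inverse mult.assoc)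
qed

lemma mult_le_powr_sum:
  fixes a b p :: real
  assumes "p > 1" "0 \<le> a" "0 \<le> b"
  shows "a * b \<le> a powr (p / (p - 1)) + b powr p"
proof -
  have q: "p / (p - 1) > 1" "1 / (p / (p - 1)) + 1 / p = 1" using assms by (auto simp: field_simps)
  have "a * b \<le> a powr (p / (p - 1)) / (p / (p - 1)) + b powr p / p"
    using assms q by (intro Youngs_inequality) auto
  also have "\<dots> \<le> a powr (p / (p - 1)) + b powr p"
    using q(1) assms(1) divide_left_mono[of 1 p "b powr p"]
      divide_left_mono[of 1 "p / (p - 1)" "a powr (p / (p - 1))"] by (intro add_mono) auto
  finally show ?thesis .
qed

text \<open>The limit objects correspond to \<open>\<phi> = a K(ln (z / w))\<close> with \<open>w = m |x|\<^sup>-\<^sup>\<gamma>\<close>; they are obtained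
  by mollifying \<open>z\<close>.\<close>

lemma composite_test_functions:
  fixes z a :: "real^'n \<Rightarrow> real" and g V Da :: "real^'n \<Rightarrow> real^'n" and l \<gamma> :: real
  defines "f \<equiv> \<lambda>x. ln (z x) + \<gamma> * ln (norm x) - l"
    and "h \<equiv> \<lambda>x. (1 / z x) *\<^sub>R g x + (\<gamma> / (norm x)\<^sup>2) *\<^sub>R x"
  assumes p: "p > 1" and zg: "weak_gradient z g" and g: "integrable lborel (\<lambda>x. norm (g x) powr p)"
    and z: "continuous_on (- {0}) z" "\<And>x. x \<noteq> 0 \<Longrightarrow> z x > 0"
    and a: "C1c A a Da" "0 \<notin> A"
    and K: "\<And>t. DERIV K t :> K' t" "continuous_on UNIV K'"
    and V: "V \<in> borel_measurable borel" "integrable lborel (\<lambda>x. indicator A x * norm (V x) powr (p / (p - 1)))"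
  obtains \<phi> D M where "\<And>n. C1c A (\<phi> n) (D n)" "\<And>n x. \<exists>t. \<phi> n x = a x * K t"
    "\<And>x. (\<lambda>n. \<phi> n x) \<longlonglongrightarrow> a x * K (f x)" "\<And>n x. \<bar>\<phi> n x\<bar> \<le> M"
    "(\<lambda>n. \<integral>x. V x \<bullet> D n x \<partial>lborel) \<longlonglongrightarrow>
       (\<integral>x. V x \<bullet> (K (f x) *\<^sub>R Da x + (a x * K' (f x)) *\<^sub>R h x) \<partial>lborel)"
    "integrable lborel (\<lambda>x. V x \<bullet> (K (f x) *\<^sub>R Da x + (a x * K' (f x)) *\<^sub>R h x))"
proof -
  note ca = C1cD[OF a(1)]
  have AU: "A \<subseteq> - {0}" using a(2) by auto
  have lz: "loc_int z" and lg: "loc_int g" using zg by (auto simp: weak_gradient_def)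
  note mg = loc_int_measurable[OF lg]
  have contK: "continuous_on UNIV K" using K(1) DERIV_isCont continuous_at_imp_continuous_on by blast
  have sA: "A \<in> sets borel" using ca(1) by (simp add: borel_compact)
  have zA: "z x > 0" if "x \<in> A" for x using z(2) AU that by blast
  obtain c Z where cZ: "c > 0" "\<And>x. x \<in> A \<Longrightarrow> c \<le> z x" "\<And>x. x \<in> A \<Longrightarrow> z x \<le> Z"
    using continuous_compact_pos_bounds[OF ca(1) continuous_on_subset[OF z(1) AU] zA] by blast
  obtain r R where rR: "r > 0" "\<And>x. x \<in> A \<Longrightarrow> r \<le> norm x" "\<And>x. x \<in> A \<Longrightarrow> norm x \<le> R"
    by (rule continuous_compact_pos_bounds[of A norm])
      (use ca(1) AU in \<open>auto intro: continuous_intros\<close>)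
  define W where "W x = indicator A x * norm (V x)" for x
  have W0: "W x \<ge> 0" for x by (simp add: W_def)
  have mW[measurable]: "W \<in> borel_measurable borel"
    unfolding W_def using V(1) sA by (intro borel_measurable_times borel_measurable_indicator) auto
  have Wq: "W x powr (p / (p - 1)) = indicator A x * norm (V x) powr (p / (p - 1))" for x
    by (auto simp: W_def indicator_def)
  have iWq: "integrable lborel (\<lambda>x. W x powr (p / (p - 1)))" unfolding Wq by (rule V(2))
  \<comment> \<open>\<open>\<zeta>\<close> and \<open>E\<close> are the mollifications of
    \<open>z\<close> and \<open>g\<close> with the same kernel: uniform closeness on
    \<open>A\<close> is needed for \<open>z\<close>, but for \<open>g\<close> only closeness in L1
    with weight |V|, because \<open>g\<close> enters the tested integrals linearly and paired with
    \<open>V\<close>.\<close>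
  have ex: "\<exists>\<zeta> E. (\<forall>x. GDERIV \<zeta> x :> E x) \<and> continuous_on UNIV E \<and> (\<forall>x\<in>A. \<bar>\<zeta> x - z x\<bar> \<le> d) \<and>
     (\<integral>\<^sup>+x. ennreal (W x * norm (E x - g x)) \<partial>lborel) \<le> ennreal d" if d: "d > 0" for d
  proof -
    obtain d1 where d1: "d1 > 0" "\<And>x y. x \<in> A \<Longrightarrow> norm y < d1 \<Longrightarrow> \<bar>z (x - y) - z x\<bar> \<le> d"
      using uniform_shift_close[OF ca(1) AU _ z(1) d] by auto
    have supp: "W x = 0" if "R < norm x" for x using rR(3)[of x] that by (auto simp: W_def indicator_def)
    obtain d2 where d2: "d2 > 0"
      "\<And>r \<rho>. r \<le> d2 \<Longrightarrow> mollifier r \<rho> \<Longrightarrow> (\<integral>\<^sup>+x. ennreal (W x * norm (convolution \<rho> g x - g x)) \<partial>lborel) \<le> ennreal d"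
      using weighted_mollification[OF p mg g mW W0 iWq supp d] by blast
    have "min d1 d2 > 0" using d1(1) d2(1) by simp
    then obtain \<rho> :: "real^'n \<Rightarrow> real" where m: "mollifier (min d1 d2) \<rho>" by (rule mollifier_exists)
    have "\<bar>convolution \<rho> z x - z x\<bar> \<le> d" if "x \<in> A" for x
    proof -
      have "norm (convolution \<rho> z x - z x) \<le> d"
        by (rule convolution_close[OF m lz]) (use d1(2)[OF that] in auto)
      then show ?thesis by simp
    qed
    moreover have "(\<integral>\<^sup>+x. ennreal (W x * norm (convolution \<rho> g x - g x)) \<partial>lborel) \<le> ennreal d"
      by (rule d2(2)[OF _ m]) simp
    ultimately show ?thesis
      using GDERIV_convolution_mollifier[OF m zg] continuous_on_convolution_mollifier[OF m lg]
      by (intro exI[of _ "convolution \<rho> z"] exI[of _ "convolution \<rho> g"]) simp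
  qed
  \<comment> \<open>With an error of at most \<open>c / 2\<close> the mollification stays above
    \<open>c / 2\<close> on \<open>A\<close>, so its logarithm and reciprocal are bounded uniformly
    in n.\<close>
  define dl where "dl n = min (c/2) (inverse (real (Suc n)))" for n
  have dl: "dl n > 0" "dl n \<le> c / 2" "dl n \<le> inverse (real (Suc n))" for n using cZ(1) by (auto simp: dl_def)
  have "\<forall>n. \<exists>\<zeta>E. (\<forall>x. GDERIV (fst \<zeta>E) x :> snd \<zeta>E x) \<and> continuous_on UNIV (snd \<zeta>E) \<and> (\<forall>x\<in>A. \<bar>fst \<zeta>E x - z x\<bar> \<le> dl n) \<and>
     (\<integral>\<^sup>+x. ennreal (W x * norm (snd \<zeta>E x - g x)) \<partial>lborel) \<le> ennreal (dl n)"
    using ex[OF dl(1)] by simp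
  from choice[OF this] obtain \<zeta>E where \<zeta>E: "\<forall>n. (\<forall>x. GDERIV (fst (\<zeta>E n)) x :> snd (\<zeta>E n) x) \<and>
     continuous_on UNIV (snd (\<zeta>E n)) \<and> (\<forall>x\<in>A. \<bar>fst (\<zeta>E n) x - z x\<bar> \<le> dl n) \<and>
     (\<integral>\<^sup>+x. ennreal (W x * norm (snd (\<zeta>E n) x - g x)) \<partial>lborel) \<le> ennreal (dl n)" ..
  define \<zeta> E where "\<zeta> n = fst (\<zeta>E n)" and "E n = snd (\<zeta>E n)" for n
  have \<zeta>: "\<And>n x. GDERIV (\<zeta> n) x :> E n x" "\<And>n. continuous_on UNIV (E n)"
    "\<And>n x. x \<in> A \<Longrightarrow> \<bar>\<zeta> n x - z x\<bar> \<le> dl n"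
    "\<And>n. (\<integral>\<^sup>+x. ennreal (W x * norm (E n x - g x)) \<partial>lborel) \<le> ennreal (dl n)"
    using \<zeta>E by (auto simp: \<zeta>_def E_def)
  have contz: "continuous_on UNIV (\<zeta> n)" for n
    using \<zeta>(1) GDERIV_isCont continuous_at_imp_continuous_on by blast
  have mE[measurable]: "E n \<in> borel_measurable borel" for n by (rule borel_measurable_continuous_onI[OF \<zeta>(2)])
  have \<zeta>b: "c / 2 \<le> \<zeta> n x" "\<zeta> n x \<le> Z + c" "\<zeta> n x > 0" if "x \<in> A" for n x
    using \<zeta>(3)[OF that, of n] dl(2)[of n] cZ(1) cZ(2)[OF that] cZ(3)[OF that] by linarith+
  define F where "F n x = ln (\<zeta> n x) + \<gamma> * ln (norm x) - l" for n x
  define H where "H n x = (1 / \<zeta> n x) *\<^sub>R E n x + (\<gamma> / (norm x)\<^sup>2) *\<^sub>R x" for n x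
  define S where "S n = {x. \<zeta> n x > 0} \<inter> - {0}" for n
  have S: "open (S n)" "A \<subseteq> S n" for n
  proof -
    have "open {x. 0 < \<zeta> n x}"
      by (intro open_Collect_less continuous_intros contz)
    then show "open (S n)" unfolding S_def by (intro open_Int) auto
    show "A \<subseteq> S n" using \<zeta>b(3) AU by (auto simp: S_def)
  qed
  have FH: "GDERIV (F n) x :> H n x" if "x \<in> S n" for n x
    unfolding F_def[abs_def] H_def using that by (intro GDERIV_ln_ratio \<zeta>(1)) (auto simp: S_def)
  have contF: "continuous_on (S n) (F n)" for n
    using FH GDERIV_isCont by (intro continuous_at_imp_continuous_on) blast
  have KF: "GDERIV (\<lambda>x. K (F n x)) x :> K' (F n x) *\<^sub>R H n x" if "x \<in> S n" for n x
    by (rule GDERIV_DERIV_compose[OF FH[OF that] K(1)])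
  have contH: "continuous_on (S n) (\<lambda>x. K' (F n x) *\<^sub>R H n x)" for n
  proof -
    have "continuous_on (S n) (\<lambda>x. K' (F n x))"
      by (rule continuous_on_compose2[OF K(2) contF]) simp
    moreover have "continuous_on (S n) (H n)"
      unfolding H_def by (intro continuous_intros continuous_on_subset[OF contz] continuous_on_subset[OF \<zeta>(2)])
        (auto simp: S_def)
    ultimately show ?thesis by (intro continuous_intros)
  qed
  define \<phi> where "\<phi> n x = a x * K (F n x)" for n x
  define D where "D n x = K (F n x) *\<^sub>R Da x + a x *\<^sub>R (K' (F n x) *\<^sub>R H n x)" for n x
  have C: "C1c A (\<phi> n) (D n)" for n
    unfolding \<phi>_def[abs_def] D_def[abs_def] by (rule C1c_mult[OF a(1) S KF contH])
  have az: "a x = 0" "Da x = 0" if "x \<notin> A" for x using ca(4)[OF that] C1c_gradient_zero[OF a(1) that] by auto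
  have dl0: "dl \<longlonglongrightarrow> 0"
    by (rule tendsto_sandwich[OF _ _ tendsto_const LIMSEQ_inverse_real_of_nat])
      (use dl in \<open>auto simp: less_imp_le\<close>)
  have \<zeta>lim: "(\<lambda>n. \<zeta> n x) \<longlonglongrightarrow> z x" if "x \<in> A" for x
    using \<zeta>(3)[OF that] by (intro LIM_zero_cancel[OF Lim_null_comparison[OF _ dl0]]) auto
  have Flim: "(\<lambda>n. F n x) \<longlonglongrightarrow> f x" if "x \<in> A" for x
    unfolding F_def f_def using cZ(1) cZ(2)[OF that] by (intro tendsto_intros \<zeta>lim[OF that]) auto
  have Klim: "(\<lambda>n. K (F n x)) \<longlonglongrightarrow> K (f x)" "(\<lambda>n. K' (F n x)) \<longlonglongrightarrow> K' (f x)" if "x \<in> A" for x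
    using continuous_on_tendsto_compose[OF contK Flim[OF that]] continuous_on_tendsto_compose[OF K(2) Flim[OF that]] by auto
  have \<phi>lim: "(\<lambda>n. \<phi> n x) \<longlonglongrightarrow> a x * K (f x)" for x
  proof (cases "x \<in> A")
    case True
    then show ?thesis unfolding \<phi>_def by (intro tendsto_intros Klim)
  qed (simp add: \<phi>_def az)
  \<comment> \<open>A bound for \<open>F n\<close> on \<open>A\<close>, uniform in n;
    \<open>K\<close> and \<open>K'\<close> matter only on [-B, B], where continuity bounds
    them.\<close>
  define B where "B = (\<bar>ln (c/2)\<bar> + \<bar>ln (Z + c)\<bar>) + \<bar>\<gamma>\<bar> * (\<bar>ln r\<bar> + \<bar>ln R\<bar>) + \<bar>l\<bar>"
  have FB: "\<bar>F n x\<bar> \<le> B" if "x \<in> A" for n x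
  proof -
    have "ln (c/2) \<le> ln (\<zeta> n x)" "ln (\<zeta> n x) \<le> ln (Z + c)"
      using \<zeta>b[OF that, of n] cZ(1) by auto
    then have 1: "\<bar>ln (\<zeta> n x)\<bar> \<le> \<bar>ln (c/2)\<bar> + \<bar>ln (Z + c)\<bar>" by linarith
    have "0 < norm x" using rR(1) rR(2)[OF that] by linarith
    then have "ln r \<le> ln (norm x)" "ln (norm x) \<le> ln R"
      using rR(1) rR(2)[OF that] rR(3)[OF that] by auto
    then have "\<bar>ln (norm x)\<bar> \<le> \<bar>ln r\<bar> + \<bar>ln R\<bar>" by linarith
    then have 2: "\<bar>\<gamma> * ln (norm x)\<bar> \<le> \<bar>\<gamma>\<bar> * (\<bar>ln r\<bar> + \<bar>ln R\<bar>)" by (simp add: abs_mult mult_left_mono)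
    show ?thesis using 1 2 unfolding F_def B_def by linarith
  qed
  have "compact (K ` {-B..B})" "compact (K' ` {-B..B})"
    using contK K(2) by (auto intro!: compact_continuous_image intro: continuous_on_subset)
  then have "bounded (K ` {-B..B})" "bounded (K' ` {-B..B})" by (auto intro: compact_imp_bounded)
  then have "\<exists>M1. \<forall>t\<in>{-B..B}. \<bar>K t\<bar> \<le> M1" "\<exists>M2. \<forall>t\<in>{-B..B}. \<bar>K' t\<bar> \<le> M2"
    by (auto simp: bounded_iff)
  then obtain M1 M2 where M12: "\<And>t. t \<in> {-B..B} \<Longrightarrow> \<bar>K t\<bar> \<le> M1" "\<And>t. t \<in> {-B..B} \<Longrightarrow> \<bar>K' t\<bar> \<le> M2"
    by blast
  define M where "M = max 0 (max M1 M2)"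
  have KM: "\<bar>K (F n x)\<bar> \<le> M" "\<bar>K' (F n x)\<bar> \<le> M" if "x \<in> A" for n x
    using M12[of "F n x"] FB[OF that, of n] by (auto simp: M_def abs_le_iff)
  have M0: "M \<ge> 0" by (simp add: M_def)
  obtain Ma where Ma: "Ma \<ge> 0" "\<And>x. \<bar>a x\<bar> \<le> Ma" "\<And>x. norm (Da x) \<le> Ma"
    using C1c_bounded[OF a(1)] by blast
  have \<phi>M: "\<bar>\<phi> n x\<bar> \<le> Ma * M" for n x
  proof (cases "x \<in> A")
    case True
    then show ?thesis unfolding \<phi>_def abs_mult by (intro mult_mono Ma KM) auto
  next
    case False
    then show ?thesis using M0 Ma(1) by (simp add: \<phi>_def az)
  qed
  \<comment> \<open>Split off the part of the gradient that contains the error \<open>E n - g\<close>.\<close>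
  define P where "P n x = V x \<bullet> (K (F n x) *\<^sub>R Da x + (a x * K' (F n x)) *\<^sub>R ((1 / \<zeta> n x) *\<^sub>R g x + (\<gamma> / (norm x)\<^sup>2) *\<^sub>R x))" for n x
  define Q where "Q n x = (a x * K' (F n x) / \<zeta> n x) * (V x \<bullet> (E n x - g x))" for n x
  have PQ: "V x \<bullet> D n x = P n x + Q n x" for n x
    by (simp add: D_def P_def Q_def H_def algebra_simps inner_add_right inner_diff_right)
  define L where "L x = V x \<bullet> (K (f x) *\<^sub>R Da x + (a x * K' (f x)) *\<^sub>R h x)" for x
  define C1 where "C1 = M * Ma + Ma * M * (2 / c + \<bar>\<gamma>\<bar> / r)"
  have dom: "\<bar>P n x\<bar> \<le> C1 * (W x + W x * norm (g x))" for n x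
  proof (cases "x \<in> A")
    case True
    have n0: "norm x \<ge> r" using rR(2)[OF True] .
    have "norm ((1 / \<zeta> n x) *\<^sub>R g x) \<le> (2 / c) * norm (g x)"
    proof -
      have "1 / \<zeta> n x \<le> 2 / c" using \<zeta>b(1,3)[OF True, of n] cZ(1) by (simp add: field_simps)
      then show ?thesis using \<zeta>b(3)[OF True, of n] by (simp add: mult_right_mono flip: times_divide_eq_left)
    qed
    moreover have "norm ((\<gamma> / (norm x)\<^sup>2) *\<^sub>R x) \<le> \<bar>\<gamma>\<bar> / r"
    proof -
      have "norm ((\<gamma> / (norm x)\<^sup>2) *\<^sub>R x) = \<bar>\<gamma>\<bar> / norm x" using n0 rR(1) by (simp add: power2_eq_square)
      also have "\<dots> \<le> \<bar>\<gamma>\<bar> / r" using n0 rR(1) by (intro divide_left_mono mult_pos_pos) auto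
      finally show ?thesis .
    qed
    ultimately have nh: "norm ((1 / \<zeta> n x) *\<^sub>R g x + (\<gamma> / (norm x)\<^sup>2) *\<^sub>R x) \<le> (2 / c) * norm (g x) + \<bar>\<gamma>\<bar> / r"
      using norm_triangle_ineq[of "(1 / \<zeta> n x) *\<^sub>R g x" "(\<gamma> / (norm x)\<^sup>2) *\<^sub>R x"] by linarith
    have n1: "norm (K (F n x) *\<^sub>R Da x) \<le> M * Ma"
      using KM(1)[OF True, of n] Ma(3)[of x] M0 by (simp add: mult_mono)
    have "\<bar>a x * K' (F n x)\<bar> \<le> Ma * M" unfolding abs_mult using Ma KM(2)[OF True, of n] by (intro mult_mono) auto
    then have n2: "norm ((a x * K' (F n x)) *\<^sub>R ((1 / \<zeta> n x) *\<^sub>R g x + (\<gamma> / (norm x)\<^sup>2) *\<^sub>R x))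
       \<le> (Ma * M) * ((2 / c) * norm (g x) + \<bar>\<gamma>\<bar> / r)"
      unfolding norm_scaleR using nh Ma(1) M0 by (intro mult_mono) auto
    have "\<bar>P n x\<bar> \<le> norm (V x) * norm (K (F n x) *\<^sub>R Da x + (a x * K' (F n x)) *\<^sub>R ((1 / \<zeta> n x) *\<^sub>R g x + (\<gamma> / (norm x)\<^sup>2) *\<^sub>R x))"
      unfolding P_def by (rule Cauchy_Schwarz_ineq2)
    also have "\<dots> \<le> norm (V x) * (M * Ma + (Ma * M) * ((2 / c) * norm (g x) + \<bar>\<gamma>\<bar> / r))"
      by (intro mult_left_mono order_trans[OF norm_triangle_ineq] add_mono n1 n2) auto
    also have "\<dots> \<le> norm (V x) * (C1 * (1 + norm (g x)))"
    proof (rule mult_left_mono)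
      have "m + m * (u * t + s) \<le> (m + m * (u + s)) * (1 + t)"
        if "0 \<le> m" "0 \<le> u" "0 \<le> s" "0 \<le> t" for m u s t :: real
      proof -
        have "0 \<le> m * t" "0 \<le> m * u" "0 \<le> m * s * t" using that by auto
        then show ?thesis by (simp add: algebra_simps)
      qed
      from this[of "M * Ma" "2 / c" "\<bar>\<gamma>\<bar> / r" "norm (g x)"]
      show "M * Ma + (Ma * M) * ((2 / c) * norm (g x) + \<bar>\<gamma>\<bar> / r) \<le> C1 * (1 + norm (g x))"
        using M0 Ma(1) cZ(1) rR(1) by (simp add: C1_def mult.commute[of Ma M])
    qed simp
    finally show ?thesis using True by (simp add: W_def algebra_simps)
  qed (simp add: P_def az W_def)
  have [measurable]: "V \<in> borel_measurable borel" "g \<in> borel_measurable borel"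
    "Da \<in> borel_measurable borel" "a \<in> borel_measurable borel" "K \<in> borel_measurable borel" "K' \<in> borel_measurable borel"
    "\<zeta> n \<in> borel_measurable borel" for n
    using V(1) mg borel_measurable_continuous_onI[OF ca(3)] borel_measurable_continuous_onI[OF ca(5)]
      borel_measurable_continuous_onI[OF contK] borel_measurable_continuous_onI[OF K(2)]
      borel_measurable_continuous_onI[OF contz] by auto
  have [measurable]: "F n \<in> borel_measurable borel" for n unfolding F_def by measurable
  have mP: "P n \<in> borel_measurable lborel" for n unfolding P_def by measurable
  have mQ: "Q n \<in> borel_measurable lborel" for n unfolding Q_def by measurable
  have PL: "(\<lambda>n. P n x) \<longlonglongrightarrow> L x" for x
  proof (cases "x \<in> A")
    case True
    have "z x \<noteq> 0" using cZ(1) cZ(2)[OF True] by linarith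
    then show ?thesis
      unfolding P_def L_def h_def by (intro tendsto_intros Klim[OF True] \<zeta>lim[OF True])
  qed (simp add: P_def L_def az)
  have mL: "L \<in> borel_measurable lborel"
    using borel_measurable_LIMSEQ_metric[OF mP PL] by simp
  have iW1: "integrable lborel W"
  proof -
    have "integrable lborel (\<lambda>x. W x powr (p / (p - 1)) + indicator A x)"
      using iWq sA emeasure_compact_finite[OF ca(1)]
      by (intro Bochner_Integration.integrable_add integrable_real_indicator) auto
    then show ?thesis
    proof (rule Bochner_Integration.integrable_bound)
      have "W x \<le> W x powr (p / (p - 1)) + indicator A x" for x
        using mult_le_powr_sum[OF p W0[of x], of 1] by (cases "x \<in> A") (auto simp: W_def)
      then show "AE x in lborel. norm (W x) \<le> norm (W x powr (p / (p - 1)) + indicator A x)"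
        using W0 by (intro AE_I2) simp
    qed simp
  qed
  have iWg: "integrable lborel (\<lambda>x. W x * norm (g x))"
  proof (rule Bochner_Integration.integrable_bound)
    show "integrable lborel (\<lambda>x. W x powr (p / (p - 1)) + norm (g x) powr p)"
      using iWq g by (rule Bochner_Integration.integrable_add)
    show "AE x in lborel. norm (W x * norm (g x)) \<le> norm (W x powr (p / (p - 1)) + norm (g x) powr p)"
      using mult_le_powr_sum[OF p W0] W0 by (intro AE_I2) simp
  qed measurable
  have idom: "integrable lborel (\<lambda>x. C1 * (W x + W x * norm (g x)))"
    using iW1 iWg by (intro integrable_mult_right Bochner_Integration.integrable_add)
  have lP: "(\<lambda>n. integral\<^sup>L lborel (P n)) \<longlonglongrightarrow> integral\<^sup>L lborel L"
    by (rule integral_dominated_convergence[OF mL mP idom]) (use PL dom in auto)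
  have iP: "integrable lborel (P n)" for n
    by (rule Bochner_Integration.integrable_bound[OF idom mP]) (use dom in \<open>auto intro!: AE_I2 order_trans[OF _ abs_ge_self]\<close>)
  have iL: "integrable lborel L"
  proof (rule Bochner_Integration.integrable_bound[OF idom mL], rule AE_I2)
    fix x
    have "(\<lambda>n. \<bar>P n x\<bar>) \<longlonglongrightarrow> \<bar>L x\<bar>" by (intro tendsto_intros PL)
    then have "\<bar>L x\<bar> \<le> C1 * (W x + W x * norm (g x))"
      by (rule LIMSEQ_le_const2) (use dom in auto)
    then show "norm (L x) \<le> norm (C1 * (W x + W x * norm (g x)))" by simp
  qed
  define C2 where "C2 = Ma * M * (2 / c)"
  have C2: "C2 \<ge> 0" using Ma(1) M0 cZ(1) by (simp add: C2_def)
  have Qb: "\<bar>Q n x\<bar> \<le> C2 * (W x * norm (E n x - g x))" for n x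
  proof (cases "x \<in> A")
    case True
    have "\<bar>a x * K' (F n x) / \<zeta> n x\<bar> \<le> C2"
    proof -
      have "1 / \<zeta> n x \<le> 2 / c" using \<zeta>b(1,3)[OF True, of n] cZ(1) by (simp add: field_simps)
      moreover have "\<bar>a x * K' (F n x)\<bar> \<le> Ma * M" unfolding abs_mult using Ma KM(2)[OF True, of n] by (intro mult_mono) auto
      ultimately have "\<bar>a x * K' (F n x)\<bar> * (1 / \<zeta> n x) \<le> C2"
        unfolding C2_def using \<zeta>b(3)[OF True, of n] Ma(1) M0 by (intro mult_mono) auto
      then show ?thesis using \<zeta>b(3)[OF True, of n] by (simp add: abs_mult)
    qed
    moreover have "\<bar>V x \<bullet> (E n x - g x)\<bar> \<le> norm (V x) * norm (E n x - g x)" by (rule Cauchy_Schwarz_ineq2)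
    ultimately have "\<bar>a x * K' (F n x) / \<zeta> n x\<bar> * \<bar>V x \<bullet> (E n x - g x)\<bar>
       \<le> C2 * (norm (V x) * norm (E n x - g x))"
      using C2 by (intro mult_mono) auto
    then show ?thesis
      using True by (simp add: Q_def W_def abs_mult)
  qed (simp add: Q_def az W_def)
  have nnW: "(\<integral>\<^sup>+x. ennreal (C2 * (W x * norm (E n x - g x))) \<partial>lborel) \<le> ennreal (C2 * dl n)" for n
  proof -
    have "(\<integral>\<^sup>+x. ennreal (C2 * (W x * norm (E n x - g x))) \<partial>lborel) = ennreal C2 * (\<integral>\<^sup>+x. ennreal (W x * norm (E n x - g x)) \<partial>lborel)"
      using C2 W0 by (subst nn_integral_cmult[symmetric]) (auto simp: ennreal_mult)
    also have "\<dots> \<le> ennreal C2 * ennreal (dl n)" by (intro mult_left_mono \<zeta>(4)) auto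
    finally show ?thesis using C2 dl(1)[of n] by (simp add: ennreal_mult)
  qed
  have nQ: "(\<integral>\<^sup>+x. ennreal (norm (Q n x)) \<partial>lborel) \<le> ennreal (C2 * dl n)" for n
    using Qb by (intro order_trans[OF nn_integral_mono nnW]) (simp add: ennreal_leI)
  have iQ: "integrable lborel (Q n)" for n
    using mQ nQ[of n] by (intro integrableI_bounded) (auto intro: le_less_trans)
  have "norm (integral\<^sup>L lborel (Q n)) \<le> C2 * dl n" for n
  proof -
    have "ennreal (norm (integral\<^sup>L lborel (Q n))) \<le> ennreal (C2 * dl n)"
      using integral_norm_bound_ennreal[OF iQ] nQ order_trans by blast
    then show ?thesis using C2 dl(1)[of n] by (simp add: ennreal_le_iff)
  qed
  then have lQ: "(\<lambda>n. integral\<^sup>L lborel (Q n)) \<longlonglongrightarrow> 0"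
    by (intro Lim_null_comparison[OF _ tendsto_mult_right_zero[OF dl0, of C2]]) auto
  have "(\<lambda>n. integral\<^sup>L lborel (P n) + integral\<^sup>L lborel (Q n)) \<longlonglongrightarrow> integral\<^sup>L lborel L + 0"
    by (intro tendsto_add lP lQ)
  then have lD: "(\<lambda>n. \<integral>x. V x \<bullet> D n x \<partial>lborel) \<longlonglongrightarrow> integral\<^sup>L lborel L"
    using iP iQ by (simp add: PQ)
  have ext: "\<exists>t. \<phi> n x = a x * K t" for n x unfolding \<phi>_def by blast
  show thesis
    by (rule that[OF C ext \<phi>lim \<phi>M]) (use lD iL in \<open>simp_all add: L_def[abs_def]\<close>)
qed

subsection \<open>Pointwise inequalities\<close>

text \<open>The flux of the p-Laplacian. At \<open>G = 0\<close> it is 0 also for p < 2.\<close>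

definition plap :: "real \<Rightarrow> 'a::real_inner \<Rightarrow> 'a" where
  "plap p G = norm G powr (p - 2) *\<^sub>R G"

lemma norm_plap: "norm (plap p G) = norm G powr (p - 1)"
  by (cases "G = 0") (auto simp: plap_def powr_diff powr_numeral power2_eq_square)

lemma plap_inner_self: "plap p G \<bullet> G = norm G powr p"
  by (cases "G = 0") (auto simp: plap_def powr_diff powr_numeral power2_eq_square simp flip: power2_norm_eq_inner)

lemma norm_plap_powr: "p > 1 \<Longrightarrow> norm (plap p G) powr (p / (p - 1)) = norm G powr p"
  by (simp add: norm_plap powr_powr)

lemma plap_scaleR: "c > 0 \<Longrightarrow> plap p (c *\<^sub>R G) = c powr (p - 1) *\<^sub>R plap p G"
proof -
  assume c: "c > 0"
  have "c powr (p - 1) = c powr (p - 2) * c"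
    using c by (simp add: powr_diff powr_numeral power2_eq_square)
  then show ?thesis using c by (simp add: plap_def powr_mult mult_ac)
qed

lemma plap_inner_le: "plap p G \<bullet> H \<le> norm G powr (p - 1) * norm H"
  using norm_cauchy_schwarz[of "plap p G" H] by (simp add: norm_plap)

text \<open>Cauchy-Schwarz on the mixed terms reduces the claim to (a^(p-1) - b^(p-1)) (a - b) \<ge>
  0 for the norms, that is, to monotonicity of t |-> t^(p-1).\<close>

lemma plap_monotone:
  assumes "p > 1"
  shows "(plap p G - plap p H) \<bullet> (G - H) \<ge> 0"
proof -
  let ?a = "norm G" and ?b = "norm H"
  have pw: "x powr p = x powr (p - 1) * x" if "x \<ge> 0" for x :: real
    using that by (cases "x = 0") (auto simp: powr_diff)
  have "(?a powr (p - 1) - ?b powr (p - 1)) * (?a - ?b) \<ge> 0"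
  proof (cases "?a \<le> ?b")
    case True
    then have "?a powr (p - 1) \<le> ?b powr (p - 1)" using assms by (intro powr_mono2) auto
    then show ?thesis using True by (intro mult_nonpos_nonpos) auto
  next
    case False
    then have "?b powr (p - 1) \<le> ?a powr (p - 1)" using assms by (intro powr_mono2) auto
    then show ?thesis using False by (intro mult_nonneg_nonneg) auto
  qed
  moreover have "(plap p G - plap p H) \<bullet> (G - H) = ?a powr p + ?b powr p - plap p G \<bullet> H - plap p H \<bullet> G"
    by (simp add: inner_diff_left inner_diff_right plap_inner_self)
  ultimately show ?thesis
    using plap_inner_le[of p G H] plap_inner_le[of p H G] pw[of ?a] pw[of ?b]
    by (simp add: algebra_simps)
qed

text \<open>Weighted arithmetic and geometric means of x = a^p and y = b^p: apply ln s \<le> s - 1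
  to x/m and y/m, where m is the arithmetic mean. Equality forces both quotients to be 1, which is
  the rigidity that later yields G = H.\<close>

lemma Young_equality:
  fixes a b p :: real
  assumes p: "p > 1" and ab: "a \<ge> 0" "b \<ge> 0"
  shows "p * (a powr (p - 1) * b) \<le> (p - 1) * a powr p + b powr p" (is ?le)
    and "p * (a powr (p - 1) * b) = (p - 1) * a powr p + b powr p \<Longrightarrow> a = b" (is "?eq \<Longrightarrow> _")
proof -
  have "?le \<and> (?eq \<longrightarrow> a = b)"
  proof (cases "a = 0 \<or> b = 0")
    case True
    then show ?thesis using p ab by auto
  next
    case False
    then have pos: "a > 0" "b > 0" using ab by auto
    define x y where "x = a powr p" and "y = b powr p"
    define m where "m = (1 - 1/p) * x + (1/p) * y"
    have xy: "x > 0" "y > 0" using pos by (auto simp: x_def y_def)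
    have c: "1 - 1/p > 0" "1/p > 0" using p by auto
    have m: "m > 0" unfolding m_def using xy c by (intro add_pos_pos mult_pos_pos)
    have l: "ln (x/m) \<le> x/m - 1" "ln (y/m) \<le> y/m - 1" using xy m by (auto intro!: ln_le_minus_one)
    have s: "(1 - 1/p) * (x/m - 1) + (1/p) * (y/m - 1) = 0"
    proof -
      have "(1 - r) * (X - 1) + r * (Y - 1) = ((1 - r) * X + r * Y) - 1" for r X Y :: real
        by (simp add: algebra_simps)
      from this[of "1/p" "x/m" "y/m"]
      have "(1 - 1/p) * (x/m - 1) + (1/p) * (y/m - 1) = ((1 - 1/p) * x + (1/p) * y) / m - 1"
        by (simp only: add_divide_distrib times_divide_eq_right)
      also have "\<dots> = 0" using m unfolding m_def[symmetric] by simp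
      finally show ?thesis .
    qed
    define u where "u = (1 - 1/p) * ln (x/m) + (1/p) * ln (y/m)"
    have u: "u \<le> (1 - 1/p) * (x/m - 1) + (1/p) * (y/m - 1)"
      unfolding u_def using c l by (intro add_mono mult_left_mono) auto
    have lnx: "ln x = p * ln a" "ln y = p * ln b" using pos by (auto simp: x_def y_def)
    have "u = (1 - 1/p) * ln x + (1/p) * ln y - ln m"
      using xy m by (simp add: u_def ln_div algebra_simps)
    also have "\<dots> = ((p - 1) * ln a + ln b) - ln m"
      using p by (simp add: lnx field_simps)
    also have "(p - 1) * ln a + ln b = ln (a powr (p - 1) * b)"
      using pos by (simp add: ln_mult)
    finally have ueq: "u = ln (a powr (p - 1) * b) - ln m" .
    have pm: "p * m = (p - 1) * a powr p + b powr p"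
      using p by (simp add: m_def x_def y_def field_simps)
    have "ln (a powr (p - 1) * b) \<le> ln m" using u s ueq by simp
    then have "a powr (p - 1) * b \<le> m" using m pos by simp
    then have le: ?le using p by (simp flip: pm)
    have "a = b" if ?eq
    proof -
      have "a powr (p - 1) * b = m" using that p by (simp flip: pm)
      then have u0: "u = 0" using ueq by simp
      have "(1 - 1/p) * (x/m - 1 - ln (x/m)) + (1/p) * (y/m - 1 - ln (y/m)) = 0"
        using u0 s by (simp add: u_def algebra_simps)
      moreover have "0 \<le> (1 - 1/p) * (x/m - 1 - ln (x/m))" "0 \<le> (1/p) * (y/m - 1 - ln (y/m))"
        using c l by auto
      ultimately have "(1 - 1/p) * (x/m - 1 - ln (x/m)) = 0" "(1/p) * (y/m - 1 - ln (y/m)) = 0" by linarith+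
      then have "ln (x/m) = x/m - 1" "ln (y/m) = y/m - 1" using c by auto
      moreover have "x/m > 0" "y/m > 0" using xy m by auto
      ultimately have "x/m = 1" "y/m = 1" using ln_eq_minus_one by blast+
      then have "x = y" using m by simp
      then have "ln a = ln b" using lnx p by simp
      then show ?thesis using pos by simp
    qed
    with le show ?thesis by blast
  qed
  then show ?le "?eq \<Longrightarrow> a = b" by auto
qed

text \<open>For G = grad u / u and H = grad w / w, multiplication by w^p gives |grad w|^p minus the
  pairing of the flux of u with grad (w^p u^(1-p)), which is Picone's remainder.\<close>

definition picone :: "real \<Rightarrow> 'a::real_inner \<Rightarrow> 'a \<Rightarrow> real" where
  "picone p G H = norm H powr p + (p - 1) * norm G powr p - p * (plap p G \<bullet> H)"

lemma picone_nonneg: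
  assumes "p > 1" shows "picone p G H \<ge> 0"
proof -
  have "p * (norm G powr (p - 1) * norm H) \<le> (p - 1) * norm G powr p + norm H powr p"
    using Young_equality(1)[OF assms] by simp
  moreover have "p * (plap p G \<bullet> H) \<le> p * (norm G powr (p - 1) * norm H)"
    using assms plap_inner_le by (intro mult_left_mono) auto
  ultimately show ?thesis unfolding picone_def by linarith
qed

text \<open>Both inequalities behind \<open>picone_nonneg\<close> become tight: Young's gives equal
  norms, Cauchy-Schwarz gives equal directions.\<close>

lemma picone_eq_0:
  assumes p: "p > 1" and 0: "picone p G H = 0"
  shows "G = H"
proof -
  let ?a = "norm G" and ?b = "norm H"
  have 1: "p * (?a powr (p - 1) * ?b) \<le> (p - 1) * ?a powr p + ?b powr p"
    using Young_equality(1)[OF p] by simp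
  have 2: "p * (plap p G \<bullet> H) \<le> p * (?a powr (p - 1) * ?b)"
    using p plap_inner_le by (intro mult_left_mono) auto
  have "p * (?a powr (p - 1) * ?b) = (p - 1) * ?a powr p + ?b powr p"
    using 0 1 2 unfolding picone_def by linarith
  then have ab: "?a = ?b" using Young_equality(2)[OF p, of ?a ?b] by simp
  have "p * (plap p G \<bullet> H) = p * (?a powr (p - 1) * ?b)"
    using 0 1 2 unfolding picone_def by linarith
  then have in_eq: "plap p G \<bullet> H = ?a powr (p - 1) * ?b" using p by simp
  show ?thesis
  proof (cases "G = 0")
    case True
    then show ?thesis using ab by simp
  next
    case False
    have "?a powr (p - 2) * (G \<bullet> H) = ?a powr (p - 2) * (?a * ?b)"
      using in_eq False by (simp add: plap_def powr_diff powr_numeral power2_eq_square)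
    then have "G \<bullet> H = ?a * ?b" using False by simp
    then have "(G - H) \<bullet> (G - H) = 0"
      using ab power2_norm_eq_inner[of G] power2_norm_eq_inner[of H]
      by (simp add: inner_diff_left inner_diff_right inner_commute power2_eq_square)
    then show ?thesis by simp
  qed
qed

text \<open>\<open>Young_weighted\<close> for the conjugate exponent q = p / (p - 1), whose own
  conjugate is p. The small constant sits at the power of \<open>a\<close> that is to be
  absorbed.\<close>

lemma Young_absorb:
  fixes p \<theta> :: real
  assumes p: "p > 1" and t: "\<theta> > 0"
  obtains C where "C > 0" "\<And>a b. 0 \<le> a \<Longrightarrow> 0 \<le> b \<Longrightarrow> a powr (p - 1) * b \<le> \<theta> * a powr p + C * b powr p"
proof -
  define q where "q = p / (p - 1)"
  have q: "q > 1" "q / (q - 1) = p" using p by (auto simp: q_def field_simps)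
  obtain C where C: "C > 0" "\<And>a b. 0 \<le> a \<Longrightarrow> 0 \<le> b \<Longrightarrow> a * b \<le> \<theta> * b powr q + C * a powr p"
    using Young_weighted[OF q(1) t] unfolding q(2) by blast
  have "a powr (p - 1) * b \<le> \<theta> * a powr p + C * b powr p" if "0 \<le> a" "0 \<le> b" for a b
  proof -
    have "(a powr (p - 1)) powr q = a powr p" using p by (simp add: powr_powr q_def)
    then show ?thesis using C(2)[of b "a powr (p - 1)"] that by (simp add: mult.commute)
  qed
  with C(1) show thesis by (rule that)
qed

text \<open>The remainder is coercive in \<open>G\<close> up to a multiple of |H|^p. This makes it
  control |G|^p in the Caccioppoli estimate.\<close>

lemma picone_lower:
  assumes p: "p > 1"
  obtains C where "C > 0" "\<And>G H :: 'a::real_inner. picone p G H \<ge> (p - 1) / 2 * norm G powr p - C * norm H powr p"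
proof -
  have "(p - 1) / (2 * p) > 0" using p by simp
  then obtain C where C: "C > 0"
    "\<And>a b. 0 \<le> a \<Longrightarrow> 0 \<le> b \<Longrightarrow> a powr (p - 1) * b \<le> (p - 1) / (2 * p) * a powr p + C * b powr p"
    using Young_absorb[OF p] by blast
  have "picone p G H \<ge> (p - 1) / 2 * norm G powr p - (p * C) * norm H powr p" for G H :: 'a
  proof -
    have "p * (plap p G \<bullet> H) \<le> p * ((p - 1) / (2 * p) * norm G powr p + C * norm H powr p)"
      using p by (intro mult_left_mono order_trans[OF plap_inner_le] C(2)) auto
    also have "\<dots> = (p - 1) / 2 * norm G powr p + p * C * norm H powr p"
      using p by (simp add: field_simps)
    finally have "p * (plap p G \<bullet> H) \<le> (p - 1) / 2 * norm G powr p + p * C * norm H powr p" .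
    moreover have "(p - 1) * norm G powr p = (p - 1) / 2 * norm G powr p + (p - 1) / 2 * norm G powr p" by simp
    moreover have "0 \<le> norm H powr p" by simp
    ultimately show ?thesis unfolding picone_def by linarith
  qed
  then show thesis using that[of "p * C"] C(1) p by simp
qed

subsection \<open>Cutoff functions\<close>

text \<open>The squared positive part is the simplest C1 function vanishing exactly on a half-line;
  the cutoffs and the nonlinearity k are built from it, as test functions only have to be
  C1.\<close>

definition pos_sq :: "real \<Rightarrow> real" where
  "pos_sq t = (max 0 t)\<^sup>2"

lemma pos_sq_nonneg: "pos_sq t \<ge> 0"
  by (simp add: pos_sq_def)

lemma DERIV_pos_sq: "DERIV pos_sq t :> 2 * max 0 t"
proof -
  consider "t < 0" | "t = 0" | "t > 0" by linarith
  then show ?thesis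
  proof cases
    case 1
    have "DERIV (\<lambda>_. 0::real) t :> 0" by simp
    then have "DERIV pos_sq t :> 0"
      by (rule has_field_derivative_transform_within_open[of _ _ _ "{..<0}"]) (use 1 in \<open>auto simp: pos_sq_def\<close>)
    then show ?thesis using 1 by simp
  next
    case 2
    have "((\<lambda>h::real. max 0 h) \<longlongrightarrow> max 0 0) (at 0)" by (intro tendsto_intros)
    then have "((\<lambda>h::real. max 0 h) \<longlongrightarrow> 0) (at 0)" by simp
    moreover have "max 0 h = (pos_sq h - pos_sq 0) / h" for h :: real
      by (auto simp: pos_sq_def max_def power2_eq_square)
    ultimately show ?thesis using 2 by (simp add: DERIV_def)
  next
    case 3
    have "DERIV (\<lambda>t. t\<^sup>2) t :> 2 * max 0 t" using 3 by (auto intro!: derivative_eq_intros)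
    then show ?thesis
      by (rule has_field_derivative_transform_within_open[of _ _ _ "{0<..}"]) (use 3 in \<open>auto simp: pos_sq_def\<close>)
  qed
qed

lemma DERIV_pos_sq_compose:
  assumes "DERIV u t :> u'" shows "DERIV (\<lambda>t. pos_sq (u t)) t :> 2 * max 0 (u t) * u'"
  using DERIV_chain2[OF DERIV_pos_sq assms] .

lemma continuous_on_pos_sq: "continuous_on S u \<Longrightarrow> continuous_on S (\<lambda>t. pos_sq (u t))"
  unfolding pos_sq_def by (intro continuous_intros)

text \<open>A C1 step from 0 to 1 across [0, 1], symmetric about 1/2. One of t and 1 - t is at least
  1/2, so the denominator is at least 1/4.\<close>

definition smooth_step :: "real \<Rightarrow> real" where
  "smooth_step t = pos_sq t / (pos_sq t + pos_sq (1 - t))"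

definition smooth_step' :: "real \<Rightarrow> real" where
  "smooth_step' t = 2 * (max 0 t * pos_sq (1 - t) + pos_sq t * max 0 (1 - t)) / (pos_sq t + pos_sq (1 - t))\<^sup>2"

lemma smooth_step_denom: "pos_sq t + pos_sq (1 - t) \<ge> 1/4"
proof (cases "t \<ge> 1/2")
  case True
  then have "pos_sq t = t\<^sup>2" "t\<^sup>2 \<ge> (1/2)\<^sup>2" by (auto simp: pos_sq_def intro!: power_mono)
  then show ?thesis using pos_sq_nonneg[of "1 - t"] by (simp add: power2_eq_square)
next
  case False
  then have "pos_sq (1 - t) = (1 - t)\<^sup>2" "(1 - t)\<^sup>2 \<ge> (1/2)\<^sup>2" by (auto simp: pos_sq_def intro!: power_mono)
  then show ?thesis using pos_sq_nonneg[of t] by (simp add: power2_eq_square)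
qed

lemma smooth_step_denom_nonzero: "pos_sq t + pos_sq (1 - t) > 0" "pos_sq t + pos_sq (1 - t) \<noteq> 0"
  using smooth_step_denom[of t] by linarith+

lemma DERIV_smooth_step: "DERIV smooth_step t :> smooth_step' t"
proof -
  have 1: "DERIV (\<lambda>t. pos_sq (1 - t)) t :> 2 * max 0 (1 - t) * (- 1)"
    by (rule DERIV_pos_sq_compose) (auto intro!: derivative_eq_intros)
  have 2: "DERIV (\<lambda>t. pos_sq t + pos_sq (1 - t)) t :> 2 * max 0 t + 2 * max 0 (1 - t) * (- 1)"
    by (rule DERIV_add[OF DERIV_pos_sq 1])
  from DERIV_divide[OF DERIV_pos_sq 2 smooth_step_denom_nonzero(2)]
  show ?thesis
    by (simp add: smooth_step_def[abs_def] smooth_step'_def power2_eq_square algebra_simps)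
qed

lemma continuous_on_smooth_step': "continuous_on S u \<Longrightarrow> continuous_on S (\<lambda>t. smooth_step' (u t))"
  unfolding smooth_step'_def
  by (intro continuous_intros continuous_on_pos_sq) (auto simp: smooth_step_denom_nonzero)

lemma smooth_step_values: "t \<le> 0 \<Longrightarrow> smooth_step t = 0" "t \<ge> 1 \<Longrightarrow> smooth_step t = 1"
  "smooth_step (1/2) = 1/2" "0 \<le> smooth_step t" "smooth_step t \<le> 1"
  using smooth_step_denom_nonzero(1)[of t] pos_sq_nonneg[of t] pos_sq_nonneg[of "1 - t"]
  by (auto simp: smooth_step_def pos_sq_def divide_simps)

lemma smooth_step_less_1: "t < 1 \<Longrightarrow> smooth_step t < 1"
proof -
  assume "t < 1"
  then have "pos_sq (1 - t) > 0" by (simp add: pos_sq_def)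
  then have "pos_sq t < pos_sq t + pos_sq (1 - t)" by simp
  then show ?thesis
    using smooth_step_denom_nonzero(1)[of t] by (simp add: smooth_step_def del: less_add_same_cancel1)
qed

lemma smooth_step'_nonneg: "smooth_step' t \<ge> 0"
  unfolding smooth_step'_def using pos_sq_nonneg by (intro divide_nonneg_nonneg) auto

lemma smooth_step'_zero: "t \<le> 0 \<or> t \<ge> 1 \<Longrightarrow> smooth_step' t = 0"
  by (auto simp: smooth_step'_def pos_sq_def)

lemma smooth_step'_pos: "0 < t \<Longrightarrow> t < 1 \<Longrightarrow> smooth_step' t > 0"
  unfolding smooth_step'_def using smooth_step_denom_nonzero(1)[of t]
  by (intro divide_pos_pos mult_pos_pos add_pos_pos zero_less_power) (auto simp: pos_sq_def)

text \<open>The numerator is at most 4 on (0, 1) and the denominator at least (1/4)^2, whence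
  64.\<close>

lemma smooth_step'_le: "smooth_step' t \<le> 64"
proof (cases "0 < t \<and> t < 1")
  case True
  have "pos_sq t \<le> 1" "pos_sq (1 - t) \<le> 1" using True by (auto simp: pos_sq_def power_le_one)
  then have "max 0 t * pos_sq (1 - t) \<le> 1 * 1" "pos_sq t * max 0 (1 - t) \<le> 1 * 1"
    using True pos_sq_nonneg by (auto intro!: mult_le_one)
  then have num: "2 * (max 0 t * pos_sq (1 - t) + pos_sq t * max 0 (1 - t)) \<le> 4" by simp
  have den: "(1/4)\<^sup>2 \<le> (pos_sq t + pos_sq (1 - t))\<^sup>2"
    by (intro power_mono smooth_step_denom) simp
  have "smooth_step' t \<le> 4 / (1/4)\<^sup>2"
    unfolding smooth_step'_def using num den by (intro frac_le) auto
  then show ?thesis by (simp add: power2_eq_square)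
qed (use smooth_step'_zero in auto)

lemma smooth_step_mono: "s \<le> t \<Longrightarrow> smooth_step s \<le> smooth_step t"
  by (rule DERIV_nonneg_imp_nondecreasing) (use DERIV_smooth_step smooth_step'_nonneg in blast)+

text \<open>The rise takes place on [0, \<tau>], while the descent is spread over all of [0, n], so
  that its slope is at most 64 / n.\<close>

definition cut_base :: "real \<Rightarrow> real \<Rightarrow> real \<Rightarrow> real" where
  "cut_base \<tau> n t = smooth_step (t / \<tau>) * (1 - smooth_step (t / n))"

definition cut_base' :: "real \<Rightarrow> real \<Rightarrow> real \<Rightarrow> real" where
  "cut_base' \<tau> n t = smooth_step' (t / \<tau>) / \<tau> * (1 - smooth_step (t / n)) - smooth_step (t / \<tau>) * (smooth_step' (t / n) / n)"

text \<open>The power \<open>q\<close> leaves a factor c^(q-1) in the derivative; for q \<ge> p this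
  permits absorption into terms weighted with c^q.\<close>

definition cut :: "nat \<Rightarrow> real \<Rightarrow> real \<Rightarrow> real \<Rightarrow> real" where
  "cut q \<tau> n t = cut_base \<tau> n t ^ q"

definition cut' :: "nat \<Rightarrow> real \<Rightarrow> real \<Rightarrow> real \<Rightarrow> real" where
  "cut' q \<tau> n t = real q * cut_base \<tau> n t ^ (q - 1) * cut_base' \<tau> n t"

lemma cut_base_bounds: "0 \<le> cut_base \<tau> n t" "cut_base \<tau> n t \<le> 1"
  unfolding cut_base_def using smooth_step_values(4,5) by (auto intro!: mult_le_one)

lemma cut_bounds: "0 \<le> cut q \<tau> n t" "cut q \<tau> n t \<le> 1"
  unfolding cut_def using cut_base_bounds by (auto intro: power_le_one)

lemma DERIV_cut:
  assumes "\<tau> > 0" "n > 0"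
  shows "DERIV (cut q \<tau> n) t :> cut' q \<tau> n t"
proof -
  have s: "DERIV (\<lambda>t. smooth_step (t / c)) t :> smooth_step' (t / c) * (1 / c)" if "c > 0" for c
    by (rule DERIV_chain2[OF DERIV_smooth_step]) (use that in \<open>auto intro!: derivative_eq_intros\<close>)
  have "DERIV (\<lambda>t. smooth_step (t / \<tau>) * (1 - smooth_step (t / n))) t :>
      smooth_step' (t / \<tau>) * (1 / \<tau>) * (1 - smooth_step (t / n)) + (0 - smooth_step' (t / n) * (1 / n)) * smooth_step (t / \<tau>)"
    by (intro DERIV_mult DERIV_diff DERIV_const s assms)
  then have "DERIV (cut_base \<tau> n) t :> cut_base' \<tau> n t"
    by (simp add: cut_base_def[abs_def] cut_base'_def algebra_simps)
  from DERIV_power[OF this, of q] show ?thesis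
    by (simp add: cut_def[abs_def] cut'_def mult_ac)
qed

lemma continuous_on_smooth_step: "continuous_on S u \<Longrightarrow> continuous_on S (\<lambda>t. smooth_step (u t))"
  unfolding smooth_step_def
  by (intro continuous_intros continuous_on_pos_sq) (auto simp: smooth_step_denom_nonzero)

lemma continuous_on_cut':
  assumes "\<tau> > 0" "n > 0"
  shows "continuous_on UNIV (cut' q \<tau> n)"
  unfolding cut'_def cut_base_def cut_base'_def using assms
  by (intro continuous_intros continuous_on_smooth_step continuous_on_smooth_step') auto

lemma cut_outside:
  assumes "\<tau> > 0" "n > 0" "q \<ge> 2" "t \<le> 0 \<or> n \<le> t"
  shows "cut q \<tau> n t = 0" "cut' q \<tau> n t = 0"
proof -
  have "t / \<tau> \<le> 0 \<or> 1 \<le> t / n" using assms by (auto simp: divide_nonpos_pos le_divide_eq)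
  then have "cut_base \<tau> n t = 0" unfolding cut_base_def using smooth_step_values by auto
  then show "cut q \<tau> n t = 0" "cut' q \<tau> n t = 0" using assms(3) by (auto simp: cut_def cut'_def power_0_left)
qed

text \<open>The slope bound gives the factor 1/n in the estimates. The strict sign of the derivative
  makes the final integral detect every place where f < 0, and the lower bound up to n / 2 lets a
  cutoff of length 2 n dominate the shell of length n.\<close>

lemma cut_tail:
  assumes "\<tau> > 0" "n > 0" "\<tau> \<le> t"
  shows "cut_base' \<tau> n t \<le> 0" "- (64 / n) \<le> cut_base' \<tau> n t" "t < n \<Longrightarrow> q \<ge> 2 \<Longrightarrow> cut' q \<tau> n t < 0"
    "cut' q \<tau> n t \<le> 0" "t \<le> n / 2 \<Longrightarrow> cut q \<tau> n t \<ge> (1/2) ^ q"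
proof -
  have t1: "t / \<tau> \<ge> 1" using assms by (simp add: le_divide_eq)
  have c: "cut_base' \<tau> n t = - (smooth_step' (t / n) / n)"
    using t1 by (simp add: cut_base'_def smooth_step_values smooth_step'_zero)
  have b: "cut_base \<tau> n t = 1 - smooth_step (t / n)"
    using t1 by (simp add: cut_base_def smooth_step_values)
  show 1: "cut_base' \<tau> n t \<le> 0" unfolding c using smooth_step'_nonneg assms(2) by simp
  show "- (64 / n) \<le> cut_base' \<tau> n t" unfolding c using smooth_step'_le assms(2) by (simp add: divide_right_mono)
  show "cut' q \<tau> n t \<le> 0"
    unfolding cut'_def using 1 cut_base_bounds(1) by (intro mult_nonneg_nonpos) auto
  show "cut' q \<tau> n t < 0" if tn: "t < n" and q: "q \<ge> 2"
  proof -
    have t01: "0 < t / n" "t / n < 1" using assms tn by auto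
    then have "smooth_step (t / n) < 1" by (intro smooth_step_less_1)
    then have "cut_base \<tau> n t > 0" by (simp add: b)
    moreover have "cut_base' \<tau> n t < 0" unfolding c using smooth_step'_pos[OF t01] assms(2) by simp
    ultimately show ?thesis unfolding cut'_def using q by (intro mult_pos_neg mult_pos_pos) auto
  qed
  show "cut q \<tau> n t \<ge> (1/2) ^ q" if "t \<le> n / 2"
  proof -
    have "t / n \<le> 1/2" using that assms(2) by (simp add: divide_le_eq)
    then have "smooth_step (t / n) \<le> 1/2" using smooth_step_mono smooth_step_values(3) by metis
    then show ?thesis unfolding cut_def b by (intro power_mono) auto
  qed
qed

text \<open>A one-sided bound independent of n suffices for \<open>Y_bound\<close>, where the
  descent of the cutoff contributes with the favourable sign.\<close>

lemma cut'_le: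
  assumes "\<tau> > 0" "n > 0"
  shows "cut' q \<tau> n t \<le> real q * (64 / \<tau>)"
proof -
  have "cut_base' \<tau> n t \<le> smooth_step' (t / \<tau>) / \<tau> * (1 - smooth_step (t / n))"
    unfolding cut_base'_def using smooth_step_values(4)[of "t / \<tau>"] smooth_step'_nonneg[of "t / n"] assms(2) by simp
  also have "\<dots> \<le> 64 / \<tau> * 1"
    using smooth_step_values(4,5)[of "t / n"] smooth_step'_le[of "t / \<tau>"] assms(1)
    by (intro mult_mono divide_right_mono) auto
  finally have c: "cut_base' \<tau> n t \<le> 64 / \<tau>" by simp
  have "cut_base \<tau> n t ^ (q - 1) * cut_base' \<tau> n t \<le> cut_base \<tau> n t ^ (q - 1) * (64 / \<tau>)"
    using c cut_base_bounds(1) by (intro mult_left_mono) auto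
  also have "\<dots> \<le> 1 * (64 / \<tau>)"
    using cut_base_bounds assms(1) by (intro mult_right_mono power_le_one) auto
  finally have "real q * (cut_base \<tau> n t ^ (q - 1) * cut_base' \<tau> n t) \<le> real q * (64 / \<tau>)"
    by (intro mult_left_mono) auto
  then show ?thesis by (simp add: cut'_def mult.assoc)
qed

lemma cut_mono:
  assumes "\<tau> > 0" "0 < n" "n \<le> n'" "t \<ge> 0"
  shows "cut q \<tau> n t \<le> cut q \<tau> n' t"
proof -
  have "t / n' \<le> t / n" using assms by (intro divide_left_mono) auto
  then have "smooth_step (t / n') \<le> smooth_step (t / n)" by (rule smooth_step_mono)
  then have "cut_base \<tau> n t \<le> cut_base \<tau> n' t"
    unfolding cut_base_def using smooth_step_values(4) by (intro mult_left_mono) auto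
  then show ?thesis unfolding cut_def using cut_base_bounds(1) by (intro power_mono)
qed

text \<open>This is the nonlinearity k of the overview. The quotient s / (1 + s) keeps it below 1
  while it stays C1, nonincreasing, and positive exactly on the negative half-line.\<close>

definition neg_part :: "real \<Rightarrow> real" where
  "neg_part t = pos_sq (- t) / (1 + pos_sq (- t))"

definition neg_part' :: "real \<Rightarrow> real" where
  "neg_part' t = - (2 * max 0 (- t)) / (1 + pos_sq (- t))\<^sup>2"

lemma DERIV_neg_part: "DERIV neg_part t :> neg_part' t"
proof -
  have 1: "DERIV (\<lambda>t. pos_sq (- t)) t :> 2 * max 0 (- t) * (- 1)"
    by (rule DERIV_pos_sq_compose) (auto intro!: derivative_eq_intros)
  have 2: "DERIV (\<lambda>t. 1 + pos_sq (- t)) t :> 0 + 2 * max 0 (- t) * (- 1)"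
    by (intro DERIV_add DERIV_const 1)
  have "1 + pos_sq (- t) \<noteq> 0" using pos_sq_nonneg[of "- t"] by linarith
  from DERIV_divide[OF 1 2 this] show ?thesis
    by (simp add: neg_part_def[abs_def] neg_part'_def power2_eq_square algebra_simps)
qed

lemma continuous_on_neg_part': "continuous_on UNIV neg_part'"
proof -
  have "1 + pos_sq (- t) \<noteq> 0" for t using pos_sq_nonneg[of "- t"] by linarith
  then show ?thesis unfolding neg_part'_def[abs_def]
    by (intro continuous_intros continuous_on_pos_sq) auto
qed

lemma neg_part_bounds: "0 \<le> neg_part t" "neg_part t \<le> 1" "neg_part' t \<le> 0"
  "t \<ge> 0 \<Longrightarrow> neg_part t = 0" "t \<ge> 0 \<Longrightarrow> neg_part' t = 0" "t < 0 \<Longrightarrow> neg_part t > 0"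
proof -
  have d: "1 + pos_sq (- t) > 0" "pos_sq (- t) \<ge> 0" using pos_sq_nonneg[of "- t"] by linarith+
  show "0 \<le> neg_part t" "neg_part t \<le> 1" using d by (auto simp: neg_part_def)
  show "neg_part' t \<le> 0" unfolding neg_part'_def by (intro divide_nonpos_nonneg) auto
  show "t \<ge> 0 \<Longrightarrow> neg_part t = 0" "t \<ge> 0 \<Longrightarrow> neg_part' t = 0"
    by (auto simp: neg_part_def neg_part'_def pos_sq_def)
  show "t < 0 \<Longrightarrow> neg_part t > 0"
    using d(1) unfolding neg_part_def by (intro divide_pos_pos) (auto simp: pos_sq_def)
qed

subsection \<open>Testing with nonlinear test functions\<close>

lemma weighted_limit:
  fixes b \<phi> :: "real^'n \<Rightarrow> real"
  assumes A: "compact A" "0 \<notin> A" and b: "continuous_on (- {0}) b"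
    and \<phi>: "\<And>n. C1c A (\<phi>' n) (D n)" "\<And>x. (\<lambda>n. \<phi>' n x) \<longlonglongrightarrow> \<phi> x" "\<And>n x. \<bar>\<phi>' n x\<bar> \<le> M"
  shows "(\<lambda>n. \<integral>x. b x * \<phi>' n x \<partial>lborel) \<longlonglongrightarrow> (\<integral>x. b x * \<phi> x \<partial>lborel)"
proof -
  have AU: "A \<subseteq> - {0}" using A(2) by auto
  have ib: "integrable lborel (\<lambda>x. indicator A x *\<^sub>R b x)"
    by (rule borel_integrable_compact[OF A(1) continuous_on_subset[OF b AU]])
  have z: "\<phi>' n x = 0" if "x \<notin> A" for n x using C1cD(4)[OF \<phi>(1) that] .
  have z': "\<phi> x = 0" if "x \<notin> A" for x
    using \<phi>(2)[of x] z[OF that] by (simp add: LIMSEQ_const_iff)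
  have m1: "\<phi>' n \<in> borel_measurable lborel" for n
    using borel_measurable_continuous_onI[OF C1cD(5)[OF \<phi>(1)]] by simp
  have m2: "\<phi> \<in> borel_measurable lborel"
    using borel_measurable_LIMSEQ_metric[OF m1 \<phi>(2)] by simp
  have eq: "b x * f x = (indicator A x *\<^sub>R b x) * f x" if "\<And>x. x \<notin> A \<Longrightarrow> f x = 0" for f :: "real^'n \<Rightarrow> real" and x
    using that[of x] by (cases "x \<in> A") auto
  have M: "M \<ge> 0" using \<phi>(3)[of 0 0] by linarith
  have "(\<lambda>n. \<integral>x. (indicator A x *\<^sub>R b x) * \<phi>' n x \<partial>lborel) \<longlonglongrightarrow> (\<integral>x. (indicator A x *\<^sub>R b x) * \<phi> x \<partial>lborel)"
  proof (rule integral_dominated_convergence)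
    show "integrable lborel (\<lambda>x. norm (indicator A x *\<^sub>R b x) * M)"
      using ib by (intro integrable_mult_left) (rule integrable_norm)
    show "AE x in lborel. (\<lambda>n. (indicator A x *\<^sub>R b x) * \<phi>' n x) \<longlonglongrightarrow> (indicator A x *\<^sub>R b x) * \<phi> x"
      by (intro AE_I2 tendsto_intros \<phi>(2))
    show "AE x in lborel. norm ((indicator A x *\<^sub>R b x) * \<phi>' n x) \<le> norm (indicator A x *\<^sub>R b x) * M" for n
      using \<phi>(3) by (intro AE_I2) (simp add: abs_mult mult_left_mono)
    show "(\<lambda>x. (indicator A x *\<^sub>R b x) * \<phi>' n x) \<in> borel_measurable lborel" for n
      by (rule borel_measurable_times[OF borel_measurable_integrable[OF ib] m1])
    show "(\<lambda>x. (indicator A x *\<^sub>R b x) * \<phi> x) \<in> borel_measurable lborel"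
      by (rule borel_measurable_times[OF borel_measurable_integrable[OF ib] m2])
  qed
  then show ?thesis
    by (subst eq[OF z], simp, subst eq[OF z'], simp, assumption)
qed

text \<open>The approximating test functions have the form \<open>a x * K t\<close>, so they inherit
  the sign of \<open>a\<close> and \<open>K\<close> and are admissible. \<open>K\<close> is general
  because it will be exp((1 - p) t) times \<open>neg_part\<close>.\<close>

lemma composite_supersolution:
  fixes z a :: "real^'n \<Rightarrow> real" and g V Da :: "real^'n \<Rightarrow> real^'n" and l \<gamma> :: real
  defines "f \<equiv> \<lambda>x. ln (z x) + \<gamma> * ln (norm x) - l"
    and "h \<equiv> \<lambda>x. (1 / z x) *\<^sub>R g x + (\<gamma> / (norm x)\<^sup>2) *\<^sub>R x"
  assumes p: "p > 1" and zg: "weak_gradient z g" and g: "integrable lborel (\<lambda>x. norm (g x) powr p)"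
    and z: "continuous_on (- {0}) z" "\<And>x. x \<noteq> 0 \<Longrightarrow> z x > 0"
    and a: "C1c A a Da" "0 \<notin> A" "\<And>x. 0 \<le> a x"
    and K: "\<And>t. DERIV K t :> K' t" "continuous_on UNIV K'" "\<And>t. 0 \<le> K t"
    and V: "V \<in> borel_measurable borel" "integrable lborel (\<lambda>x. indicator A x * norm (V x) powr (p / (p - 1)))"
    and b: "continuous_on (- {0}) b"
    and super: "\<And>A \<phi> D. C1c A \<phi> D \<Longrightarrow> 0 \<notin> A \<Longrightarrow> (\<And>x. 0 \<le> \<phi> x) \<Longrightarrow>
      (\<integral>x. b x * \<phi> x \<partial>lborel) \<le> (\<integral>x. V x \<bullet> D x \<partial>lborel)"
  shows "(\<integral>x. b x * (a x * K (f x)) \<partial>lborel) \<le>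
      (\<integral>x. V x \<bullet> (K (f x) *\<^sub>R Da x + (a x * K' (f x)) *\<^sub>R h x) \<partial>lborel)" (is ?th1)
    and "integrable lborel (\<lambda>x. V x \<bullet> (K (f x) *\<^sub>R Da x + (a x * K' (f x)) *\<^sub>R h x))" (is ?th2)
proof -
  obtain \<phi> D M where \<phi>: "\<And>n. C1c A (\<phi> n) (D n)" "\<And>n x. \<exists>t. \<phi> n x = a x * K t"
    "\<And>x. (\<lambda>n. \<phi> n x) \<longlonglongrightarrow> a x * K (f x)" "\<And>n x. \<bar>\<phi> n x\<bar> \<le> M"
    "(\<lambda>n. \<integral>x. V x \<bullet> D n x \<partial>lborel) \<longlonglongrightarrow>
       (\<integral>x. V x \<bullet> (K (f x) *\<^sub>R Da x + (a x * K' (f x)) *\<^sub>R h x) \<partial>lborel)" ?th2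
    using composite_test_functions[OF p zg g z a(1,2) K(1,2) V, where \<gamma>=\<gamma> and l=l]
    unfolding f_def h_def by blast
  have nn: "0 \<le> \<phi> n x" for n x using \<phi>(2)[of n x] a(3)[of x] K(3) by auto
  have "(\<integral>x. b x * \<phi> n x \<partial>lborel) \<le> (\<integral>x. V x \<bullet> D n x \<partial>lborel)" for n
    by (rule super[OF \<phi>(1) a(2) nn])
  then show ?th1
    by (intro LIMSEQ_le[OF weighted_limit[OF C1cD(1)[OF a(1)] a(2) b \<phi>(1,3,4)] \<phi>(5)]) auto
  show ?th2 by fact
qed

text \<open>The flux of a power of |x| is such a radial field, so this plays the part of testing the
  equation for w. It is an identity, hence \<open>K\<close> carries no sign condition.\<close>

lemma composite_radial_field:
  fixes z a :: "real^'n \<Rightarrow> real" and g Da :: "real^'n \<Rightarrow> real^'n" and l \<gamma> \<alpha> :: real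
  defines "f \<equiv> \<lambda>x. ln (z x) + \<gamma> * ln (norm x) - l"
    and "h \<equiv> \<lambda>x. (1 / z x) *\<^sub>R g x + (\<gamma> / (norm x)\<^sup>2) *\<^sub>R x"
  assumes p: "p > 1" and zg: "weak_gradient z g" and g: "integrable lborel (\<lambda>x. norm (g x) powr p)"
    and z: "continuous_on (- {0}) z" "\<And>x. x \<noteq> 0 \<Longrightarrow> z x > 0"
    and a: "C1c A a Da" "0 \<notin> A"
    and K: "\<And>t. DERIV K t :> K' t" "continuous_on UNIV K'"
  shows "(\<integral>x. norm x powr (- \<alpha>) * (x \<bullet> (K (f x) *\<^sub>R Da x + (a x * K' (f x)) *\<^sub>R h x)) \<partial>lborel) =
      (\<alpha> - real CARD('n)) * (\<integral>x. norm x powr (- \<alpha>) * (a x * K (f x)) \<partial>lborel)" (is ?th1)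
    and "integrable lborel (\<lambda>x. norm x powr (- \<alpha>) * (x \<bullet> (K (f x) *\<^sub>R Da x + (a x * K' (f x)) *\<^sub>R h x)))" (is ?th2)
proof -
  define V where "V x = norm x powr (- \<alpha>) *\<^sub>R x" for x :: "real^'n"
  have AU: "A \<subseteq> - {0}" using a(2) by auto
  note cA = C1cD(1)[OF a(1)]
  have cV: "continuous_on (- {0}) V" unfolding V_def by (intro continuous_intros) auto
  have mV: "V \<in> borel_measurable borel" unfolding V_def by measurable
  have "continuous_on A (\<lambda>x. norm (V x) powr (p / (p - 1)))"
    using AU by (intro continuous_intros continuous_on_subset[OF cV AU]) (auto simp: V_def)
  from borel_integrable_compact[OF cA this]
  have iV: "integrable lborel (\<lambda>x. indicator A x * norm (V x) powr (p / (p - 1)))" by simp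
  obtain \<phi> D M where \<phi>: "\<And>n. C1c A (\<phi> n) (D n)" "\<And>n x. \<exists>t. \<phi> n x = a x * K t"
    "\<And>x. (\<lambda>n. \<phi> n x) \<longlonglongrightarrow> a x * K (f x)" "\<And>n x. \<bar>\<phi> n x\<bar> \<le> M"
    "(\<lambda>n. \<integral>x. V x \<bullet> D n x \<partial>lborel) \<longlonglongrightarrow>
       (\<integral>x. V x \<bullet> (K (f x) *\<^sub>R Da x + (a x * K' (f x)) *\<^sub>R h x) \<partial>lborel)"
    "integrable lborel (\<lambda>x. V x \<bullet> (K (f x) *\<^sub>R Da x + (a x * K' (f x)) *\<^sub>R h x))"
    using composite_test_functions[OF p zg g z a K mV iV, where \<gamma>=\<gamma> and l=l]
    unfolding f_def h_def by blast
  have e: "(\<integral>x. V x \<bullet> D n x \<partial>lborel) = (\<alpha> - real CARD('n)) * (\<integral>x. norm x powr (- \<alpha>) * \<phi> n x \<partial>lborel)" for n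
    using integral_radial_field[OF \<phi>(1)[of n] a(2), of \<alpha>] by (simp add: V_def)
  have "continuous_on (- {0}) (\<lambda>x::real^'n. norm x powr (- \<alpha>))" by (intro continuous_intros) auto
  from weighted_limit[OF cA a(2) this \<phi>(1,3,4)]
  have "(\<lambda>n. \<integral>x. V x \<bullet> D n x \<partial>lborel) \<longlonglongrightarrow>
    (\<alpha> - real CARD('n)) * (\<integral>x. norm x powr (- \<alpha>) * (a x * K (f x)) \<partial>lborel)"
    unfolding e by (intro tendsto_mult_left)
  from LIMSEQ_unique[OF \<phi>(5) this] show ?th1 by (simp add: V_def)
  from \<phi>(6) show ?th2 by (simp add: V_def)
qed

text \<open>Logarithmic radius, counted outwards for \<open>\<sigma> = 1\<close> and inwards for \<open>\<sigma> = -1\<close>.\<close>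

definition log_shell :: "real \<Rightarrow> real \<Rightarrow> real \<Rightarrow> ('a::euclidean_space) set" where
  "log_shell \<sigma> s n = {x. x \<noteq> 0 \<and> s \<le> \<sigma> * ln (norm x) \<and> \<sigma> * ln (norm x) \<le> n}"

lemma zero_notin_log_shell [simp]: "0 \<notin> log_shell \<sigma> s n"
  by (simp add: log_shell_def)

lemma compact_log_shell:
  assumes "\<sigma> = 1 \<or> \<sigma> = - 1"
  shows "compact (log_shell \<sigma> s n :: ('a::euclidean_space) set)"
proof -
  have ln: "t \<le> ln r \<longleftrightarrow> exp t \<le> r" "ln r \<le> t \<longleftrightarrow> r \<le> exp t" if "r > 0" for r t :: real
    using that by (simp_all add: ln_ge_iff) (metis exp_le_cancel_iff exp_ln)
  have "\<exists>a b. log_shell \<sigma> s n = cball (0::'a) b - ball 0 a"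
  proof (cases "\<sigma> = 1")
    case True
    have "x \<in> log_shell \<sigma> s n \<longleftrightarrow> x \<in> cball 0 (exp n) - ball 0 (exp s)" for x :: 'a
      using True ln[of "norm x"] by (cases "x = 0") (auto simp: log_shell_def)
    then show ?thesis by blast
  next
    case False
    then have s: "\<sigma> = - 1" using assms by simp
    have e: "s \<le> - ln r \<longleftrightarrow> ln r \<le> - s" "- ln r \<le> n \<longleftrightarrow> - n \<le> ln r" for r :: real by linarith+
    have "x \<in> log_shell \<sigma> s n \<longleftrightarrow> x \<in> cball 0 (exp (- s)) - ball 0 (exp (- n))" for x :: 'a
      using s ln[of "norm x"] e[of "norm x"] by (cases "x = 0") (auto simp: log_shell_def)
    then show ?thesis by blast
  qed
  then obtain a b where "log_shell \<sigma> s n = cball (0::'a) b - ball 0 a" by blast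
  then show ?thesis by (simp add: compact_diff)
qed

lemma GDERIV_ln_norm:
  fixes x :: "'a::real_inner"
  assumes "x \<noteq> 0"
  shows "GDERIV (\<lambda>x. \<sigma> * ln (norm x)) x :> (\<sigma> / (norm x)\<^sup>2) *\<^sub>R x"
proof -
  have "DERIV (\<lambda>r. \<sigma> * ln r) (norm x) :> \<sigma> / norm x"
    using assms by (auto intro!: derivative_eq_intros)
  from GDERIV_DERIV_compose[OF GDERIV_norm[OF assms] this] show ?thesis
    using assms by (simp add: sgn_div_norm power2_eq_square divide_inverse mult.assoc)
qed

lemma radial_C1c:
  fixes \<sigma> n :: real
  assumes "\<sigma> = 1 \<or> \<sigma> = - 1" "n > 0" and E: "\<And>t. DERIV E t :> E' t" "continuous_on UNIV E'"
    "\<And>t. t \<le> 0 \<or> n \<le> t \<Longrightarrow> E t = 0" "\<And>t. t \<le> 0 \<or> n \<le> t \<Longrightarrow> E' t = 0"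
  shows "C1c (log_shell \<sigma> 0 n) (\<lambda>x::real^'n. E (\<sigma> * ln (norm x))) (\<lambda>x. (E' (\<sigma> * ln (norm x)) * \<sigma> / (norm x)\<^sup>2) *\<^sub>R x)"
proof (rule C1cI[of _ "- {0}"])
  show "compact (log_shell \<sigma> 0 n :: (real^'n) set)" by (rule compact_log_shell[OF assms(1)])
  show "GDERIV (\<lambda>x. E (\<sigma> * ln (norm x))) x :> (E' (\<sigma> * ln (norm x)) * \<sigma> / (norm x)\<^sup>2) *\<^sub>R x"
    if "x \<in> - {0}" for x :: "real^'n"
  proof -
    have "x \<noteq> 0" using that by simp
    from GDERIV_DERIV_compose[OF GDERIV_ln_norm[OF this] E(1)] show ?thesis by simp
  qed
  show "continuous_on (- {0}) (\<lambda>x::real^'n. (E' (\<sigma> * ln (norm x)) * \<sigma> / (norm x)\<^sup>2) *\<^sub>R x)"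
    by (intro continuous_intros continuous_on_compose2[OF E(2)]) auto
  fix x :: "real^'n" assume x: "x \<notin> log_shell \<sigma> 0 n"
  show "E (\<sigma> * ln (norm x)) = 0" "(E' (\<sigma> * ln (norm x)) * \<sigma> / (norm x)\<^sup>2) *\<^sub>R x = 0"
    using x E(3,4)[of "\<sigma> * ln (norm x)"] E(3)[of 0] by (auto simp: log_shell_def)
qed auto

lemma GDERIV_norm_powr:
  fixes x :: "'a::real_inner"
  assumes "x \<noteq> 0"
  shows "GDERIV (\<lambda>x. c * norm x powr (- \<gamma>)) x :> (c * norm x powr (- \<gamma>)) *\<^sub>R ((- \<gamma> / (norm x)\<^sup>2) *\<^sub>R x)"
proof -
  have "DERIV (\<lambda>r. c * r powr (- \<gamma>)) (norm x) :> c * (- \<gamma> * norm x powr (- \<gamma> - 1))"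
    using assms by (auto intro!: derivative_eq_intros)
  moreover have "norm x powr (- \<gamma> - 1) = norm x powr (- \<gamma>) / norm x"
    using assms by (simp add: powr_diff)
  ultimately show ?thesis
    using GDERIV_DERIV_compose[OF GDERIV_norm[OF assms]] assms
    by (fastforce simp: sgn_div_norm power2_eq_square field_simps)
qed

subsection \<open>Comparison with radial solutions\<close>

text \<open>Young's inequality for \<open>A\<close> and \<open>b / c\<close>, multiplied by c^q. As
  0 < c \<le> 1 and q \<ge> p, the term c^q (b / c)^p is at most b^p, so the cutoff disappears from
  the error term.\<close>

lemma cutoff_Young:
  fixes p A b c \<theta> C :: real and q :: nat
  assumes Y: "\<And>a b. 0 \<le> a \<Longrightarrow> 0 \<le> b \<Longrightarrow> a powr (p - 1) * b \<le> \<theta> * a powr p + C * b powr p"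
    and c: "0 \<le> c" "c \<le> 1" and q: "q \<ge> 2" "real q \<ge> p" and Ab: "0 \<le> A" "0 \<le> b" and C: "C > 0"
  shows "A powr (p - 1) * (c ^ (q - 1) * b) \<le> \<theta> * (c ^ q * A powr p) + C * b powr p"
proof (cases "c = 0")
  case True
  then show ?thesis using q C Ab by (simp add: power_0_left)
next
  case False
  then have c0: "c > 0" using c by simp
  have "A powr (p - 1) * (b / c) \<le> \<theta> * A powr p + C * (b / c) powr p"
    using Y[OF Ab(1), of "b / c"] Ab c0 by simp
  then have "c ^ q * (A powr (p - 1) * (b / c)) \<le> c ^ q * (\<theta> * A powr p + C * (b / c) powr p)"
    using c by (intro mult_left_mono) auto
  moreover have "c ^ q * (A powr (p - 1) * (b / c)) = A powr (p - 1) * (c ^ (q - 1) * b)"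
    using c0 q(1) by (cases q) auto
  moreover have "c ^ q * (b / c) powr p \<le> b powr p"
  proof -
    have "c ^ q = c powr real q" using c0 by (simp add: powr_realpow)
    also have "\<dots> \<le> c powr p" using c0 c q(2) by (intro powr_mono') auto
    finally have "c ^ q / c powr p \<le> 1" using c0 by simp
    then have "(c ^ q / c powr p) * b powr p \<le> 1 * b powr p" by (intro mult_right_mono) auto
    then show ?thesis using c0 Ab by (simp add: powr_divide)
  qed
  then have "C * (c ^ q * (b / c) powr p) \<le> C * b powr p" using C by (intro mult_left_mono) auto
  ultimately show ?thesis by (simp add: algebra_simps)
qed

text \<open>\<open>z\<close> will be the representative of \<open>u\<close>, with \<nu> = \<mu>, or
  that representative plus a positive constant, with \<nu> = 0. The sign \<sigma> treats both sides
  of the sphere at once: \<open>gam(2)\<close> says that w^p |x|^-p is integrable at infinity for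
  \<sigma> = 1 and at the origin for \<sigma> = -1. \<open>tau\<close> is the strict inequality in a
  thin shell that hides the rise of the cutoff.\<close>

locale radial_comparison =
  fixes p \<gamma> \<nu> m \<sigma> \<tau> :: real and q :: nat and z :: "real^'n \<Rightarrow> real" and g :: "real^'n \<Rightarrow> real^'n"
  assumes p: "1 < p"
    and sigma: "\<sigma> = 1 \<or> \<sigma> = - 1"
    and gam: "0 \<le> \<gamma>" "\<sigma> * (\<gamma> * p + p - real CARD('n)) > 0"
    and root: "(p - 1) * \<gamma> powr p - (real CARD('n) - p) * \<gamma> powr (p - 1) + \<nu> = 0"
    and zg: "weak_gradient z g" and gLp: "integrable lborel (\<lambda>x. norm (g x) powr p)"
    and z: "continuous_on (- {0}) z" "\<And>x. x \<noteq> 0 \<Longrightarrow> z x > 0"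
    and super: "\<And>A \<phi> D. C1c A \<phi> D \<Longrightarrow> 0 \<notin> A \<Longrightarrow> (\<And>x. 0 \<le> \<phi> x) \<Longrightarrow>
      (\<integral>x. (\<nu> * norm x powr (- p) * z x powr (p - 1)) * \<phi> x \<partial>lborel) \<le> (\<integral>x. plap p (g x) \<bullet> D x \<partial>lborel)"
    and m: "m > 0"
    and tau: "\<tau> > 0" "\<And>x. x \<noteq> 0 \<Longrightarrow> \<bar>ln (norm x)\<bar> \<le> \<tau> \<Longrightarrow> m * norm x powr (- \<gamma>) < z x"
    and q: "q \<ge> 2" "real q \<ge> p"
begin

definition "f x = ln (z x) + \<gamma> * ln (norm x) - ln m"
definition "w x = m * norm x powr (- \<gamma>)" for x :: "real^'n"
definition "G x = (1 / z x) *\<^sub>R g x"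
definition "H x = (- \<gamma> / (norm x)\<^sup>2) *\<^sub>R x" for x :: "real^'n"
definition "eta n x = cut q \<tau> n (\<sigma> * ln (norm x))" for x :: "real^'n"
definition "Deta n x = (cut' q \<tau> n (\<sigma> * ln (norm x)) * \<sigma> / (norm x)\<^sup>2) *\<^sub>R x" for x :: "real^'n"
text \<open>The integrand left after adding the two tested relations and cancelling the singular
  terms. The middle summand comes from differentiating k(f), as the gradient of f is G - H.\<close>

definition "Psi n x = w x powr p * (neg_part (f x) * ((plap p (G x) - plap p (H x)) \<bullet> Deta n x)
   + eta n x * neg_part' (f x) * ((plap p (G x) - plap p (H x)) \<bullet> (G x - H x))
   - eta n x * neg_part (f x) * picone p (G x) (H x))"
definition "J x = w x powr p * neg_part (f x) * norm (G x) powr p"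
definition "Y x = w x powr p * norm x powr (- p)" for x :: "real^'n"

section \<open>The tested inequality and pointwise bounds for its integrand\<close>

lemma w_pos: "x \<noteq> 0 \<Longrightarrow> w x > 0"
  using m by (simp add: w_def)

lemma z_eq_w_exp: "x \<noteq> 0 \<Longrightarrow> z x = w x * exp (f x)"
  using z(2)[of x] m by (simp add: f_def w_def exp_add exp_diff powr_def exp_minus field_simps)

lemma f_pos: "x \<noteq> 0 \<Longrightarrow> \<bar>ln (norm x)\<bar> \<le> \<tau> \<Longrightarrow> f x > 0"
  using tau(2)[of x] z_eq_w_exp[of x] w_pos[of x] by (simp add: w_def[symmetric])

lemma G_minus_H: "(1 / z x) *\<^sub>R g x + (\<gamma> / (norm x)\<^sup>2) *\<^sub>R x = G x - H x"
  by (simp add: G_def H_def)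

lemma norm_H: "norm (H x) = \<gamma> / norm x"
  using gam(1) by (cases "x = 0") (auto simp: H_def power2_eq_square)

lemma plap_H: "x \<noteq> 0 \<Longrightarrow> plap p (H x) = - (\<gamma> powr (p - 1) * norm x powr (- p)) *\<^sub>R x"
proof (cases "\<gamma> = 0")
  case True
  then have "H x = 0" unfolding H_def by simp
  then show ?thesis using True p by (simp add: plap_def)
next
  case False
  assume x: "x \<noteq> 0"
  have g0: "\<gamma> > 0" using False gam(1) by simp
  have "(\<gamma> / norm x) powr (p - 2) * (\<gamma> / (norm x)\<^sup>2) = (\<gamma> powr (p - 2) * \<gamma>) / (norm x powr (p - 2) * (norm x)\<^sup>2)"
    using g0 x by (simp add: powr_divide)
  also have "\<gamma> powr (p - 2) * \<gamma> = \<gamma> powr (p - 1)"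
    using g0 by (simp add: powr_diff powr_numeral power2_eq_square)
  also have "norm x powr (p - 2) * (norm x)\<^sup>2 = norm x powr p"
    using x by (simp add: powr_diff powr_numeral)
  finally have "(\<gamma> / norm x) powr (p - 2) * (\<gamma> / (norm x)\<^sup>2) = \<gamma> powr (p - 1) * norm x powr (- p)"
    by (simp add: powr_minus_divide)
  then show ?thesis by (simp add: plap_def norm_H) (simp add: H_def)
qed

lemma measurable_data [measurable]:
  "z \<in> borel_measurable borel" "g \<in> borel_measurable borel" "f \<in> borel_measurable borel"
  "w \<in> borel_measurable borel" "G \<in> borel_measurable borel" "H \<in> borel_measurable borel"
  "J \<in> borel_measurable borel" "Y \<in> borel_measurable borel"
  "(\<lambda>x. picone p (G x) (H x)) \<in> borel_measurable borel" "(\<lambda>x. neg_part (f x)) \<in> borel_measurable borel"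
proof -
  show [measurable]: "z \<in> borel_measurable borel" "g \<in> borel_measurable borel"
    using zg by (auto simp: weak_gradient_def loc_int_def)
  show [measurable]: "f \<in> borel_measurable borel" "w \<in> borel_measurable borel" "G \<in> borel_measurable borel" "H \<in> borel_measurable borel"
    unfolding f_def w_def G_def H_def by measurable
  have "continuous_on UNIV neg_part"
    using DERIV_neg_part DERIV_isCont continuous_at_imp_continuous_on by blast
  then have [measurable]: "neg_part \<in> borel_measurable borel" by (rule borel_measurable_continuous_onI)
  show [measurable]: "(\<lambda>x. neg_part (f x)) \<in> borel_measurable borel" by measurable
  show "J \<in> borel_measurable borel" "Y \<in> borel_measurable borel" unfolding J_def Y_def by measurable
  show "(\<lambda>x. picone p (G x) (H x)) \<in> borel_measurable borel" unfolding picone_def plap_def by measurable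
qed

lemma eta_C1c: "n > 0 \<Longrightarrow> C1c (log_shell \<sigma> 0 n) (eta n) (Deta n)"
  unfolding eta_def[abs_def] Deta_def[abs_def]
  by (rule radial_C1c[OF sigma _ DERIV_cut continuous_on_cut' cut_outside])
    (use tau(1) q(1) in auto)

lemma eta_bounds: "0 \<le> eta n x" "eta n x \<le> 1"
  using cut_bounds by (auto simp: eta_def)

lemma measurable_eta [measurable]: "n > 0 \<Longrightarrow> eta n \<in> borel_measurable borel"
  using borel_measurable_continuous_onI[OF C1cD(5)[OF eta_C1c]] .

text \<open>\<open>L1\<close> comes from the supersolution, \<open>L2\<close> from the radial field,
  which is the flux of w up to the constant -c0. The terms without gradients are the same integral
  with opposite signs, which is where the root equation enters.\<close>

lemma Psi_integral:
  assumes n: "n > 0"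
  shows "integrable lborel (Psi n)" "0 \<le> integral\<^sup>L lborel (Psi n)"
proof -
  let ?A = "log_shell \<sigma> 0 n :: (real^'n) set"
  let ?k = neg_part and ?k' = neg_part'
  \<comment> \<open>As exp(f) = z / w, the product of \<open>a\<close> with this \<open>K\<close> at
    f is \<eta> w^p z^(1-p) k(f).\<close>
  define K where "K t = exp ((1 - p) * t) * ?k t" for t
  define K' where "K' t = exp ((1 - p) * t) * (?k' t + (1 - p) * ?k t)" for t
  define a where "a x = eta n x * w x" for x
  define Da where "Da x = w x *\<^sub>R Deta n x + eta n x *\<^sub>R (w x *\<^sub>R H x)" for x
  have a: "C1c ?A a Da"
    unfolding a_def[abs_def] Da_def[abs_def]
  proof (rule C1c_mult[OF eta_C1c[OF n], of "- {0}"])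
    show "GDERIV w x :> w x *\<^sub>R H x" if "x \<in> - {0}" for x
      using GDERIV_norm_powr[of x m \<gamma>] that by (simp add: w_def[abs_def] H_def)
    show "continuous_on (- {0}) (\<lambda>x. w x *\<^sub>R H x)"
      unfolding w_def H_def by (intro continuous_intros) auto
  qed (auto simp: log_shell_def)
  have a0: "0 \<notin> ?A" by simp
  have ann: "0 \<le> a x" for x using eta_bounds m by (simp add: a_def w_def)
  have dK: "DERIV K t :> K' t" for t
  proof -
    have "DERIV (\<lambda>t. exp ((1 - p) * t) * ?k t) t :> exp ((1 - p) * t) * (1 - p) * ?k t + ?k' t * exp ((1 - p) * t)"
      by (intro DERIV_mult DERIV_neg_part) (auto intro!: derivative_eq_intros)
    then show ?thesis by (simp add: K_def[abs_def] K'_def algebra_simps)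
  qed
  have ck: "continuous_on UNIV ?k"
    using DERIV_neg_part DERIV_isCont continuous_at_imp_continuous_on by blast
  have cK: "continuous_on UNIV K'"
    unfolding K'_def[abs_def] by (intro continuous_intros ck continuous_on_neg_part')
  have Knn: "0 \<le> K t" for t using neg_part_bounds(1) by (simp add: K_def)
  define b where "b x = \<nu> * norm x powr (- p) * z x powr (p - 1)" for x
  have cb: "continuous_on (- {0}) b"
    unfolding b_def[abs_def] using z(2) by (intro continuous_intros z(1)) (auto simp: less_imp_neq[symmetric])
  have mV: "(\<lambda>x. plap p (g x)) \<in> borel_measurable borel" unfolding plap_def by measurable
  have sA: "?A \<in> sets borel" using compact_log_shell[OF sigma] by (intro borel_compact)
  have iV: "integrable lborel (\<lambda>x. indicator ?A x * norm (plap p (g x)) powr (p / (p - 1)))"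
    unfolding norm_plap_powr[OF p]
  proof (rule Bochner_Integration.integrable_bound[OF gLp])
    show "(\<lambda>x. indicat_real ?A x * norm (g x) powr p) \<in> borel_measurable lborel"
      using sA by (intro borel_measurable_times borel_measurable_indicator) auto
  qed (auto simp: indicator_def)
  \<comment> \<open>The exponent for which w^(p-1) |x|^-p is m^(p-1) |x|^-\<alpha>.\<close>
  define \<alpha> where "\<alpha> = p + \<gamma> * (p - 1)"
  define c0 where "c0 = m powr (p - 1) * \<gamma> powr (p - 1)"
  define L1 where "L1 x = plap p (g x) \<bullet> (K (f x) *\<^sub>R Da x + (a x * K' (f x)) *\<^sub>R (G x - H x))" for x
  define L2 where "L2 x = norm x powr (- \<alpha>) * (x \<bullet> (?k (f x) *\<^sub>R Da x + (a x * ?k' (f x)) *\<^sub>R (G x - H x)))" for x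
  have super': "(\<integral>x. b x * \<phi> x \<partial>lborel) \<le> (\<integral>x. plap p (g x) \<bullet> D x \<partial>lborel)"
    if "C1c A \<phi> D" "0 \<notin> A" "\<And>x. 0 \<le> \<phi> x" for A \<phi> D
    unfolding b_def using that by (rule super)
  have L1': "L1 = (\<lambda>x. plap p (g x) \<bullet> (K (ln (z x) + \<gamma> * ln (norm x) - ln m) *\<^sub>R Da x +
      (a x * K' (ln (z x) + \<gamma> * ln (norm x) - ln m)) *\<^sub>R ((1 / z x) *\<^sub>R g x + (\<gamma> / (norm x)\<^sup>2) *\<^sub>R x)))"
    by (simp only: L1_def[abs_def] G_minus_H f_def)
  have L2': "L2 = (\<lambda>x. norm x powr (- \<alpha>) * (x \<bullet> (?k (ln (z x) + \<gamma> * ln (norm x) - ln m) *\<^sub>R Da x +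
      (a x * ?k' (ln (z x) + \<gamma> * ln (norm x) - ln m)) *\<^sub>R ((1 / z x) *\<^sub>R g x + (\<gamma> / (norm x)\<^sup>2) *\<^sub>R x))))"
    by (simp only: L2_def[abs_def] G_minus_H f_def)
  have S': "(\<integral>x. b x * (a x * K (f x)) \<partial>lborel) \<le> integral\<^sup>L lborel L1" "integrable lborel L1"
    unfolding L1' f_def
    by (rule composite_supersolution[OF p zg gLp z a a0 ann dK cK Knn mV iV cb super'], assumption+)+
  have R1: "integral\<^sup>L lborel L2 = (\<alpha> - real CARD('n)) * (\<integral>x. norm x powr (- \<alpha>) * (a x * ?k (f x)) \<partial>lborel)"
    unfolding L2' f_def
    by (rule composite_radial_field(1)[OF p zg gLp z a a0 DERIV_neg_part continuous_on_neg_part'])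
  have R2: "integrable lborel L2"
    unfolding L2' by (rule composite_radial_field(2)[OF p zg gLp z a a0 DERIV_neg_part continuous_on_neg_part'])
  note R' = R1 R2
  have wp1: "w x powr (p - 1) * norm x powr (- p) = m powr (p - 1) * norm x powr (- \<alpha>)" if "x \<noteq> 0" for x
  proof -
    have "w x powr (p - 1) = m powr (p - 1) * norm x powr (- \<gamma> * (p - 1))"
      using m by (simp add: w_def powr_mult powr_powr)
    moreover have "norm x powr (- \<gamma> * (p - 1)) * norm x powr (- p) = norm x powr (- \<alpha>)"
      unfolding powr_add[symmetric] by (simp add: \<alpha>_def algebra_simps)
    ultimately show ?thesis by (simp only: mult.assoc)
  qed
  have zp1: "z x powr (p - 1) * exp ((1 - p) * f x) = w x powr (p - 1)" if "x \<noteq> 0" for x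
  proof -
    have "z x powr (p - 1) = w x powr (p - 1) * exp ((p - 1) * f x)"
      unfolding z_eq_w_exp[OF that] using w_pos[OF that] by (simp add: powr_mult exp_powr_real mult.commute)
    then show ?thesis by (simp add: mult.assoc flip: exp_add) (simp add: algebra_simps)
  qed
  have zero: "a 0 = 0" "Da 0 = 0" "Deta n 0 = 0" "eta n 0 = 0"
    using C1cD(4)[OF a a0] C1c_gradient_zero[OF a a0] C1cD(4)[OF eta_C1c[OF n] a0] C1c_gradient_zero[OF eta_C1c[OF n] a0] by auto
  \<comment> \<open>After extracting w^(p-1), \<open>L1\<close> carries \<open>plap p (G x)\<close>
    and \<open>c0 * L2\<close> carries minus \<open>plap p (H x)\<close>. The gradient of w in
    \<open>Da\<close> and the summand (1 - p) k(f) in \<open>K'\<close> combine to minus k(f) times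
    the Picone remainder.\<close>
  have Psi_eq: "Psi n x = L1 x + c0 * L2 x" for x
  proof (cases "x = 0")
    case True
    then show ?thesis by (simp add: Psi_def L1_def L2_def zero)
  next
    case False
    let ?P = "plap p (G x)" and ?Q = "plap p (H x)" and ?W = "w x powr (p - 1)"
    have "g x = z x *\<^sub>R G x" using z(2)[OF False] by (simp add: G_def)
    then have "plap p (g x) = z x powr (p - 1) *\<^sub>R ?P" using plap_scaleR[OF z(2)[OF False], of p "G x"] by simp
    moreover have "K (f x) *\<^sub>R Da x + (a x * K' (f x)) *\<^sub>R (G x - H x) =
       exp ((1 - p) * f x) *\<^sub>R (?k (f x) *\<^sub>R Da x + (a x * (?k' (f x) + (1 - p) * ?k (f x))) *\<^sub>R (G x - H x))"
      by (simp add: K_def K'_def algebra_simps)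
    ultimately have "L1 x = (z x powr (p - 1) * exp ((1 - p) * f x)) * (?P \<bullet> (?k (f x) *\<^sub>R Da x + (a x * (?k' (f x) + (1 - p) * ?k (f x))) *\<^sub>R (G x - H x)))"
      unfolding L1_def by simp
    then have L1: "L1 x = ?W * (?P \<bullet> (?k (f x) *\<^sub>R Da x + (a x * (?k' (f x) + (1 - p) * ?k (f x))) *\<^sub>R (G x - H x)))"
      by (simp add: zp1[OF False])
    have "?W *\<^sub>R ?Q = - (\<gamma> powr (p - 1) * (?W * norm x powr (- p))) *\<^sub>R x"
      by (simp add: plap_H[OF False] mult_ac)
    also have "\<dots> = - (c0 * norm x powr (- \<alpha>)) *\<^sub>R x"
      by (simp only: wp1[OF False] c0_def) (simp add: mult_ac)
    finally have WP0: "(c0 * norm x powr (- \<alpha>)) *\<^sub>R x = - (?W *\<^sub>R ?Q)" by simp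
    have "c0 * L2 x = ((c0 * norm x powr (- \<alpha>)) *\<^sub>R x) \<bullet> (?k (f x) *\<^sub>R Da x + (a x * ?k' (f x)) *\<^sub>R (G x - H x))"
      by (simp add: L2_def)
    then have L2: "c0 * L2 x = - (?W * (?Q \<bullet> (?k (f x) *\<^sub>R Da x + (a x * ?k' (f x)) *\<^sub>R (G x - H x))))"
      unfolding WP0 by simp
    have Wp: "w x powr p = ?W * w x" using w_pos[OF False] by (simp add: powr_diff)
    show ?thesis
      unfolding L1 L2 Psi_def Wp picone_def a_def Da_def
      by (simp add: inner_add_left inner_add_right inner_diff_left inner_diff_right plap_inner_self algebra_simps)
  qed
  then have PsiL: "Psi n = (\<lambda>x. L1 x + c0 * L2 x)" by (simp add: fun_eq_iff)
  show "integrable lborel (Psi n)" unfolding PsiL using S'(2) R'(2) by simp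
  \<comment> \<open>The root equation, divided up as \<nu> = \<gamma>^(p-1) (N - \<alpha>),
    identifies the coefficients of the two singular terms.\<close>
  have nu: "m powr (p - 1) * \<nu> = - (c0 * (\<alpha> - real CARD('n)))"
  proof -
    have "\<gamma> powr p = \<gamma> powr (p - 1) * \<gamma>" using gam(1) p by (cases "\<gamma> = 0") (auto simp: powr_diff)
    then have nu0: "\<nu> = \<gamma> powr (p - 1) * (real CARD('n) - \<alpha>)" using root by (simp add: \<alpha>_def algebra_simps)
    show ?thesis unfolding nu0 c0_def by (simp add: algebra_simps)
  qed
  have "b x * (a x * K (f x)) = - (c0 * (\<alpha> - real CARD('n))) * (norm x powr (- \<alpha>) * (a x * ?k (f x)))" for x
  proof (cases "x = 0")
    case False
    have "b x * (a x * K (f x)) = \<nu> * ((z x powr (p - 1) * exp ((1 - p) * f x)) * norm x powr (- p)) * (a x * ?k (f x))"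
      by (simp add: b_def K_def mult_ac)
    also have "\<dots> = (m powr (p - 1) * \<nu>) * (norm x powr (- \<alpha>) * (a x * ?k (f x)))"
      by (simp only: zp1[OF False] wp1[OF False]) (simp add: mult_ac)
    finally show ?thesis unfolding nu .
  qed (simp add: zero)
  then have "(\<integral>x. b x * (a x * K (f x)) \<partial>lborel) = - (c0 * integral\<^sup>L lborel L2)"
    unfolding R' by simp
  then have "0 \<le> integral\<^sup>L lborel L1 + c0 * integral\<^sup>L lborel L2" using S'(1) by simp
  also have "\<dots> = integral\<^sup>L lborel (Psi n)" unfolding PsiL using S'(2) R'(2) by simp
  finally show "0 \<le> integral\<^sup>L lborel (Psi n)" .
qed

text \<open>For 0 \<le> \<sigma> ln |x| \<le> \<tau> the ratio exceeds 1, so k(f) and k'(f) vanish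
  there; elsewhere off the shell the cutoff and its gradient vanish. The rise of the cutoff thus
  leaves no trace.\<close>

lemma outside_shell:
  assumes "n > 0" "x \<notin> log_shell \<sigma> \<tau> n"
  shows "eta n x * neg_part (f x) = 0" "Psi n x = 0"
proof -
  have "(eta n x = 0 \<and> Deta n x = 0) \<or> (neg_part (f x) = 0 \<and> neg_part' (f x) = 0)"
  proof (cases "x \<in> log_shell \<sigma> 0 n")
    case True
    then have "x \<noteq> 0" "\<bar>ln (norm x)\<bar> \<le> \<tau>" using assms(2) sigma by (auto simp: log_shell_def)
    then have "f x > 0" by (rule f_pos)
    then show ?thesis using neg_part_bounds by simp
  next
    case False
    then show ?thesis using C1cD(4)[OF eta_C1c[OF assms(1)] False] C1c_gradient_zero[OF eta_C1c[OF assms(1)] False] by simp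
  qed
  then show "eta n x * neg_part (f x) = 0" "Psi n x = 0" by (auto simp: Psi_def)
qed

text \<open>The middle summand is nonpositive by monotonicity of \<open>plap\<close> and the sign of
  \<open>neg_part'\<close>, and is dropped.\<close>

lemma Psi_le:
  assumes n: "n > 0"
  shows "Psi n x \<le> w x powr p * neg_part (f x) * ((norm (G x) powr (p - 1) + norm (H x) powr (p - 1)) * norm (Deta n x)
     - eta n x * picone p (G x) (H x))"
proof -
  have 1: "(plap p (G x) - plap p (H x)) \<bullet> Deta n x \<le> (norm (G x) powr (p - 1) + norm (H x) powr (p - 1)) * norm (Deta n x)"
  proof -
    have "(plap p (G x) - plap p (H x)) \<bullet> Deta n x \<le> norm (plap p (G x) - plap p (H x)) * norm (Deta n x)"
      by (rule norm_cauchy_schwarz)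
    also have "\<dots> \<le> (norm (G x) powr (p - 1) + norm (H x) powr (p - 1)) * norm (Deta n x)"
      by (intro mult_right_mono order_trans[OF norm_triangle_ineq4]) (simp_all add: norm_plap)
    finally show ?thesis .
  qed
  have 2: "eta n x * neg_part' (f x) * ((plap p (G x) - plap p (H x)) \<bullet> (G x - H x)) \<le> 0"
    using eta_bounds neg_part_bounds(3) plap_monotone[OF p] by (intro mult_nonpos_nonneg mult_nonneg_nonpos) auto
  have "Psi n x \<le> w x powr p * (neg_part (f x) * ((norm (G x) powr (p - 1) + norm (H x) powr (p - 1)) * norm (Deta n x))
     - eta n x * neg_part (f x) * picone p (G x) (H x))"
    unfolding Psi_def using 2 mult_left_mono[OF 1 neg_part_bounds(1)[of "f x"]] by (intro mult_left_mono) auto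
  then show ?thesis by (simp add: algebra_simps)
qed

text \<open>The rise of the cutoff is over beyond \<tau>, which leaves the slope 64 / n. The power
  of \<open>cut_base\<close> is retained because \<open>cutoff_Young\<close> consumes it.\<close>

lemma norm_Deta_le:
  assumes n: "n > 0" and x: "x \<in> log_shell \<sigma> \<tau> n"
  shows "norm (Deta n x) \<le> cut_base \<tau> n (\<sigma> * ln (norm x)) ^ (q - 1) * (64 * real q / n / norm x)"
proof -
  let ?t = "\<sigma> * ln (norm x)"
  have x0: "x \<noteq> 0" and t: "\<tau> \<le> ?t" using x by (auto simp: log_shell_def)
  have c: "\<bar>cut_base' \<tau> n ?t\<bar> \<le> 64 / n" using cut_tail(1,2)[OF tau(1) n t] by linarith
  have "norm (Deta n x) = \<bar>cut' q \<tau> n ?t\<bar> / norm x"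
    using x0 sigma by (auto simp: Deta_def abs_mult power2_eq_square)
  also have "\<bar>cut' q \<tau> n ?t\<bar> = real q * cut_base \<tau> n ?t ^ (q - 1) * \<bar>cut_base' \<tau> n ?t\<bar>"
    using cut_base_bounds(1) by (simp add: cut'_def abs_mult)
  also have "\<dots> / norm x \<le> (real q * cut_base \<tau> n ?t ^ (q - 1) * (64 / n)) / norm x"
    using c cut_base_bounds(1) by (intro divide_right_mono mult_left_mono) auto
  finally show ?thesis by (simp add: mult_ac)
qed

section \<open>Integral estimates on logarithmic shells and the conclusion f \<ge> 0\<close>

lemma Y_nonneg: "0 \<le> Y x" and J_nonneg: "0 \<le> J x"
  using neg_part_bounds(1) by (auto simp: Y_def J_def)

lemma shell_borel [measurable]: "(log_shell \<sigma> s n :: (real^'n) set) \<in> sets borel"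
  using compact_log_shell[OF sigma] by (intro borel_compact)

lemma Y_integrable: "integrable lborel (\<lambda>x. indicator (log_shell \<sigma> s n) x * Y x)"
proof -
  have "continuous_on (log_shell \<sigma> s n) Y"
    unfolding Y_def w_def using m by (intro continuous_intros) (auto simp: log_shell_def)
  from borel_integrable_compact[OF compact_log_shell[OF sigma] this] show ?thesis by simp
qed

lemma eta_ge: "n > 0 \<Longrightarrow> x \<in> log_shell \<sigma> \<tau> n \<Longrightarrow> (1/2) ^ q \<le> eta (2 * n) x"
  unfolding eta_def by (rule cut_tail(5)[OF tau(1)]) (auto simp: log_shell_def)

lemma indicator_le_eta: "n > 0 \<Longrightarrow> indicator (log_shell \<sigma> \<tau> n) x \<le> 2 ^ q * eta (2 * n) x"
  using eta_ge[of n x] eta_bounds(1)[of "2 * n" x]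
  by (auto simp: indicator_def power_divide field_simps)

text \<open>Y is a multiple of |x|^-\<beta>, so the radial field identity turns d times the integral
  of Y \<eta> into the integral of Y times the derivative of the cutoff. That derivative is positive
  only where the cutoff rises, a fixed shell, so the bound does not depend on n.\<close>

lemma Y_bound: "\<exists>C. \<forall>n\<ge>1. (\<integral>x. indicator (log_shell \<sigma> \<tau> n) x * Y x \<partial>lborel) \<le> C"
proof -
  define \<beta> where "\<beta> = \<gamma> * p + p"
  define d where "d = \<sigma> * (\<beta> - real CARD('n))"
  have d: "d > 0" using gam(2) by (simp add: d_def \<beta>_def)
  have Yeq: "Y x = m powr p * norm x powr (- \<beta>)" for x
    using m by (cases "x = 0") (auto simp: Y_def w_def \<beta>_def powr_mult powr_powr powr_add[symmetric])
  \<comment> \<open>The largest possible contribution of the rise, with the derivative of the cutoff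
    replaced by its upper bound from \<open>cut'_le\<close>.\<close>
  define K where "K = (\<integral>x. indicator (log_shell \<sigma> 0 \<tau>) x * Y x * (real q * (64 / \<tau>)) \<partial>lborel)"
  have "(\<integral>x. indicator (log_shell \<sigma> \<tau> n) x * Y x \<partial>lborel) \<le> 2 ^ q * (K / d)" if n: "n \<ge> 1" for n
  proof -
    have n0: "2 * n > 0" using n by simp
    note E = eta_C1c[OF n0]
    have i1: "integrable lborel (\<lambda>x. Y x * eta (2 * n) x)"
    proof (rule Bochner_Integration.integrable_bound[OF Y_integrable[of 0 "2 * n"]])
      show "(\<lambda>x. Y x * eta (2 * n) x) \<in> borel_measurable lborel" using n0 by measurable
      show "AE x in lborel. norm (Y x * eta (2 * n) x) \<le> norm (indicat_real (log_shell \<sigma> 0 (2 * n)) x * Y x)"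
      proof (rule AE_I2)
        fix x
        show "norm (Y x * eta (2 * n) x) \<le> norm (indicat_real (log_shell \<sigma> 0 (2 * n)) x * Y x)"
          using C1cD(4)[OF E, of x] eta_bounds[of "2 * n" x] Y_nonneg[of x]
          by (cases "x \<in> log_shell \<sigma> 0 (2 * n)") (auto simp: mult_left_le)
      qed
    qed
    have xD: "\<sigma> * (x \<bullet> Deta (2 * n) x) = cut' q \<tau> (2 * n) (\<sigma> * ln (norm x))" if "x \<noteq> 0" for x
      using that sigma by (auto simp: Deta_def dot_square_norm)
    have "d * (\<integral>x. Y x * eta (2 * n) x \<partial>lborel) = \<sigma> * (m powr p * ((\<beta> - real CARD('n)) * (\<integral>x. norm x powr (- \<beta>) * eta (2 * n) x \<partial>lborel)))"
      by (simp add: Yeq d_def mult.assoc)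
    also have "\<dots> = \<sigma> * (m powr p * (\<integral>x. norm x powr (- \<beta>) * (x \<bullet> Deta (2 * n) x) \<partial>lborel))"
      by (subst integral_radial_field[OF E zero_notin_log_shell]) simp
    also have "\<dots> = (\<integral>x. Y x * (\<sigma> * (x \<bullet> Deta (2 * n) x)) \<partial>lborel)"
      unfolding Yeq by (simp add: mult_ac flip: integral_mult_right_zero integral_mult_left_zero)
    also have "\<dots> \<le> K"
      unfolding K_def
    proof (rule integral_mono')
      show "integrable lborel (\<lambda>x. indicator (log_shell \<sigma> 0 \<tau>) x * Y x * (real q * (64 / \<tau>)))"
        by (intro integrable_mult_left Y_integrable)
      fix x
      have nn: "0 \<le> indicat_real (log_shell \<sigma> 0 \<tau>) x * Y x * (real q * (64 / \<tau>))"
        using Y_nonneg tau(1) by (auto simp: indicator_def)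
      then show "0 \<le> indicat_real (log_shell \<sigma> 0 \<tau>) x * Y x * (real q * (64 / \<tau>))" .
      show "Y x * (\<sigma> * (x \<bullet> Deta (2 * n) x)) \<le> indicat_real (log_shell \<sigma> 0 \<tau>) x * Y x * (real q * (64 / \<tau>))"
      proof (cases "x = 0")
        case True
        then show ?thesis using nn by simp
      next
        case False
        have "cut' q \<tau> (2 * n) (\<sigma> * ln (norm x)) \<le> indicat_real (log_shell \<sigma> 0 \<tau>) x * (real q * (64 / \<tau>))"
        proof (cases "x \<in> log_shell \<sigma> 0 \<tau>")
          case True
          then show ?thesis using cut'_le[OF tau(1) n0] by simp
        next
          case f: False
          then consider "\<sigma> * ln (norm x) \<le> 0" | "\<tau> \<le> \<sigma> * ln (norm x)" using False by (force simp: log_shell_def)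
          then have "cut' q \<tau> (2 * n) (\<sigma> * ln (norm x)) \<le> 0"
            using cut_outside(2)[OF tau(1) n0 q(1)] cut_tail(4)[OF tau(1) n0] by cases auto
          then show ?thesis using f by simp
        qed
        then have "Y x * cut' q \<tau> (2 * n) (\<sigma> * ln (norm x)) \<le> Y x * (indicat_real (log_shell \<sigma> 0 \<tau>) x * (real q * (64 / \<tau>)))"
          using Y_nonneg by (rule mult_left_mono)
        then show ?thesis unfolding xD[OF False] by (simp add: mult_ac)
      qed
    qed
    finally have b: "(\<integral>x. Y x * eta (2 * n) x \<partial>lborel) \<le> K / d" using d by (simp add: le_divide_eq mult.commute)
    have "(\<integral>x. indicator (log_shell \<sigma> \<tau> n) x * Y x \<partial>lborel) \<le> (\<integral>x. 2 ^ q * (Y x * eta (2 * n) x) \<partial>lborel)"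
    proof (rule integral_mono[OF Y_integrable])
      show "integrable lborel (\<lambda>x. 2 ^ q * (Y x * eta (2 * n) x))" using i1 by simp
      fix x
      have "n > 0" using n by simp
      from mult_right_mono[OF indicator_le_eta[OF this, of x] Y_nonneg[of x]]
      show "indicat_real (log_shell \<sigma> \<tau> n) x * Y x \<le> 2 ^ q * (Y x * eta (2 * n) x)" by (simp add: mult_ac)
    qed
    also have "\<dots> = 2 ^ q * (\<integral>x. Y x * eta (2 * n) x \<partial>lborel)" by simp
    also have "\<dots> \<le> 2 ^ q * (K / d)" using b by (rule mult_left_mono) simp
    finally show ?thesis .
  qed
  then show ?thesis by blast
qed

text \<open>This is the logarithmic Caccioppoli estimate. \<open>Psi\<close> has nonnegative
  integral, the Picone remainder in it supplies (p - 1)/2 |G|^p, and half of that absorbs the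
  gradient of the cutoff; all remaining terms are multiples of Y.\<close>

lemma J_bound: "\<exists>C. \<forall>n\<ge>1. integrable lborel (\<lambda>x. indicator (log_shell \<sigma> \<tau> n) x * J x) \<and>
   (\<integral>x. indicator (log_shell \<sigma> \<tau> n) x * J x \<partial>lborel) \<le> C"
proof -
  \<comment> \<open>Half of the coefficient (p - 1) / 2 provided by
    \<open>picone_lower\<close>.\<close>
  have "(p - 1) / 4 > 0" using p by simp
  then obtain C1 where C1: "C1 > 0"
    "\<And>a b. 0 \<le> a \<Longrightarrow> 0 \<le> b \<Longrightarrow> a powr (p - 1) * b \<le> (p - 1) / 4 * a powr p + C1 * b powr p"
    using Young_absorb[OF p] by blast
  obtain C2 where C2: "C2 > 0"
    "\<And>G H :: real^'n. picone p G H \<ge> (p - 1) / 2 * norm G powr p - C2 * norm H powr p"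
    using picone_lower[OF p] by blast
  \<comment> \<open>64 bounds the slope of the step function, and \<open>q\<close> comes from
    differentiating the q-th power.\<close>
  define s where "s = 64 * real q"
  define C3 where "C3 = C1 * s powr p + \<gamma> powr (p - 1) * s + C2 * \<gamma> powr p"
  have s: "s > 0" using q(1) by (simp add: s_def)
  have C3: "C3 \<ge> 0" using C1(1) C2(1) s by (simp add: C3_def)
  have key: "eta n x * J x \<le> (4 / (p - 1)) * (C3 * (indicator (log_shell \<sigma> \<tau> n) x * Y x) - Psi n x)" if n: "n \<ge> 1" for n x
  proof (cases "x \<in> log_shell \<sigma> \<tau> n")
    case False
    then have "eta n x * J x = 0" "Psi n x = 0" using outside_shell[of n x] n by (auto simp: J_def)
    then show ?thesis using False by auto
  next
    case True
    have n0: "n > 0" using n by simp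
    have x0: "x \<noteq> 0" using True by (simp add: log_shell_def)
    define r where "r = norm x"
    have r: "r > 0" using x0 by (simp add: r_def)
    define c where "c = cut_base \<tau> n (\<sigma> * ln (norm x))"
    have c: "0 \<le> c" "c \<le> 1" using cut_base_bounds by (auto simp: c_def)
    have e: "eta n x = c ^ q" by (simp add: eta_def cut_def c_def)
    define A where "A = norm (G x)"
    have A: "A \<ge> 0" by (simp add: A_def)
    have D: "norm (Deta n x) \<le> c ^ (q - 1) * (s / r)"
    proof -
      have "norm (Deta n x) \<le> c ^ (q - 1) * (s / n / r)"
        using norm_Deta_le[OF n0 True] by (simp add: c_def s_def r_def)
      also have "\<dots> \<le> c ^ (q - 1) * (s / r)"
        using c n s r by (intro mult_left_mono divide_right_mono) (auto simp: divide_le_eq)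
      finally show ?thesis .
    qed
    have 1: "A powr (p - 1) * norm (Deta n x) \<le> (p - 1) / 4 * (c ^ q * A powr p) + C1 * s powr p * r powr (- p)"
    proof -
      have "A powr (p - 1) * norm (Deta n x) \<le> A powr (p - 1) * (c ^ (q - 1) * (s / r))"
        using D by (rule mult_left_mono) simp
      also have "\<dots> \<le> (p - 1) / 4 * (c ^ q * A powr p) + C1 * (s / r) powr p"
        by (rule cutoff_Young[OF C1(2) c q A _ C1(1)]) (use s r in auto)
      also have "(s / r) powr p = s powr p * r powr (- p)"
        using s r by (simp add: powr_divide powr_minus_divide)
      finally show ?thesis by simp
    qed
    have 2: "(\<gamma> / r) powr (p - 1) * norm (Deta n x) \<le> \<gamma> powr (p - 1) * s * r powr (- p)"
    proof -
      have "c ^ (q - 1) * (s / r) \<le> 1 * (s / r)" using c s r by (intro mult_right_mono power_le_one) auto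
      then have "(\<gamma> / r) powr (p - 1) * norm (Deta n x) \<le> (\<gamma> / r) powr (p - 1) * (s / r)"
        using D by (intro mult_left_mono) auto
      also have "\<dots> = \<gamma> powr (p - 1) * s * (1 / (r powr (p - 1) * r))"
        using r gam(1) by (simp add: powr_divide)
      also have "r powr (p - 1) * r = r powr p" using r by (simp add: powr_diff)
      finally show ?thesis by (simp add: powr_minus_divide)
    qed
    have 3: "c ^ q * picone p (G x) (H x) \<ge> (p - 1) / 2 * (c ^ q * A powr p) - C2 * \<gamma> powr p * r powr (- p)"
    proof -
      have "c ^ q * picone p (G x) (H x) \<ge> c ^ q * ((p - 1) / 2 * A powr p - C2 * (\<gamma> / r) powr p)"
        using C2(2)[of "G x" "H x"] c by (intro mult_left_mono) (auto simp: A_def norm_H r_def)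
      moreover have "c ^ q * (C2 * (\<gamma> / r) powr p) \<le> 1 * (C2 * (\<gamma> / r) powr p)"
        using c C2(1) by (intro mult_right_mono power_le_one) auto
      moreover have "(\<gamma> / r) powr p = \<gamma> powr p * r powr (- p)"
        using gam(1) r by (simp add: powr_divide powr_minus_divide)
      ultimately show ?thesis by (simp add: algebra_simps)
    qed
    have "(A powr (p - 1) + (\<gamma> / r) powr (p - 1)) * norm (Deta n x) - c ^ q * picone p (G x) (H x)
       \<le> C3 * r powr (- p) - (p - 1) / 4 * (c ^ q * A powr p)"
    proof -
      have "(p - 1) / 2 * (c ^ q * A powr p) = (p - 1) / 4 * (c ^ q * A powr p) + (p - 1) / 4 * (c ^ q * A powr p)" by simp
      moreover have "C3 * r powr (- p) = C1 * s powr p * r powr (- p) + \<gamma> powr (p - 1) * s * r powr (- p) + C2 * \<gamma> powr p * r powr (- p)"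
        by (simp add: C3_def algebra_simps)
      moreover have "(A powr (p - 1) + (\<gamma> / r) powr (p - 1)) * norm (Deta n x) = A powr (p - 1) * norm (Deta n x) + (\<gamma> / r) powr (p - 1) * norm (Deta n x)"
        by (rule distrib_right)
      ultimately show ?thesis using 1 2 3 by linarith
    qed
    then have "w x powr p * neg_part (f x) * ((A powr (p - 1) + (\<gamma> / r) powr (p - 1)) * norm (Deta n x) - c ^ q * picone p (G x) (H x))
       \<le> w x powr p * neg_part (f x) * (C3 * r powr (- p) - (p - 1) / 4 * (c ^ q * A powr p))"
      using neg_part_bounds(1) by (intro mult_left_mono) auto
    then have "Psi n x \<le> w x powr p * neg_part (f x) * (C3 * r powr (- p) - (p - 1) / 4 * (c ^ q * A powr p))"
      using Psi_le[OF n0, of x] by (simp add: A_def norm_H r_def e)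
    also have "\<dots> = C3 * neg_part (f x) * Y x - (p - 1) / 4 * (eta n x * J x)"
      by (simp add: J_def Y_def e A_def r_def algebra_simps)
    also have "\<dots> \<le> C3 * Y x - (p - 1) / 4 * (eta n x * J x)"
    proof -
      have "C3 * (neg_part (f x) * Y x) \<le> C3 * (1 * Y x)"
        using C3 neg_part_bounds Y_nonneg by (intro mult_left_mono mult_right_mono) auto
      then show ?thesis by simp
    qed
    finally show ?thesis using True p by (simp add: field_simps)
  qed
  obtain CY where CY: "\<And>n. n \<ge> 1 \<Longrightarrow> (\<integral>x. indicator (log_shell \<sigma> \<tau> n) x * Y x \<partial>lborel) \<le> CY"
    using Y_bound by blast
  have "integrable lborel (\<lambda>x. indicator (log_shell \<sigma> \<tau> n) x * J x) \<and>
   (\<integral>x. indicator (log_shell \<sigma> \<tau> n) x * J x \<partial>lborel) \<le> 2 ^ q * ((4 / (p - 1)) * (C3 * CY))" if n: "n \<ge> 1" for n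
  proof -
    have n0: "n > 0" and n1: "2 * n \<ge> 1" and n2: "2 * n > 0" using n by auto
    \<comment> \<open>A cutoff of length 2 n is at least 2^-q on the shell of length n, so the
      indicator can be replaced at the cost of the factor 2^q.\<close>
    let ?B = "\<lambda>x. 2 ^ q * ((4 / (p - 1)) * (C3 * (indicator (log_shell \<sigma> \<tau> (2 * n)) x * Y x) - Psi (2 * n) x))"
    have iB: "integrable lborel ?B"
      using Psi_integral(1)[OF n2] Y_integrable by (intro integrable_mult_right Bochner_Integration.integrable_diff)
    have le: "indicator (log_shell \<sigma> \<tau> n) x * J x \<le> ?B x" for x
    proof -
      have "indicator (log_shell \<sigma> \<tau> n) x * J x \<le> (2 ^ q * eta (2 * n) x) * J x"
        using indicator_le_eta[OF n0] J_nonneg by (rule mult_right_mono)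
      also have "\<dots> = 2 ^ q * (eta (2 * n) x * J x)" by simp
      also have "\<dots> \<le> ?B x" using key[OF n1] by (intro mult_left_mono) auto
      finally show ?thesis .
    qed
    have iJ: "integrable lborel (\<lambda>x. indicator (log_shell \<sigma> \<tau> n) x * J x)"
    proof (rule Bochner_Integration.integrable_bound[OF iB])
      show "(\<lambda>x. indicat_real (log_shell \<sigma> \<tau> n) x * J x) \<in> borel_measurable lborel" by measurable
      show "AE x in lborel. norm (indicat_real (log_shell \<sigma> \<tau> n) x * J x) \<le> norm (?B x)"
      proof (rule AE_I2)
        fix x
        have "0 \<le> indicat_real (log_shell \<sigma> \<tau> n) x * J x" using J_nonneg by simp
        then show "norm (indicat_real (log_shell \<sigma> \<tau> n) x * J x) \<le> norm (?B x)"
          using order_trans[OF le abs_ge_self] by (simp only: real_norm_def abs_of_nonneg)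
      qed
    qed
    have "(\<integral>x. indicator (log_shell \<sigma> \<tau> n) x * J x \<partial>lborel) \<le> integral\<^sup>L lborel ?B"
      by (rule integral_mono[OF iJ iB le])
    also have "\<dots> = 2 ^ q * ((4 / (p - 1)) * (C3 * (\<integral>x. indicator (log_shell \<sigma> \<tau> (2 * n)) x * Y x \<partial>lborel) - integral\<^sup>L lborel (Psi (2 * n))))"
      using Psi_integral(1)[OF n2] Y_integrable by simp
    also have "\<dots> \<le> 2 ^ q * ((4 / (p - 1)) * (C3 * CY))"
    proof -
      have "C3 * (\<integral>x. indicator (log_shell \<sigma> \<tau> (2 * n)) x * Y x \<partial>lborel) \<le> C3 * CY"
        using CY[OF n1] C3 by (rule mult_left_mono)
      then show ?thesis using Psi_integral(2)[OF n2] p by (intro mult_left_mono) auto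
    qed
    finally show ?thesis using iJ by blast
  qed
  then show ?thesis by blast
qed

text \<open>With |G|^p already bounded in the weighted L1 norm, the cutoff gradient is only O(1 / (n
  |x|)), so the integral of the Picone term with cutoff n is O(1/n). The cutoffs increase with n,
  hence the integral for the fixed \<open>M\<close> is below all of these and vanishes.\<close>

lemma picone_AE_zero:
  assumes M: "M \<ge> 1"
  shows "AE x in lborel. eta M x * neg_part (f x) * w x powr p * picone p (G x) (H x) = 0"
proof -
  define X where "X n x = eta n x * neg_part (f x) * w x powr p * picone p (G x) (H x)" for n x
  have Xnn: "0 \<le> X n x" for n x
    unfolding X_def by (intro mult_nonneg_nonneg eta_bounds neg_part_bounds(1) picone_nonneg[OF p]) simp
  obtain CY where CY: "\<And>n. n \<ge> 1 \<Longrightarrow> (\<integral>x. indicator (log_shell \<sigma> \<tau> n) x * Y x \<partial>lborel) \<le> CY"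
    using Y_bound by blast
  obtain CJ where CJ: "\<And>n. n \<ge> 1 \<Longrightarrow> integrable lborel (\<lambda>x. indicator (log_shell \<sigma> \<tau> n) x * J x)"
    "\<And>n. n \<ge> 1 \<Longrightarrow> (\<integral>x. indicator (log_shell \<sigma> \<tau> n) x * J x \<partial>lborel) \<le> CJ"
    using J_bound by blast
  define s where "s = 64 * real q"
  have s: "s > 0" using q(1) by (simp add: s_def)
  define d where "d = 1 + \<gamma> powr (p - 1)"
  have d: "d > 0" by (simp add: d_def add_pos_nonneg)
  let ?I = "\<lambda>n. indicator (log_shell \<sigma> \<tau> n)"
  have key: "X n x \<le> (s / n) * (?I n x * J x + d * (?I n x * Y x)) - Psi n x" if n: "n \<ge> 1" for n x
  proof (cases "x \<in> log_shell \<sigma> \<tau> n")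
    case False
    then have "X n x = 0" "Psi n x = 0" using outside_shell[of n x] n by (auto simp: X_def)
    then show ?thesis using False by simp
  next
    case True
    have n0: "n > 0" using n by simp
    define r where "r = norm x"
    have r: "r > 0" using True by (simp add: r_def log_shell_def)
    define A where "A = norm (G x)"
    have D: "norm (Deta n x) \<le> (s / n) * (1 / r)"
    proof -
      let ?c = "cut_base \<tau> n (\<sigma> * ln (norm x))"
      have "norm (Deta n x) \<le> ?c ^ (q - 1) * (s / n / r)"
        using norm_Deta_le[OF n0 True] by (simp add: s_def r_def)
      also have "\<dots> \<le> 1 * (s / n / r)"
        using cut_base_bounds s n0 r by (intro mult_right_mono power_le_one) auto
      finally show ?thesis by simp
    qed
    have 1: "A powr (p - 1) * (1 / r) \<le> A powr p + r powr (- p)"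
      using mult_le_powr_sum[OF p, of "A powr (p - 1)" "1 / r"] r p
      by (simp add: powr_powr powr_divide powr_minus_divide)
    have 2: "(\<gamma> / r) powr (p - 1) * (1 / r) = \<gamma> powr (p - 1) * r powr (- p)"
    proof -
      have "r powr (p - 1) * r = r powr p" using r by (simp add: powr_diff)
      then show ?thesis using r gam(1) by (simp add: powr_divide powr_minus_divide)
    qed
    have "(A powr (p - 1) + (\<gamma> / r) powr (p - 1)) * norm (Deta n x)
      \<le> (A powr (p - 1) + (\<gamma> / r) powr (p - 1)) * ((s / n) * (1 / r))"
      using D by (intro mult_left_mono) auto
    also have "\<dots> = (s / n) * (A powr (p - 1) * (1 / r) + (\<gamma> / r) powr (p - 1) * (1 / r))"
      by (simp add: algebra_simps add_divide_distrib)
    also have "\<dots> \<le> (s / n) * (A powr p + d * r powr (- p))"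
      unfolding 2 using 1 s n0 by (intro mult_left_mono) (auto simp: d_def algebra_simps)
    finally have 3: "(A powr (p - 1) + (\<gamma> / r) powr (p - 1)) * norm (Deta n x) \<le> (s / n) * (A powr p + d * r powr (- p))" .
    have "Psi n x \<le> w x powr p * neg_part (f x) * ((A powr (p - 1) + (\<gamma> / r) powr (p - 1)) * norm (Deta n x) - eta n x * picone p (G x) (H x))"
      using Psi_le[OF n0, of x] by (simp add: A_def norm_H r_def)
    also have "\<dots> \<le> w x powr p * neg_part (f x) * ((s / n) * (A powr p + d * r powr (- p)) - eta n x * picone p (G x) (H x))"
      using 3 neg_part_bounds(1) by (intro mult_left_mono) auto
    also have "\<dots> = (s / n) * (J x + d * (neg_part (f x) * Y x)) - X n x"
      by (simp add: J_def Y_def X_def A_def r_def algebra_simps)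
    also have "\<dots> \<le> (s / n) * (J x + d * (1 * Y x)) - X n x"
      using neg_part_bounds Y_nonneg d s n0
      by (intro diff_right_mono mult_left_mono add_left_mono mult_right_mono) auto
    finally show ?thesis using True by simp
  qed
  have mX: "X n \<in> borel_measurable lborel" if "n \<ge> 1" for n
  proof -
    have [measurable]: "eta n \<in> borel_measurable borel" using measurable_eta[of n] that by simp
    have [measurable]: "(\<lambda>x. picone p (G x) (H x)) \<in> borel_measurable borel" "(\<lambda>x. neg_part (f x)) \<in> borel_measurable borel"
      by (rule measurable_data)+
    show ?thesis unfolding X_def by measurable
  qed
  have iX: "integrable lborel (X n)" and X_le: "integral\<^sup>L lborel (X n) \<le> (s / n) * (CJ + d * CY)" if n: "n \<ge> 1" for n
  proof -
    have n0: "n > 0" using n by simp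
    let ?B = "\<lambda>x. (s / n) * (?I n x * J x + d * (?I n x * Y x)) - Psi n x"
    have iB: "integrable lborel ?B"
      using Psi_integral(1)[OF n0] Y_integrable CJ(1)[OF n]
      by (intro integrable_mult_right Bochner_Integration.integrable_diff Bochner_Integration.integrable_add)
    show i: "integrable lborel (X n)"
    proof (rule Bochner_Integration.integrable_bound[OF iB mX[OF n]], rule AE_I2)
      fix x
      show "norm (X n x) \<le> norm (?B x)" using key[OF n, of x] Xnn[of n x] unfolding real_norm_def by linarith
    qed
    have "integral\<^sup>L lborel (X n) \<le> integral\<^sup>L lborel ?B"
      by (rule integral_mono[OF i iB key[OF n]])
    also have "\<dots> = (s / n) * ((\<integral>x. ?I n x * J x \<partial>lborel) + d * (\<integral>x. ?I n x * Y x \<partial>lborel)) - integral\<^sup>L lborel (Psi n)"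
      using Psi_integral(1)[OF n0] Y_integrable CJ(1)[OF n] by simp
    also have "\<dots> \<le> (s / n) * (CJ + d * CY)"
    proof -
      have "(s / n) * ((\<integral>x. ?I n x * J x \<partial>lborel) + d * (\<integral>x. ?I n x * Y x \<partial>lborel)) \<le> (s / n) * (CJ + d * CY)"
        using CJ(2)[OF n] CY[OF n] s d n0 by (intro mult_left_mono add_mono) auto
      then show ?thesis using Psi_integral(2)[OF n0] by linarith
    qed
    finally show "integral\<^sup>L lborel (X n) \<le> (s / n) * (CJ + d * CY)" .
  qed
  have "integral\<^sup>L lborel (X M) \<le> 0"
  proof (rule LIMSEQ_le_const)
    have "(\<lambda>i. (s * (CJ + d * CY)) * inverse (real (Suc i))) \<longlonglongrightarrow> (s * (CJ + d * CY)) * 0"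
      by (intro tendsto_mult_left LIMSEQ_inverse_real_of_nat)
    then show "(\<lambda>i. (s / real (Suc i)) * (CJ + d * CY)) \<longlonglongrightarrow> 0"
      by (simp add: divide_inverse mult_ac)
    have "integral\<^sup>L lborel (X M) \<le> (s / real (Suc i)) * (CJ + d * CY)" if i: "M \<le> real (Suc i)" for i
    proof -
      have n1: "real (Suc i) \<ge> 1" by simp
      have "integral\<^sup>L lborel (X M) \<le> integral\<^sup>L lborel (X (real (Suc i)))"
      proof (rule integral_mono[OF iX[OF M] iX[OF n1]])
        fix x
        have "eta M x \<le> eta (real (Suc i)) x"
        proof (cases "\<sigma> * ln (norm x) \<ge> 0")
          case True
          then show ?thesis unfolding eta_def using M i by (intro cut_mono tau) auto
        next
          case False
          then have "eta M x = 0" unfolding eta_def using M by (intro cut_outside tau q) auto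
          then show ?thesis using eta_bounds by simp
        qed
        then show "X M x \<le> X (real (Suc i)) x"
          unfolding X_def using neg_part_bounds(1) picone_nonneg[OF p] by (intro mult_right_mono) auto
      qed
      also have "\<dots> \<le> (s / real (Suc i)) * (CJ + d * CY)" by (rule X_le[OF n1])
      finally show ?thesis .
    qed
    moreover obtain N :: nat where "M \<le> real N" using real_arch_simple by blast
    ultimately show "\<exists>N. \<forall>i\<ge>N. integral\<^sup>L lborel (X M) \<le> (s / real (Suc i)) * (CJ + d * CY)"
      by (intro exI[of _ N]) auto
  qed
  then have "integral\<^sup>L lborel (X M) = 0"
    using Xnn by (intro antisym Bochner_Integration.integral_nonneg) auto
  then have "AE x in lborel. X M x = 0"
    using integral_nonneg_eq_0_iff_AE[OF iX[OF M]] Xnn by simp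
  then show ?thesis by (simp add: X_def)
qed

text \<open>The exponent N makes the radial field divergence-free. Once G = H where k(f) is nonzero
  inside the cutoff, the tested identity says that k(f) |x|^-N times the derivative of the cutoff
  has integral 0. This product is nonpositive, since f > 0 where the cutoff rises; as the derivative
  is strictly negative on (\<tau>, M), k(f) must vanish there.\<close>

lemma f_nonneg_AE:
  assumes M: "M \<ge> 1"
  shows "AE x in lborel. x \<noteq> 0 \<longrightarrow> 0 < \<sigma> * ln (norm x) \<longrightarrow> \<sigma> * ln (norm x) < M \<longrightarrow> f x \<ge> 0"
proof -
  have M0: "M > 0" using M by simp
  let ?A = "log_shell \<sigma> 0 M :: (real^'n) set"
  let ?N = "real CARD('n)"
  note E = eta_C1c[OF M0]
  define L where "L x = norm x powr (- ?N) * (x \<bullet> (neg_part (f x) *\<^sub>R Deta M x + (eta M x * neg_part' (f x)) *\<^sub>R (G x - H x)))" for x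
  define B where "B x = neg_part (f x) * (norm x powr (- ?N) * cut' q \<tau> M (\<sigma> * ln (norm x)))" for x :: "real^'n"
  have L': "L = (\<lambda>x. norm x powr (- ?N) * (x \<bullet> (neg_part (ln (z x) + \<gamma> * ln (norm x) - ln m) *\<^sub>R Deta M x +
      (eta M x * neg_part' (ln (z x) + \<gamma> * ln (norm x) - ln m)) *\<^sub>R ((1 / z x) *\<^sub>R g x + (\<gamma> / (norm x)\<^sup>2) *\<^sub>R x))))"
    by (simp only: L_def[abs_def] G_minus_H f_def)
  have R: "integral\<^sup>L lborel L = (?N - ?N) * (\<integral>x. norm x powr (- ?N) * (eta M x * neg_part (ln (z x) + \<gamma> * ln (norm x) - ln m)) \<partial>lborel)"
    unfolding L'
    by (rule composite_radial_field(1)[OF p zg gLp z E zero_notin_log_shell DERIV_neg_part continuous_on_neg_part'])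
  have iL: "integrable lborel L"
    unfolding L'
    by (rule composite_radial_field(2)[OF p zg gLp z E zero_notin_log_shell DERIV_neg_part continuous_on_neg_part'])
  have L0: "integral\<^sup>L lborel L = 0" unfolding R by simp
  have LB: "AE x in lborel. \<sigma> * L x = B x"
    using picone_AE_zero[OF M] AE_lborel_singleton[of "0::real^'n"]
  proof eventually_elim
    case (elim x)
    have x: "x \<noteq> 0" using elim(2) by simp
    have "(eta M x * neg_part' (f x)) *\<^sub>R (G x - H x) = 0"
    proof (cases "eta M x = 0 \<or> f x \<ge> 0")
      case True
      then show ?thesis using neg_part_bounds(5)[of "f x"] by auto
    next
      case False
      then have "neg_part (f x) > 0" using neg_part_bounds(6) by simp
      then have "picone p (G x) (H x) = 0" using elim(1) False w_pos[OF x] by simp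
      then have "G x = H x" by (rule picone_eq_0[OF p])
      then show ?thesis by simp
    qed
    then have "L x = norm x powr (- ?N) * (neg_part (f x) * (x \<bullet> Deta M x))"
      by (simp only: L_def add_0_right inner_scaleR_right)
    then have "\<sigma> * L x = neg_part (f x) * (norm x powr (- ?N) * (\<sigma> * (x \<bullet> Deta M x)))"
      by simp
    also have "\<sigma> * (x \<bullet> Deta M x) = cut' q \<tau> M (\<sigma> * ln (norm x))"
      using x sigma by (auto simp: Deta_def dot_square_norm)
    finally show ?case by (simp only: B_def)
  qed
  have Bneg: "B x \<le> 0" if "x \<noteq> 0" for x
  proof -
    consider "\<sigma> * ln (norm x) \<le> 0" | "0 < \<sigma> * ln (norm x)" "\<sigma> * ln (norm x) \<le> \<tau>" | "\<tau> \<le> \<sigma> * ln (norm x)" by linarith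
    then show ?thesis
    proof cases
      case 1
      then show ?thesis using cut_outside(2)[OF tau(1) M0 q(1)] by (simp add: B_def)
    next
      case 2
      then have "\<bar>ln (norm x)\<bar> \<le> \<tau>" using sigma by auto
      then have "f x > 0" by (rule f_pos[OF that])
      then show ?thesis by (simp add: B_def neg_part_bounds)
    next
      case 3
      have "cut' q \<tau> M (\<sigma> * ln (norm x)) \<le> 0" by (rule cut_tail(4)[OF tau(1) M0 3])
      then show ?thesis unfolding B_def using neg_part_bounds(1) by (intro mult_nonneg_nonpos) auto
    qed
  qed
  have "AE x in lborel. - (\<sigma> * L x) \<ge> 0"
    using LB AE_lborel_singleton[of "0::real^'n"]
  proof eventually_elim
    case (elim x)
    then show ?case using Bneg[of x] by simp
  qed
  moreover have "integrable lborel (\<lambda>x. - (\<sigma> * L x))" using iL by simp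
  moreover have "integral\<^sup>L lborel (\<lambda>x. - (\<sigma> * L x)) = 0" using L0 by simp
  ultimately have "AE x in lborel. - (\<sigma> * L x) = 0"
    using integral_nonneg_eq_0_iff_AE by blast
  then show ?thesis using LB
  proof eventually_elim
    case (elim x)
    have B0: "B x = 0" using elim by simp
    show ?case
    proof (intro impI)
      assume x: "x \<noteq> 0" and t: "0 < \<sigma> * ln (norm x)" "\<sigma> * ln (norm x) < M"
      show "f x \<ge> 0"
      proof (cases "\<sigma> * ln (norm x) \<le> \<tau>")
        case True
        then have "\<bar>ln (norm x)\<bar> \<le> \<tau>" using sigma t by auto
        then show ?thesis using f_pos[OF x] by simp
      next
        case False
        then have "cut' q \<tau> M (\<sigma> * ln (norm x)) < 0" using t by (intro cut_tail(3)[OF tau(1) M0 _ _ q(1)]) auto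
        then have "neg_part (f x) = 0" using B0 x by (simp add: B_def)
        then show ?thesis using neg_part_bounds(6)[of "f x"] by linarith
      qed
    qed
  qed
qed

text \<open>The set where f < 0 on the chosen side of the sphere is open by continuity and null by
  the preceding lemma, hence empty.\<close>

lemma comparison:
  assumes x: "x \<noteq> 0" "0 < \<sigma> * ln (norm x)"
  shows "m * norm x powr (- \<gamma>) \<le> z x"
proof -
  define S where "S = {x::real^'n. x \<noteq> 0 \<and> 0 < \<sigma> * ln (norm x) \<and> f x < 0}"
  have cf: "continuous_on (- {0}) f"
    unfolding f_def[abs_def] by (intro continuous_intros z) (use z(2) in \<open>auto simp: less_imp_neq[symmetric]\<close>)
  have S': "S = (- {0} \<inter> (\<lambda>x. \<sigma> * ln (norm x)) -` {0<..}) \<inter> (- {0} \<inter> f -` {..<0})" by (auto simp: S_def)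
  have "open S"
    unfolding S' by (intro open_Int continuous_open_preimage) (auto intro!: continuous_intros cf)
  moreover have "AE x in lborel. \<forall>n::nat. x \<noteq> 0 \<longrightarrow> 0 < \<sigma> * ln (norm x) \<longrightarrow> \<sigma> * ln (norm x) < real (Suc n) \<longrightarrow> f x \<ge> 0"
    unfolding AE_all_countable by (intro allI f_nonneg_AE) simp
  then have "AE x in lborel. x \<notin> S"
  proof eventually_elim
    case (elim x)
    obtain n :: nat where "\<sigma> * ln (norm x) < real n" using reals_Archimedean2 by blast
    then have "\<sigma> * ln (norm x) < real (Suc n)" by simp
    then show ?case using elim by (force simp: S_def)
  qed
  ultimately have "S = {}" by (rule open_AE_empty)
  then have "f x \<ge> 0" using x by (force simp: S_def)
  then have "w x * 1 \<le> w x * exp (f x)" using w_pos[OF x(1)] by (intro mult_left_mono) auto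
  then show ?thesis using z_eq_w_exp[OF x(1)] by (simp add: w_def)
qed

end

subsection \<open>Reduction to Borel measurable data\<close>

lemma borel_vector_version:
  fixes h :: "real^'n \<Rightarrow> real^'n"
  assumes "h \<in> borel_measurable lebesgue"
  obtains g where "g \<in> borel_measurable borel" "AE x in lborel. h x = g x"
proof -
  have "\<exists>g'\<in>borel_measurable lborel. AE x in lborel. h x $ i = g' x" for i
  proof (rule completion_ex_borel_measurable_real)
    show "(\<lambda>x. h x $ i) \<in> borel_measurable lebesgue"
      using borel_measurable_continuous_on[OF _ assms, of "\<lambda>y. y $ i"] by (simp add: continuous_on_component)
  qed
  then obtain g where g: "\<And>i. g i \<in> borel_measurable lborel" "\<And>i. AE x in lborel. h x $ i = g i x"
    unfolding Bex_def by metis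
  show thesis
  proof (rule that[of "\<lambda>x. \<chi> i. g i x"])
    have gb: "g i \<in> borel_measurable borel" for i using g(1)[of i] by simp
    show "(\<lambda>x. \<chi> i. g i x) \<in> borel_measurable borel"
      unfolding borel_measurable_euclidean_space[of "\<lambda>x. \<chi> i. g i x"]
    proof
      fix b :: "real^'n" assume "b \<in> Basis"
      then obtain i where "b = axis i 1" by (auto simp: Basis_vec_def)
      then show "(\<lambda>x. (\<chi> i. g i x) \<bullet> b) \<in> borel_measurable borel"
        using gb[of i] by (simp add: inner_axis)
    qed
    have "AE x in lborel. \<forall>i. h x $ i = g i x"
      using g(2) by (intro eventually_all_finite)
    then show "AE x in lborel. h x = (\<chi> i. g i x)"
      by eventually_elim (simp add: vec_eq_iff)
  qed
qed

lemma integral_lebesgue_AE_borel: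
  fixes f :: "'a::euclidean_space \<Rightarrow> 'b::euclidean_space"
  assumes f: "f \<in> borel_measurable borel" and ae: "AE x in lborel. h x = f x"
  shows "integral\<^sup>L lebesgue h = integral\<^sup>L lborel f" "integrable lebesgue h \<longleftrightarrow> integrable lborel f"
proof -
  have f1: "f \<in> borel_measurable lborel" using f by simp
  have f2: "f \<in> borel_measurable lebesgue" using f1 by (rule measurable_completion)
  have ae': "AE x in lebesgue. h x = f x" using ae by (simp add: AE_completion_iff)
  have ae'': "AE x in lebesgue. f x = h x" using ae' by eventually_elim simp
  have h: "h \<in> borel_measurable lebesgue"
    by (rule borel_measurable_AE[OF f2 ae''])
  show "integral\<^sup>L lebesgue h = integral\<^sup>L lborel f"
    using integral_cong_AE[OF h f2 ae'] integral_completion[OF f1] by simp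
  show "integrable lebesgue h \<longleftrightarrow> integrable lborel f"
    using integrable_cong_AE[OF h f2 ae'] integrable_completion[OF f1] by simp
qed

lemma loc_int_bounded_product_integrable:
  fixes V :: "'a::euclidean_space \<Rightarrow> 'b::euclidean_space" and D :: "'a \<Rightarrow> 'b"
  assumes V: "loc_int V" and A: "compact A" and D: "continuous_on UNIV D" "\<And>x. x \<notin> A \<Longrightarrow> D x = 0"
  shows "integrable lborel (\<lambda>x. V x \<bullet> D x)"
proof -
  have "compact (D ` A)" using A D(1) by (auto intro: compact_continuous_image continuous_on_subset)
  then obtain M where M: "\<And>x. x \<in> A \<Longrightarrow> norm (D x) \<le> M"
    using compact_imp_bounded by (fastforce simp: bounded_iff)
  have "integrable lborel (\<lambda>x. norm (indicator A x *\<^sub>R V x) * M)"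
    using loc_int_compact[OF V A] by (intro integrable_mult_left) (rule integrable_norm)
  then show ?thesis
  proof (rule Bochner_Integration.integrable_bound)
    have [measurable]: "V \<in> borel_measurable borel" "D \<in> borel_measurable borel"
      using loc_int_measurable[OF V] borel_measurable_continuous_onI[OF D(1)] by auto
    show "(\<lambda>x. V x \<bullet> D x) \<in> borel_measurable lborel" by measurable
    show "AE x in lborel. norm (V x \<bullet> D x) \<le> norm (norm (indicat_real A x *\<^sub>R V x) * M)"
    proof (rule AE_I2)
      fix x
      show "norm (V x \<bullet> D x) \<le> norm (norm (indicat_real A x *\<^sub>R V x) * M)"
      proof (cases "x \<in> A")
        case True
        have "norm (V x \<bullet> D x) \<le> norm (V x) * norm (D x)" using Cauchy_Schwarz_ineq2 by auto
        also have "\<dots> \<le> norm (V x) * M" using M[OF True] by (intro mult_left_mono) auto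
        also have "\<dots> \<le> norm (norm (V x) * M)" by simp
        finally show ?thesis using True by simp
      qed (simp add: D(2))
    qed
  qed
qed

lemma test_function_gradient:
  assumes "test_function \<phi>"
  shows "C1c (closure {x. \<phi> x \<noteq> 0}) \<phi> (gradient \<phi>)"
  using assms closure_subset[of "{x. \<phi> x \<noteq> 0}"]
  by (intro test_function_C1c) (auto simp: test_function_def)

text \<open>A shifted function leaves the space of functions of critical integrability but keeps its
  weak gradient. This allows comparison to be run for v + e, which is strictly positive, before v is
  known to be so.\<close>

lemma weak_gradient_add_const:
  assumes "weak_gradient v g" shows "weak_gradient (\<lambda>x. v x + s) g"
  unfolding weak_gradient_def
proof (intro conjI allI impI)
  have lv: "loc_int v" and lg: "loc_int g" using assms by (auto simp: weak_gradient_def)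
  show "loc_int g" by fact
  have "loc_int (\<lambda>_::real^'a. s)" by (intro continuous_loc_int continuous_intros)
  then show "loc_int (\<lambda>x. v x + s)"
    using lv unfolding loc_int_def scaleR_add_right
    by (intro conjI allI Bochner_Integration.integrable_add borel_measurable_add) blast+
  fix \<phi> :: "real^'a \<Rightarrow> real" and i assume t: "test_function \<phi>"
  note c = test_function_gradient[OF t]
  have pd: "partial_deriv i \<phi> x = gradient \<phi> x \<bullet> axis i 1" for x by (simp add: gradient_def inner_axis)
  have i1: "integrable lborel (\<lambda>x. v x * partial_deriv i \<phi> x)"
    using loc_int_bounded_product_integrable[OF lv C1cD(1)[OF c], of "\<lambda>x. partial_deriv i \<phi> x"]
      C1cD(3)[OF c] C1c_gradient_zero[OF c] by (simp add: pd continuous_intros)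
  have i2: "integrable lborel (\<lambda>x. partial_deriv i \<phi> x)"
    unfolding pd by (intro integrable_inner_left C1c_integrable(2)[OF c])
  have "(\<integral>x. partial_deriv i \<phi> x \<partial>lborel) = 0" unfolding pd by (rule integral_C1c_gradient[OF c])
  then have "(\<integral>x. (v x + s) * partial_deriv i \<phi> x \<partial>lborel) = (\<integral>x. v x * partial_deriv i \<phi> x \<partial>lborel)"
    using i1 i2 by (simp add: distrib_right)
  then show "(\<integral>x. (v x + s) * partial_deriv i \<phi> x \<partial>lborel) = - (\<integral>x. g x $ i * \<phi> x \<partial>lborel)"
    using assms t by (simp add: weak_gradient_def)
qed

lemma AE_continuous_nonneg:
  fixes v :: "'a::euclidean_space \<Rightarrow> real"
  assumes v: "continuous_on (- {0}) v" and ae: "AE x in lborel. 0 \<le> v x" and x: "x \<noteq> 0"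
  shows "0 \<le> v x"
proof -
  have "open (- {0} \<inter> v -` {..<0})" by (intro continuous_open_preimage v) auto
  moreover have "AE x in lborel. x \<notin> - {0} \<inter> v -` {..<0}" using ae by eventually_elim auto
  ultimately have "- {0} \<inter> v -` {..<0} = {}" by (rule open_AE_empty)
  then show ?thesis using x by force
qed

text \<open>A supersolution is given through -u, so the chosen weak gradient is one of -u;
  \<open>g\<close> is minus a Borel version of it and serves as the weak gradient of v. The sign of
  \<open>Q\<close> then removes the right-hand side.\<close>

lemma weak_supersolution_borel:
  fixes u v Q :: "real^'n \<Rightarrow> real"
  assumes p: "1 < p" and mu: "0 \<le> \<mu>" and Q: "AE x in lebesgue. 0 \<le> Q x"
    and u: "AE x in lebesgue. 0 \<le> u x" "weak_supersolution p \<mu> Q u" and rep: "continuous_rep u v"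
  obtains g where "weak_gradient v g" "integrable lborel (\<lambda>x. norm (g x) powr p)"
    "\<And>A \<phi> D. C1c A \<phi> D \<Longrightarrow> 0 \<notin> A \<Longrightarrow> (\<And>x. 0 \<le> \<phi> x) \<Longrightarrow>
      (\<integral>x. (\<mu> * norm x powr (- p) * v x powr (p - 1)) * \<phi> x \<partial>lborel) \<le> (\<integral>x. plap p (g x) \<bullet> D x \<partial>lborel)"
    "\<And>x. x \<noteq> 0 \<Longrightarrow> 0 \<le> v x"
proof -
  define U where "U x = - u x" for x
  define h where "h = weak_grad U"
  have sub: "weak_subsolution p \<mu> Q U" using u(2) by (simp add: weak_supersolution_def U_def[abs_def])
  then have "U \<in> D1p p" by (simp add: weak_subsolution_def)
  then have "weakly_differentiable U" and hLp: "in_Lp p h" by (auto simp: D1p_def h_def)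
  then have wg: "has_weak_gradient U h"
    unfolding weakly_differentiable_def h_def weak_grad_def by (metis someI_ex)
  obtain g0 where g0: "g0 \<in> borel_measurable borel" "AE x in lborel. h x = g0 x"
    using hLp borel_vector_version[of h] by (auto simp: in_Lp_def)
  define g where "g x = - g0 x" for x
  have mg[measurable]: "g \<in> borel_measurable borel" using g0(1) by (simp add: g_def[abs_def])
  have hg: "AE x in lborel. h x = - g x" using g0(2) by (simp add: g_def)
  have cv: "continuous_on (- {0}) v" and vu: "AE x in lborel. v x = u x"
    using rep by (auto simp: continuous_rep_def AE_completion_iff Compl_eq_Diff_UNIV)
  \<comment> \<open>The value of \<open>v\<close> at the origin is arbitrary, but a single
    exceptional point does not affect Borel measurability.\<close>
  have mv[measurable]: "v \<in> borel_measurable borel"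
    by (rule borel_measurable_continuous_countable_exceptions[of "{0}"]) (use cv in auto)
  have Uv: "AE x in lborel. U x = - v x" using vu by eventually_elim (simp add: U_def)
  have vae: "AE x in lborel. 0 \<le> v x" using vu u(1) unfolding AE_completion_iff by eventually_elim simp
  have vnn: "0 \<le> v x" if "x \<noteq> 0" for x by (rule AE_continuous_nonneg[OF cv vae that])
  have gLp: "integrable lborel (\<lambda>x. norm (g x) powr p)"
  proof -
    have "AE x in lborel. norm (h x) powr p = norm (g x) powr p" using hg by eventually_elim simp
    from integral_lebesgue_AE_borel(2)[OF _ this] show ?thesis using hLp by (simp add: in_Lp_def)
  qed
  have lg: "loc_int g" using Lp_loc_int[OF _ mg gLp] p by simp
  have lv: "loc_int v"
    unfolding loc_int_def
  proof (intro conjI allI)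
    fix R
    have "set_integrable lebesgue (cball 0 R) U"
      using wg compact_cball unfolding has_weak_gradient_def locally_integrable_def by blast
    then have iU: "integrable lebesgue (\<lambda>x. indicator (cball 0 R) x *\<^sub>R U x)" by (simp add: set_integrable_def)
    have aU: "AE x in lborel. indicator (cball 0 R) x *\<^sub>R U x = - (indicator (cball 0 R) x *\<^sub>R v x)"
      using Uv by eventually_elim simp
    have mU: "(\<lambda>x. - (indicator (cball 0 R) x *\<^sub>R v x)) \<in> borel_measurable borel"
      by (intro borel_measurable_uminus borel_measurable_scaleR borel_measurable_indicator mv) auto
    have "integrable lborel (\<lambda>x. - (indicator (cball 0 R) x *\<^sub>R v x))"
      by (rule integral_lebesgue_AE_borel(2)[OF mU aU, THEN iffD1, OF iU])
    from Bochner_Integration.integrable_minus[OF this]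
    show "integrable lborel (\<lambda>x. indicator (cball 0 R) x *\<^sub>R v x)" by simp
  qed (rule mv)
  have wvg: "weak_gradient v g"
    unfolding weak_gradient_def
  proof (intro conjI allI impI lv lg)
    fix \<phi> :: "real^'n \<Rightarrow> real" and i assume t: "test_function \<phi>"
    note c = test_function_gradient[OF t]
    have pd: "partial_deriv i \<phi> x = gradient \<phi> x $ i" for x by (simp add: gradient_def)
    have "continuous_on UNIV (\<lambda>x. gradient \<phi> x $ i)" by (intro continuous_intros C1cD(3)[OF c])
    then have [measurable]: "partial_deriv i \<phi> \<in> borel_measurable borel" "\<phi> \<in> borel_measurable borel"
      using C1cD(5)[OF c] by (auto intro: borel_measurable_continuous_onI simp flip: pd)
    have [measurable]: "(\<lambda>x. g x $ i) \<in> borel_measurable borel"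
      using borel_measurable_continuous_on[OF _ mg, of "\<lambda>y. y $ i"] by (simp add: continuous_on_component)
    have a1: "AE x in lborel. U x * partial_deriv i \<phi> x = - (v x * partial_deriv i \<phi> x)"
      using Uv by eventually_elim simp
    have a2: "AE x in lborel. h x $ i * \<phi> x = - (g x $ i * \<phi> x)" using hg by eventually_elim simp
    have "integral\<^sup>L lebesgue (\<lambda>x. U x * partial_deriv i \<phi> x) = - integral\<^sup>L lebesgue (\<lambda>x. h x $ i * \<phi> x)"
      using wg t by (simp add: has_weak_gradient_def)
    moreover have "integral\<^sup>L lebesgue (\<lambda>x. U x * partial_deriv i \<phi> x) = (\<integral>x. - (v x * partial_deriv i \<phi> x) \<partial>lborel)"
      by (rule integral_lebesgue_AE_borel(1)[OF _ a1]) measurable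
    moreover have "integral\<^sup>L lebesgue (\<lambda>x. h x $ i * \<phi> x) = (\<integral>x. - (g x $ i * \<phi> x) \<partial>lborel)"
      by (rule integral_lebesgue_AE_borel(1)[OF _ a2]) measurable
    ultimately show "(\<integral>x. v x * partial_deriv i \<phi> x \<partial>lborel) = - (\<integral>x. g x $ i * \<phi> x \<partial>lborel)" by simp
  qed
  define V where "V x = plap p (g x)" for x
  define b where "b x = \<mu> * norm x powr (- p) * v x powr (p - 1)" for x
  have mV[measurable]: "V \<in> borel_measurable borel" unfolding V_def plap_def by measurable
  have lV: "loc_int V"
  proof (rule Lp_loc_int[of "p / (p - 1)"])
    show "1 \<le> p / (p - 1)" using p by simp
    show "integrable lborel (\<lambda>x. norm (V x) powr (p / (p - 1)))"
      using gLp by (simp add: V_def norm_plap_powr[OF p])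
  qed (rule mV)
  have cb: "continuous_on (- {0}) b"
    unfolding b_def[abs_def] using vnn p by (intro continuous_intros cv continuous_on_powr') auto
  have mb[measurable]: "b \<in> borel_measurable borel" unfolding b_def by measurable
  have super: "(\<integral>x. b x * \<phi> x \<partial>lborel) \<le> (\<integral>x. V x \<bullet> gradient \<phi> x \<partial>lborel)"
    if B: "compact B" "0 \<notin> B" and t: "test_function \<phi>" and nn: "\<And>x. 0 \<le> \<phi> x" and s: "\<And>x. x \<notin> B \<Longrightarrow> \<phi> x = 0" for B \<phi>
  proof -
    have c: "C1c B \<phi> (gradient \<phi>)" by (rule test_function_C1c[OF t B(1) s])
    have [measurable]: "\<phi> \<in> borel_measurable borel" "gradient \<phi> \<in> borel_measurable borel"
      using borel_measurable_continuous_onI[OF C1cD(3)[OF c]] borel_measurable_continuous_onI[OF C1cD(5)[OF c]] by auto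
    have le: "integral\<^sup>L lebesgue (\<lambda>x. (norm (h x) powr (p - 2) *\<^sub>R h x) \<bullet> gradient \<phi> x
            - \<mu> / norm x powr p * \<bar>U x\<bar> powr (p - 2) * U x * \<phi> x)
        \<le> integral\<^sup>L lebesgue (\<lambda>x. Q x * \<bar>U x\<bar> powr (crit_exp (real CARD('n)) p - 2) * U x * \<phi> x)" (is "?I1 \<le> ?I2")
      using sub t nn unfolding weak_subsolution_def h_def by blast
    \<comment> \<open>The right-hand side is tested with U = -u \<le> 0, so its integrand is
      nonpositive almost everywhere.\<close>
    have "0 \<le> integral\<^sup>L lebesgue (\<lambda>x. - (Q x * \<bar>U x\<bar> powr (crit_exp (real CARD('n)) p - 2) * U x * \<phi> x))"
    proof (rule integral_nonneg_AE)
      show "AE x in lebesgue. 0 \<le> - (Q x * \<bar>U x\<bar> powr (crit_exp (real CARD('n)) p - 2) * U x * \<phi> x)"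
        using Q u(1)
      proof eventually_elim
        case (elim x)
        have "0 \<le> Q x * \<bar>U x\<bar> powr (crit_exp (real CARD('n)) p - 2) * u x * \<phi> x"
          using elim nn by (intro mult_nonneg_nonneg) auto
        then show ?case by (simp add: U_def)
      qed
    qed
    then have "?I1 \<le> 0" using le by simp
    moreover have "?I1 = (\<integral>x. b x * \<phi> x - V x \<bullet> gradient \<phi> x \<partial>lborel)"
    proof (rule integral_lebesgue_AE_borel(1))
      show "(\<lambda>x. b x * \<phi> x - V x \<bullet> gradient \<phi> x) \<in> borel_measurable borel" by measurable
      show "AE x in lborel. (norm (h x) powr (p - 2) *\<^sub>R h x) \<bullet> gradient \<phi> x - \<mu> / norm x powr p * \<bar>U x\<bar> powr (p - 2) * U x * \<phi> x
         = b x * \<phi> x - V x \<bullet> gradient \<phi> x"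
        using hg Uv vae
      proof eventually_elim
        case (elim x)
        have "v x powr (p - 2) * v x = v x powr (p - 1)"
          using elim(3) p by (cases "v x = 0") (auto simp: powr_diff powr_numeral power2_eq_square)
        then have "- (\<mu> / norm x powr p * \<bar>U x\<bar> powr (p - 2) * U x * \<phi> x) = b x * \<phi> x"
          using elim by (simp add: b_def powr_minus_divide mult.assoc)
        moreover have "(norm (h x) powr (p - 2) *\<^sub>R h x) \<bullet> gradient \<phi> x = - (V x \<bullet> gradient \<phi> x)"
          using elim by (simp add: V_def plap_def)
        ultimately show ?case by linarith
      qed
    qed
    moreover have "integrable lborel (\<lambda>x. b x * \<phi> x)"
    proof -
      have "continuous_on B (\<lambda>x. b x * \<phi> x)"
        using B(2) by (intro continuous_intros continuous_on_subset[OF cb] continuous_on_subset[OF C1cD(5)[OF c]]) auto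
      from borel_integrable_compact[OF B(1) this]
      have "integrable lborel (\<lambda>x. indicator B x *\<^sub>R (b x * \<phi> x))" .
      moreover have "(\<lambda>x. indicator B x *\<^sub>R (b x * \<phi> x)) = (\<lambda>x. b x * \<phi> x)"
        using s by (auto simp: indicator_def fun_eq_iff)
      ultimately show ?thesis by simp
    qed
    moreover have "integrable lborel (\<lambda>x. V x \<bullet> gradient \<phi> x)"
      by (rule loc_int_bounded_product_integrable[OF lV B(1) C1cD(3)[OF c] C1c_gradient_zero[OF c]])
    ultimately show ?thesis by simp
  qed
  have "(\<integral>x. b x * \<phi> x \<partial>lborel) \<le> (\<integral>x. V x \<bullet> D x \<partial>lborel)"
    if "C1c A \<phi> D" "0 \<notin> A" "\<And>x. 0 \<le> \<phi> x" for A \<phi> D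
    by (rule C1c_supersolution[OF lV cb super that])
  then show thesis
    using that[OF wvg gLp _ vnn] unfolding b_def V_def by blast
qed

subsection \<open>The two comparison steps\<close>

text \<open>The points with e^-1 \<le> |x| \<le> e where the strict inequality fails form a compact
  set that misses the unit sphere, so |ln |x|| has a positive minimum on it.\<close>

lemma shell_near_sphere:
  fixes z :: "'a::euclidean_space \<Rightarrow> real"
  assumes z: "continuous_on (- {0}) z" and m: "\<And>y. norm y = 1 \<Longrightarrow> m < z y"
  obtains \<tau> where "\<tau> > 0" "\<And>x. x \<noteq> 0 \<Longrightarrow> \<bar>ln (norm x)\<bar> \<le> \<tau> \<Longrightarrow> m * norm x powr (- \<gamma>) < z x"
proof -
  define F where "F x = z x - m * norm x powr (- \<gamma>)" for x
  let ?B = "log_shell 1 (- 1) 1 :: 'a set"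
  have B: "compact ?B" by (rule compact_log_shell) simp
  have cF: "continuous_on (- {0}) F" unfolding F_def by (intro continuous_intros z) auto
  have BU: "?B \<subseteq> - {0}" by (auto simp: log_shell_def)
  have cFB: "continuous_on ?B F" by (rule continuous_on_subset[OF cF BU])
  define C where "C = ?B \<inter> F -` {..0}"
  have "closed C" unfolding C_def by (rule continuous_closed_preimage[OF cFB compact_imp_closed[OF B] closed_atMost])
  then have C: "compact C" using B compact_Int_closed[OF B] unfolding C_def by (metis inf.left_idem)
  show thesis
  proof (cases "C = {}")
    case True
    show thesis
    proof (rule that[of 1])
      fix x :: 'a assume "x \<noteq> 0" "\<bar>ln (norm x)\<bar> \<le> 1"
      then have "x \<in> ?B" by (auto simp: log_shell_def)
      then show "m * norm x powr (- \<gamma>) < z x" using True by (force simp: C_def F_def)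
    qed simp
  next
    case False
    have "continuous_on C (\<lambda>x. \<bar>ln (norm x)\<bar>)"
      using BU by (intro continuous_intros) (auto simp: C_def)
    from continuous_attains_inf[OF C False this]
    obtain x0 where x0: "x0 \<in> C" "\<And>x. x \<in> C \<Longrightarrow> \<bar>ln (norm x0)\<bar> \<le> \<bar>ln (norm x)\<bar>" by blast
    have x00: "x0 \<noteq> 0" using x0(1) BU by (auto simp: C_def)
    have pos: "\<bar>ln (norm x0)\<bar> > 0"
    proof (rule ccontr)
      assume "\<not> \<bar>ln (norm x0)\<bar> > 0"
      then have "ln (norm x0) = 0" by simp
      then have n1: "norm x0 = 1" using x00 by simp
      then have "F x0 > 0" using m[OF n1] by (simp add: F_def)
      then show False using x0(1) by (simp add: C_def)
    qed
    show thesis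
    proof (rule that[of "min 1 (\<bar>ln (norm x0)\<bar> / 2)"])
      show "min 1 (\<bar>ln (norm x0)\<bar> / 2) > 0" using pos by simp
      fix x :: 'a assume x: "x \<noteq> 0" "\<bar>ln (norm x)\<bar> \<le> min 1 (\<bar>ln (norm x0)\<bar> / 2)"
      then have "x \<in> ?B" by (auto simp: log_shell_def)
      moreover have "x \<notin> C" using x0(2)[of x] x pos by auto
      ultimately show "m * norm x powr (- \<gamma>) < z x" by (simp add: C_def F_def)
    qed
  qed
qed

lemma supersolution_comparison:
  fixes z :: "real^'n \<Rightarrow> real"
  assumes p: "1 < p" and sigma: "\<sigma> = 1 \<or> \<sigma> = - 1"
    and gam: "0 \<le> \<gamma>" "\<sigma> * (\<gamma> * p + p - real CARD('n)) > 0"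
    and root: "(p - 1) * \<gamma> powr p - (real CARD('n) - p) * \<gamma> powr (p - 1) + \<nu> = 0"
    and zg: "weak_gradient z g" and gLp: "integrable lborel (\<lambda>x. norm (g x) powr p)"
    and z: "continuous_on (- {0}) z" "\<And>x. x \<noteq> 0 \<Longrightarrow> z x > 0"
    and super: "\<And>A \<phi> D. C1c A \<phi> D \<Longrightarrow> 0 \<notin> A \<Longrightarrow> (\<And>x. 0 \<le> \<phi> x) \<Longrightarrow>
      (\<integral>x. (\<nu> * norm x powr (- p) * z x powr (p - 1)) * \<phi> x \<partial>lborel) \<le> (\<integral>x. plap p (g x) \<bullet> D x \<partial>lborel)"
    and m: "m > 0" "\<And>y. norm y = 1 \<Longrightarrow> m < z y"
    and x: "x \<noteq> 0" "0 < \<sigma> * ln (norm x)"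
  shows "m * norm x powr (- \<gamma>) \<le> z x"
proof -
  obtain \<tau> where tau: "\<tau> > 0" "\<And>x. x \<noteq> 0 \<Longrightarrow> \<bar>ln (norm x)\<bar> \<le> \<tau> \<Longrightarrow> m * norm x powr (- \<gamma>) < z x"
    using shell_near_sphere[OF z(1) m(2)] by blast
  \<comment> \<open>At least p for \<open>cutoff_Young\<close>, and at least 2 so that the cutoff
    and its derivative vanish together at the ends.\<close>
  define q where "q = nat \<lceil>p\<rceil> + 2"
  have q: "q \<ge> 2" "real q \<ge> p" by (auto simp: q_def) linarith
  have "radial_comparison p \<gamma> \<nu> m \<sigma> \<tau> q z g"
    by (rule radial_comparison.intro[OF p sigma gam root zg gLp z super m(1) tau q])
  then show ?thesis using x by (rule radial_comparison.comparison)
qed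

text \<open>At c = (N - p)/p the polynomial expression equals \<mu> - c^p < 0, whereas at 0 and at
  (N - p)/(p - 1) it equals \<mu> \<ge> 0. The intermediate value theorem gives a root on each side
  of c, and there are only two roots.\<close>

lemma gamma_roots_separated:
  assumes p: "1 < p" "p < N" and mu: "0 \<le> \<mu>" "\<mu> < ((N - p) / p) powr p"
    and roots: "\<gamma>1 < \<gamma>2" "gamma_roots N p \<mu> = {\<gamma>1, \<gamma>2}"
  shows "\<gamma>1 < (N - p) / p" "(N - p) / p < \<gamma>2"
proof -
  define h where "h t = (p - 1) * t powr p - (N - p) * t powr (p - 1) + \<mu>" for t
  have cont: "continuous_on {0..b} h" for b
    unfolding h_def using p by (intro continuous_intros continuous_on_powr') auto
  define c where "c = (N - p) / p"
  have c: "c > 0" using p by (simp add: c_def)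
  have pw: "t powr p = t powr (p - 1) * t" if "t > 0" for t :: real using that by (simp add: powr_diff)
  have hc: "h c < 0"
  proof -
    have "(p - 1) * c powr p - (N - p) * c powr (p - 1) = - (c powr p)"
    proof -
      have "N - p = p * c" using p by (simp add: c_def)
      then show ?thesis using pw[OF c] by (simp add: algebra_simps)
    qed
    then show ?thesis using mu(2) by (simp add: h_def c_def)
  qed
  have root_iff: "t \<in> {\<gamma>1, \<gamma>2} \<longleftrightarrow> 0 \<le> t \<and> h t = 0" for t
    unfolding roots(2)[symmetric] by (simp add: gamma_roots_def h_def)
  have "h 0 \<ge> 0" using mu(1) p by (simp add: h_def)
  then obtain t1 where t1: "0 \<le> t1" "t1 \<le> c" "h t1 = 0"
    using IVT2'[of h c 0 0] hc c cont[of c] by auto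
  define d where "d = (N - p) / (p - 1)"
  have d: "d > 0" "c \<le> d" using p by (auto simp: d_def c_def intro: divide_left_mono)
  have hd: "h d \<ge> 0"
  proof -
    have "N - p = (p - 1) * d" using p by (simp add: d_def)
    then show ?thesis unfolding h_def pw[OF d(1)] using mu(1) by simp
  qed
  have "continuous_on {c..d} h" using cont[of d] c by (auto intro: continuous_on_subset)
  then obtain t2 where t2: "c \<le> t2" "t2 \<le> d" "h t2 = 0"
    using IVT'[of h c 0 d] hc hd d by auto
  have "t1 \<noteq> c" "t2 \<noteq> c" using hc t1(3) t2(3) by auto
  then have "t1 < c" "c < t2" using t1 t2 by auto
  moreover have "t1 \<in> {\<gamma>1, \<gamma>2}" "t2 \<in> {\<gamma>1, \<gamma>2}" using root_iff t1 t2 c by auto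
  ultimately show "\<gamma>1 < (N - p) / p" "(N - p) / p < \<gamma>2" using roots(1) by (auto simp: c_def)
qed

theorem theorem1p2:
  fixes p \<mu> \<gamma>1 \<gamma>2 :: real
    and Q u v :: "real^'n \<Rightarrow> real"
  assumes p: "1 < p" "p < real CARD('n)"
    and mu: "0 \<le> \<mu>" "\<mu> < ((real CARD('n) - p) / p) powr p"
    and gamma: "\<gamma>1 < \<gamma>2" "gamma_roots (real CARD('n)) p \<mu> = {\<gamma>1, \<gamma>2}"
    and Q: "in_Linfty Q" "AE x in lebesgue. 0 \<le> Q x"
    and u: "u \<in> D1p p" "AE x in lebesgue. 0 \<le> u x" "weak_solution p \<mu> Q u"
    and rep: "continuous_rep u v"
  shows "(AE x in lebesgue. norm x < 1 \<longrightarrow>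
            u x \<ge> (INF y\<in>sphere 0 1. v y) * norm x powr (- \<gamma>1)) \<and>
         (AE x in lebesgue. norm x > 1 \<longrightarrow>
            u x \<ge> (INF y\<in>sphere 0 1. v y) * norm x powr (- \<gamma>2))"
proof -
  let ?N = "real CARD('n)"
  define m where "m = (INF y\<in>sphere 0 1. v y)"
  have "weak_supersolution p \<mu> Q u" using u(3) by (simp add: weak_solution_def)
  from weak_supersolution_borel[OF p(1) mu(1) Q(2) u(2) this rep]
  obtain g where wg: "weak_gradient v g" and gLp: "integrable lborel (\<lambda>x. norm (g x) powr p)"
    and super: "\<And>A \<phi> D. C1c A \<phi> D \<Longrightarrow> 0 \<notin> A \<Longrightarrow> (\<And>x. 0 \<le> \<phi> x) \<Longrightarrow>
      (\<integral>x. (\<mu> * norm x powr (- p) * v x powr (p - 1)) * \<phi> x \<partial>lborel) \<le> (\<integral>x. plap p (g x) \<bullet> D x \<partial>lborel)"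
    and vnn: "\<And>x. x \<noteq> 0 \<Longrightarrow> 0 \<le> v x" by blast
  have cv: "continuous_on (- {0}) v" and vu: "AE x in lebesgue. v x = u x"
    using rep by (auto simp: continuous_rep_def Compl_eq_Diff_UNIV)
  have ms: "m \<le> v y" if "norm y = 1" for y
    unfolding m_def
  proof (rule cINF_lower)
    have "0 \<le> v x" if "x \<in> sphere 0 1" for x
    proof (rule vnn)
      show "x \<noteq> 0" using that by auto
    qed
    then show "bdd_below (v ` sphere 0 1)" by (rule bdd_belowI2)
  qed (use that in simp)
  \<comment> \<open>Since \<mu> \<ge> 0 and v \<ge> 0 off the origin, v is also a supersolution for
    the p-Laplacian alone. The zero coefficient lets any \<open>w\<close> stand in the singular
    term, in particular v plus a constant.\<close>
  have super0: "(\<integral>x. (0 * norm x powr (- p) * w x powr (p - 1)) * \<phi> x \<partial>lborel) \<le> (\<integral>x. plap p (g x) \<bullet> D x \<partial>lborel)"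
    if "C1c A \<phi> D" "0 \<notin> A" "\<And>x. 0 \<le> \<phi> x" for A \<phi> D and w :: "real^'n \<Rightarrow> real"
  proof -
    have "0 \<le> (\<integral>x. (\<mu> * norm x powr (- p) * v x powr (p - 1)) * \<phi> x \<partial>lborel)"
      using that(3) mu(1) by (intro Bochner_Integration.integral_nonneg) auto
    then show ?thesis using super[OF that] by simp
  qed
  have bound: "m * norm x powr (- \<gamma>) \<le> v x"
    if m0: "m > 0" and sg: "\<sigma> = 1 \<or> \<sigma> = - 1" and x: "x \<noteq> 0" "0 < \<sigma> * ln (norm x)"
      and cases: "(\<sigma> = - 1 \<and> \<gamma> = \<gamma>1) \<or> (\<sigma> = 1 \<and> \<gamma> = \<gamma>2)" for \<sigma> \<gamma> x
  proof -
    \<comment> \<open>The exponents for \<mu> = 0: the constant inside the ball, and outside it the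
      fundamental solution of the p-Laplacian, with exponent (N - p)/(p - 1).\<close>
    define \<beta> where "\<beta> s = (if s = (1::real) then (?N - p) / (p - 1) else 0)" for s
    have b0: "0 \<le> \<beta> s" "(p - 1) * \<beta> s powr p - (?N - p) * \<beta> s powr (p - 1) + 0 = 0"
      and b1: "s = 1 \<or> s = - 1 \<Longrightarrow> s * (\<beta> s * p + p - ?N) > 0" for s
    proof -
      show "0 \<le> \<beta> s" using p by (simp add: \<beta>_def)
      define d where "d = (?N - p) / (p - 1)"
      have d: "d > 0" "?N - p = (p - 1) * d" using p by (auto simp: d_def)
      have "(p - 1) * d powr p - (?N - p) * d powr (p - 1) = 0"
        unfolding d(2) using d(1) by (simp add: powr_diff)
      then show "(p - 1) * \<beta> s powr p - (?N - p) * \<beta> s powr (p - 1) + 0 = 0"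
        using p by (simp add: \<beta>_def d_def)
      assume s: "s = 1 \<or> s = - 1"
      have "d * p + p - ?N = d" using d(2) by (simp add: algebra_simps)
      then show "s * (\<beta> s * p + p - ?N) > 0" using s d(1) p by (auto simp: \<beta>_def d_def)
    qed
    \<comment> \<open>Adding e > 0 makes v positive, so that its logarithm may be taken, and makes
      the inequality on the sphere strict. Letting e tend to 0 leaves a positive lower bound for
      v.\<close>
    have first: "m * norm y powr (- \<beta> s) \<le> v y"
      if s: "s = 1 \<or> s = - 1" and y: "y \<noteq> 0" "0 < s * ln (norm y)" for s y
    proof (rule field_le_epsilon)
      fix e :: real assume e: "e > 0"
      show "m * norm y powr (- \<beta> s) \<le> v y + e"
      proof (rule supersolution_comparison[OF p(1) s b0(1) b1[OF s] b0(2) weak_gradient_add_const[OF wg] gLp _ _ super0 m0 _ y])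
        show "continuous_on (- {0}) (\<lambda>x. v x + e)" by (intro continuous_intros cv)
        show "0 < v x + e" if "x \<noteq> 0" for x using vnn[OF that] e by simp
        show "m < v y + e" if "norm y = 1" for y using ms[OF that] e by simp
      qed
    qed
    have vpos: "v y > 0" if y: "y \<noteq> 0" for y
    proof (cases "norm y = 1")
      case True
      then show ?thesis using ms m0 by fastforce
    next
      case False
      then have "ln (norm y) \<noteq> 0" using y by simp
      then have "0 < 1 * ln (norm y) \<or> 0 < - 1 * ln (norm y)" by linarith
      then obtain s where "s = 1 \<or> s = - 1" "0 < s * ln (norm y)" by blast
      from first[OF this(1) y this(2)] show ?thesis
        using m0 y by (smt (verit) mult_pos_pos powr_gt_zero zero_less_norm_iff)
    qed
    have "\<gamma> \<in> gamma_roots ?N p \<mu>" using cases gamma(2) by auto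
    then have g1: "0 \<le> \<gamma>" "(p - 1) * \<gamma> powr p - (?N - p) * \<gamma> powr (p - 1) + \<mu> = 0"
      by (auto simp: gamma_roots_def)
    have sep: "\<gamma>1 * p < ?N - p" "?N - p < \<gamma>2 * p"
      using gamma_roots_separated[OF p mu gamma] p by (simp_all add: field_simps)
    have g2: "\<sigma> * (\<gamma> * p + p - ?N) > 0" using cases sep by auto
    show ?thesis
    \<comment> \<open>Now v itself is positive, and the strict inequality on the sphere comes from t
      m < m \<le> v instead of a shift, which the singular term would not tolerate.\<close>
    proof (rule field_le_mult_one_interval)
      fix t :: real assume t: "0 < t" "t < 1"
      have tm: "t * m > 0" "t * m < m" using t m0 by auto
      have "(t * m) * norm x powr (- \<gamma>) \<le> v x"
        by (rule supersolution_comparison[OF p(1) sg g1(1) g2 g1(2) wg gLp cv vpos super tm(1) _ x])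
          (use tm ms in \<open>auto intro: less_le_trans\<close>)
      then show "t * (m * norm x powr (- \<gamma>)) \<le> v x" by (simp add: mult.assoc)
    qed
  qed
  have nz: "AE x in lebesgue. x \<noteq> (0::real^'n)"
    unfolding AE_completion_iff by (rule AE_lborel_singleton)
  have "AE x in lebesgue. norm x < 1 \<longrightarrow> u x \<ge> m * norm x powr (- \<gamma>1)"
    using vu u(2) nz
  proof eventually_elim
    case (elim x)
    show ?case
    proof
      assume "norm x < 1"
      show "m * norm x powr (- \<gamma>1) \<le> u x"
      \<comment> \<open>The logarithm of the ratio to w needs m > 0; otherwise the lower bound is
        nonpositive and u \<ge> 0 suffices.\<close>
      proof (cases "m > 0")
        case True
        have "ln (norm x) < 0" using elim(3) \<open>norm x < 1\<close> by simp
        then show ?thesis using bound[OF True, of "- 1" x \<gamma>1] elim by simp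
      next
        case False
        then have "m * norm x powr (- \<gamma>1) \<le> 0" by (intro mult_nonpos_nonneg) auto
        then show ?thesis using elim by linarith
      qed
    qed
  qed
  moreover have "AE x in lebesgue. norm x > 1 \<longrightarrow> u x \<ge> m * norm x powr (- \<gamma>2)"
    using vu u(2) nz
  proof eventually_elim
    case (elim x)
    show ?case
    proof
      assume "norm x > 1"
      show "m * norm x powr (- \<gamma>2) \<le> u x"
      proof (cases "m > 0")
        case True
        have "ln (norm x) > 0" using elim(3) \<open>norm x > 1\<close> by simp
        then show ?thesis using bound[OF True, of 1 x \<gamma>2] elim by simp
      next
        case False
        then have "m * norm x powr (- \<gamma>2) \<le> 0" by (intro mult_nonpos_nonneg) auto
        then show ?thesis using elim by linarith
      qed
    qed
  qed
  ultimately show ?thesis unfolding m_def by blast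
qed

end
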